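(* The Locally Minimal Defensive Alliance problem (given a graph $G$ and an integer $k$, decide whether $G$ has a locally minimal defensive alliance of size at least $k$) is fixed-parameter tractable when parameterized by the neighbourhood diversity of the input graph.
   Context: All graphs are finite, simple and undirected; $N(v)$ and $N[v]$ denote open and closed neighbourhoods. A non-empty set $S\subseteq V$ is a defensive alliance if for each $v\in S$, $|N[v]\cap S|\ge|N(v)\setminus S|$; it is locally minimal if for every $v\in S$, $S\setminus\{v\}$ is not a defensive alliance. Two vertices $u,v$ have the same type if $N(u)\setminus\{v\}=N(v)\setminus\{u\}$. The neighbourhood diversity of $G$ is the least integer $d$ such that $V(G)$ can be partitioned into $d$ classes in each of which all vertices have the same type. *)

theory Defs
  imports Main "HOL-Library.Disjoint_Sets" "HOL-Library.Log_Nat"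
begin

section \<open>Graphs, defensive alliances and neighbourhood diversity\<close>

text \<open>A graph is given by a vertex set \<open>V\<close> and a set \<open>E\<close> of two-element sets of vertices.\<close>

definition simple_graph :: "'a set \<Rightarrow> 'a set set \<Rightarrow> bool" where
  "simple_graph V E \<longleftrightarrow> finite V \<and> E \<subseteq> {{u, v} | u v. u \<in> V \<and> v \<in> V \<and> u \<noteq> v}"

definition open_nbhd :: "'a set set \<Rightarrow> 'a \<Rightarrow> 'a set" where
  "open_nbhd E v = {u. {u, v} \<in> E}"

definition closed_nbhd :: "'a set set \<Rightarrow> 'a \<Rightarrow> 'a set" where
  "closed_nbhd E v = insert v (open_nbhd E v)"

definition defensive_alliance :: "'a set \<Rightarrow> 'a set set \<Rightarrow> 'a set \<Rightarrow> bool" where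
  "defensive_alliance V E S \<longleftrightarrow>
     S \<noteq> {} \<and> S \<subseteq> V \<and> (\<forall>v\<in>S. card (closed_nbhd E v \<inter> S) \<ge> card (open_nbhd E v - S))"

definition locally_minimal_defensive_alliance :: "'a set \<Rightarrow> 'a set set \<Rightarrow> 'a set \<Rightarrow> bool" where
  "locally_minimal_defensive_alliance V E S \<longleftrightarrow>
     defensive_alliance V E S \<and> (\<forall>v\<in>S. \<not> defensive_alliance V E (S - {v}))"

definition same_type :: "'a set set \<Rightarrow> 'a \<Rightarrow> 'a \<Rightarrow> bool" where
  "same_type E u v \<longleftrightarrow> open_nbhd E u - {v} = open_nbhd E v - {u}"

definition neighbourhood_diversity :: "'a set \<Rightarrow> 'a set set \<Rightarrow> nat" where
  "neighbourhood_diversity V E =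
     (LEAST d. \<exists>P. partition_on V P \<and> card P = d \<and> (\<forall>C\<in>P. \<forall>u\<in>C. \<forall>v\<in>C. same_type E u v))"


section \<open>Random access machines\<close>

text \<open>
  The model of computation is a random access machine on natural numbers with structured
  control flow. A state consists of registers, which a program addresses directly, and of a
  memory, which it addresses indirectly through registers. The only arithmetic is addition and
  truncated subtraction, so that after \<open>t\<close> steps every number has at most \<open>t\<close> bits more than the
  largest number in the input or the program. Counting one step per instruction is therefore
  polynomially related to the running time of Turing machines.
\<close>

type_synonym state = "(nat \<Rightarrow> nat) \<times> (nat \<Rightarrow> nat)"

datatype prog =
    Skip
  | Const nat nat        \<comment> \<open>\<open>Const i a\<close>: register \<open>i\<close> becomes \<open>a\<close>\<close>
  | Add nat nat nat      \<comment> \<open>\<open>Add i j l\<close>: register \<open>i\<close> becomes register \<open>j\<close> + register \<open>l\<close>\<close>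
  | Sub nat nat nat
  | Load nat nat         \<comment> \<open>\<open>Load i j\<close>: register \<open>i\<close> becomes the memory cell addressed by register \<open>j\<close>\<close>
  | Store nat nat        \<comment> \<open>\<open>Store i j\<close>: the memory cell addressed by register \<open>i\<close> becomes register \<open>j\<close>\<close>
  | Seq prog prog
  | IfNZ nat prog prog   \<comment> \<open>\<open>IfNZ\<close> and \<open>WhileNZ\<close> test whether the register is nonzero\<close>
  | WhileNZ nat prog

text \<open>\<open>exec c s t s'\<close>: started in state \<open>s\<close>, the program \<open>c\<close> halts in state \<open>s'\<close> after exactly
  \<open>t\<close> steps.\<close>

inductive exec :: "prog \<Rightarrow> state \<Rightarrow> nat \<Rightarrow> state \<Rightarrow> bool" where
  Skip: "exec Skip s 1 s"
| Const: "exec (Const i a) (r, m) 1 (r(i := a), m)"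
| Add: "exec (Add i j l) (r, m) 1 (r(i := r j + r l), m)"
| Sub: "exec (Sub i j l) (r, m) 1 (r(i := r j - r l), m)"
| Load: "exec (Load i j) (r, m) 1 (r(i := m (r j)), m)"
| Store: "exec (Store i j) (r, m) 1 (r, m(r i := r j))"
| Seq: "exec c s t s' \<Longrightarrow> exec d s' t' s'' \<Longrightarrow> exec (Seq c d) s (t + t') s''"
| If_True: "fst s i \<noteq> 0 \<Longrightarrow> exec c s t s' \<Longrightarrow> exec (IfNZ i c d) s (Suc t) s'"
| If_False: "fst s i = 0 \<Longrightarrow> exec d s t s' \<Longrightarrow> exec (IfNZ i c d) s (Suc t) s'"
| While_True: "fst s i \<noteq> 0 \<Longrightarrow> exec c s t s' \<Longrightarrow> exec (WhileNZ i c) s' t' s'' \<Longrightarrow>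
    exec (WhileNZ i c) s (Suc (t + t')) s''"
| While_False: "fst s i = 0 \<Longrightarrow> exec (WhileNZ i c) s 1 s"

inductive_cases execE:
  "exec Skip s t s'" "exec (Const i a) s t s'" "exec (Add i j l) s t s'" "exec (Sub i j l) s t s'"
  "exec (Load i j) s t s'" "exec (Store i j) s t s'"
inductive_cases exec_SeqE: "exec (Seq c d) s t s'"
inductive_cases exec_IfNZE: "exec (IfNZ i c d) s t s'"
inductive_cases exec_WhileNZE: "exec (WhileNZ i c) s t s'"

lemma exec_deterministic:
  "exec c s t s' \<Longrightarrow> exec c s u s'' \<Longrightarrow> u = t \<and> s'' = s'"
proof (induction arbitrary: u s'' rule: exec.induct)
  case (Seq c s t s' d t' s2)
  from Seq.prems show ?case by (rule exec_SeqE) (use Seq.IH in blast)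
next
  case (If_True s i c t s' d)
  from If_True.prems show ?case
    by (rule exec_IfNZE) (auto dest: If_True.IH simp: If_True.hyps)
next
  case (If_False s i d t s' c)
  from If_False.prems show ?case
    by (rule exec_IfNZE) (auto dest: If_False.IH simp: If_False.hyps)
next
  case (While_True s i c t s' t' s2)
  from While_True.prems show ?case
    by (rule exec_WhileNZE) (use While_True.IH While_True.hyps in \<open>blast | simp\<close>)+
next
  case (While_False s i c)
  from While_False.prems show ?case
    by (rule exec_WhileNZE) (auto simp: While_False.hyps)
qed (erule execE, simp)+

text \<open>The input is a list of numbers, stored in the memory from address 0 on, with its length
  in register 0; everything else is 0. The output is read off register 0.\<close>

definition initial_state :: "nat list \<Rightarrow> state" where
  "initial_state xs =
     ((\<lambda>_. 0)(0 := length xs), \<lambda>i. if i < length xs then xs ! i else 0)"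

definition result :: "state \<Rightarrow> nat" where
  "result s = fst s 0"

definition computable :: "(nat \<Rightarrow> nat) \<Rightarrow> bool" where
  "computable f \<longleftrightarrow> (\<exists>c. \<forall>n. \<exists>t s. exec c (initial_state [n]) t s \<and> result s = f n)"


section \<open>Fixed-parameter tractability\<close>

text \<open>Number of bits of the input, with one separator per number.\<close>

definition input_size :: "nat list \<Rightarrow> nat" where
  "input_size xs = (\<Sum>x\<leftarrow>xs. Suc (floorlog 2 x))"

text \<open>A parameterized decision problem consists of a set \<open>I\<close> of instances, their encoding as
  machine inputs, the property \<open>Q\<close> to be decided, and the parameter \<open>\<kappa>\<close>. The machine is given
  the instance, but not the value of the parameter.\<close>

definition fixed_parameter_tractable ::
    "'i set \<Rightarrow> ('i \<Rightarrow> nat list) \<Rightarrow> ('i \<Rightarrow> bool) \<Rightarrow> ('i \<Rightarrow> nat) \<Rightarrow> bool" where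
  "fixed_parameter_tractable I enc Q \<kappa> \<longleftrightarrow>
     (\<exists>c f p. computable f \<and>
        (\<forall>x\<in>I. \<exists>t s. exec c (initial_state (enc x)) t s \<and>
           t \<le> f (\<kappa> x) * input_size (enc x) ^ p \<and>
           (result s \<noteq> 0 \<longleftrightarrow> Q x)))"


section \<open>The problem Locally Minimal Defensive Alliance\<close>

text \<open>An instance \<open>(n, E, k)\<close> consists of a graph with vertices \<open>0, \<dots>, n - 1\<close> and an integer.
  It is encoded by the sign and the absolute value of \<open>k\<close>, the number \<open>n\<close>, and the rows of the
  adjacency matrix.\<close>

type_synonym lmda_instance = "nat \<times> nat set set \<times> int"

definition lmda_instances :: "lmda_instance set" where
  "lmda_instances = {(n, E, k). simple_graph {..<n} E}"

fun lmda_encoding :: "lmda_instance \<Rightarrow> nat list" where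
  "lmda_encoding (n, E, k) =
     [if k < 0 then 1 else 0, nat \<bar>k\<bar>, n] @
     [if {i, j} \<in> E then 1 else 0. i \<leftarrow> [0..<n], j \<leftarrow> [0..<n]]"

fun lmda_problem :: "lmda_instance \<Rightarrow> bool" where
  "lmda_problem (n, E, k) \<longleftrightarrow>
     (\<exists>S. locally_minimal_defensive_alliance {..<n} E S \<and> int (card S) \<ge> k)"

fun lmda_parameter :: "lmda_instance \<Rightarrow> nat" where
  "lmda_parameter (n, E, k) = neighbourhood_diversity {..<n} E"

end

theory Submission
  imports Defs
begin

text \<open>
  Whether \<open>S\<close> is a locally minimal defensive alliance depends only on the numbers \<open>x j\<close> of its vertices
  in the type classes \<open>j < d\<close>, and it is a Boolean combination of tests \<open>\<theta> \<le> (\<Sum>j<d. a j * x j)\<close> with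
  coefficients 0 and 1. Instead of integer programming in bounded dimension, an automaton evaluates
  all tests simultaneously while reading the bits of \<open>x\<close>, least significant first: its states
  are the vectors of carries, which lie in \<open>{0..d + 1}\<close>, so the number of states is bounded
  in terms of \<open>d\<close>. The set of states reachable after \<open>n + 2\<close> bits is computed by dynamic programming.
  The machine program is obtained from a small imperative language with arrays and bounded loops,
  whose semantics is a total function and whose running time is polynomial in the largest loop bound.
\<close>

section \<open>A language with bounded loops\<close>

text \<open>Local minimality quantifies over all deletions, but deleting \<open>v\<close> destroys
  an alliance only by leaving nothing or through a neighbour of \<open>v\<close> in \<open>S\<close>
  with no slack. Both are visible in the class counts, so seven tests per class suffice. The carries
  stay small although thresholds grow with the graph: after \<open>i\<close> bits only the quotient
  by \<open>2^i\<close> of a sum of at most \<open>d\<close> numbers below \<open>2^i\<close>, plus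
  \<open>2^i\<close>, is remembered. All carries together are one number below
  \<open>W = B ^ (7 * d)\<close> with \<open>B = 2 ^ (d + 2)\<close>, so that adding codes adds all
  carries at once. The machine only adds and subtracts and is not given the parameter. Hence it
  finds the classes itself, multiplies by \<open>B\<close> through doublings, and takes quotients,
  remainders and halves from tables that are filled by counting. Every loop runs at most
  \<open>W + n + 7 * d + 5\<close> times, and the time is a fixed power of this. The function
  \<open>2 ^ (C * 4 ^ D)\<close> is generous as a bound in the parameter \<open>D\<close>, but it
  absorbs that power by the choice of \<open>C\<close>, and doublings alone compute it.\<close>

datatype aexp = N nat | V nat | A nat aexp | In aexp | Plus aexp aexp | Minus aexp aexp

datatype com = Asg nat aexp | Put nat aexp aexp | Semi com com | Cond aexp com com | Loop nat com

type_synonym store = "(nat \<Rightarrow> nat) \<times> (nat \<Rightarrow> nat \<Rightarrow> nat)"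

fun aval :: "nat list \<Rightarrow> aexp \<Rightarrow> store \<Rightarrow> nat" where
  "aval xs (N a) s = a"
| "aval xs (V x) s = fst s x"
| "aval xs (A a e) s = snd s a (aval xs e s)"
| "aval xs (In e) s = (let i = aval xs e s in if i < length xs then xs ! i else 0)"
| "aval xs (Plus e f) s = aval xs e s + aval xs f s"
| "aval xs (Minus e f) s = aval xs e s - aval xs f s"

fun sem :: "nat list \<Rightarrow> com \<Rightarrow> store \<Rightarrow> store" where
  "sem xs (Asg x e) s = ((fst s)(x := aval xs e s), snd s)"
| "sem xs (Put a e f) s = (fst s, (snd s)(a := (snd s a)(aval xs e s := aval xs f s)))"
| "sem xs (Semi c d) s = sem xs d (sem xs c s)"
| "sem xs (Cond e c d) s = (if aval xs e s \<noteq> 0 then sem xs c s else sem xs d s)"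
| "sem xs (Loop x c) s = (sem xs c ^^ fst s x) s"

fun wf_aexp :: "aexp \<Rightarrow> bool" where
  "wf_aexp (N a) = True"
| "wf_aexp (V x) = True"
| "wf_aexp (A a e) = (a < 32 \<and> wf_aexp e)"
| "wf_aexp (In e) = wf_aexp e"
| "wf_aexp (Plus e f) = (wf_aexp e \<and> wf_aexp f)"
| "wf_aexp (Minus e f) = (wf_aexp e \<and> wf_aexp f)"

fun wf_com :: "com \<Rightarrow> bool" where
  "wf_com (Asg x e) = wf_aexp e"
| "wf_com (Put a e f) = (a < 32 \<and> wf_aexp e \<and> wf_aexp f)"
| "wf_com (Semi c d) = (wf_com c \<and> wf_com d)"
| "wf_com (Cond e c d) = (wf_aexp e \<and> wf_com c \<and> wf_com d)"
| "wf_com (Loop x c) = wf_com c"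

section \<open>Translation into machine code and its cost\<close>

definition var :: "nat \<Rightarrow> nat" where "var x = 2 * x + 1"

definition scr :: "nat \<Rightarrow> nat" where "scr k = 2 * k + 2"

lemma scr_var_simps [simp]:
  "scr i = scr j \<longleftrightarrow> i = j" "var x = var y \<longleftrightarrow> x = y" "scr i \<noteq> var x" "var x \<noteq> scr i"
  "scr i \<noteq> 0" "var x \<noteq> 0" "0 \<noteq> scr i" "0 \<noteq> var x"
  unfolding scr_def var_def by (simp_all, presburger+)

text \<open>Register 0 keeps the length of the input, register \<open>var x\<close> the scalar variable \<open>x\<close>, and
  the registers \<open>scr k, scr (k + 1), \<dots>\<close> are free for the code generated at level \<open>k\<close>. The arrays are
  interleaved behind the input: cell \<open>i\<close> of array \<open>a < 32\<close> has the address \<open>length xs + (32 * i + a)\<close>.\<close>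

definition address :: "nat \<Rightarrow> nat \<Rightarrow> prog" where
  "address k a = Seq (Add (scr k) (scr k) (scr k)) (Seq (Add (scr k) (scr k) (scr k))
     (Seq (Add (scr k) (scr k) (scr k)) (Seq (Add (scr k) (scr k) (scr k))
     (Seq (Add (scr k) (scr k) (scr k)) (Seq (Const (scr (Suc k)) a)
     (Seq (Add (scr k) (scr k) (scr (Suc k))) (Add (scr k) (scr k) 0)))))))"

fun comp_aexp :: "aexp \<Rightarrow> nat \<Rightarrow> prog" where
  "comp_aexp (N a) k = Const (scr k) a"
| "comp_aexp (V x) k = Seq (Const (scr k) 0) (Add (scr k) (scr k) (var x))"
| "comp_aexp (A a e) k = Seq (comp_aexp e k) (Seq (address k a) (Load (scr k) (scr k)))"
| "comp_aexp (In e) k = Seq (comp_aexp e k) (Seq (Sub (scr (Suc k)) 0 (scr k))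
     (IfNZ (scr (Suc k)) (Load (scr k) (scr k)) (Const (scr k) 0)))"
| "comp_aexp (Plus e f) k =
     Seq (comp_aexp e k) (Seq (comp_aexp f (Suc k)) (Add (scr k) (scr k) (scr (Suc k))))"
| "comp_aexp (Minus e f) k =
     Seq (comp_aexp e k) (Seq (comp_aexp f (Suc k)) (Sub (scr k) (scr k) (scr (Suc k))))"

fun comp_com :: "com \<Rightarrow> nat \<Rightarrow> prog" where
  "comp_com (Asg x e) k = Seq (comp_aexp e k) (Seq (Const (scr (Suc k)) 0) (Add (var x) (scr k) (scr (Suc k))))"
| "comp_com (Put a e f) k =
     Seq (comp_aexp e k) (Seq (address k a) (Seq (comp_aexp f (Suc k)) (Store (scr k) (scr (Suc k)))))"
| "comp_com (Semi c d) k = Seq (comp_com c k) (comp_com d k)"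
| "comp_com (Cond e c d) k = Seq (comp_aexp e k) (IfNZ (scr k) (comp_com c k) (comp_com d k))"
| "comp_com (Loop x c) k = Seq (comp_aexp (V x) k)
     (WhileNZ (scr k) (Seq (comp_com c (Suc k))
        (Seq (Const (scr (Suc k)) 1) (Sub (scr k) (scr k) (scr (Suc k))))))"

fun aexp_time :: "aexp \<Rightarrow> nat" where
  "aexp_time (N a) = 1"
| "aexp_time (V x) = 2"
| "aexp_time (A a e) = aexp_time e + 9"
| "aexp_time (In e) = aexp_time e + 3"
| "aexp_time (Plus e f) = aexp_time e + aexp_time f + 1"
| "aexp_time (Minus e f) = aexp_time e + aexp_time f + 1"

text \<open>A bound independent of the store: both branches of a conditional are charged. A loop
  pays 2 steps for copying its bound and 1 for the last test; each round pays 3 for the test, the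
  constant 1 and the decrement.\<close>

fun com_time :: "nat \<Rightarrow> com \<Rightarrow> nat" where
  "com_time M (Asg x e) = aexp_time e + 2"
| "com_time M (Put a e f) = aexp_time e + aexp_time f + 9"
| "com_time M (Semi c d) = com_time M c + com_time M d"
| "com_time M (Cond e c d) = aexp_time e + 1 + com_time M c + com_time M d"
| "com_time M (Loop x c) = 3 + M * (com_time M c + 3)"

text \<open>Only the stores that the run really visits are inspected, so loop bounds may be computed
  by the program itself.\<close>

fun loops_bounded :: "nat list \<Rightarrow> nat \<Rightarrow> com \<Rightarrow> store \<Rightarrow> bool" where
  "loops_bounded xs M (Asg x e) s = True"
| "loops_bounded xs M (Put a e f) s = True"
| "loops_bounded xs M (Semi c d) s = (loops_bounded xs M c s \<and> loops_bounded xs M d (sem xs c s))"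
| "loops_bounded xs M (Cond e c d) s =
     (if aval xs e s \<noteq> 0 then loops_bounded xs M c s else loops_bounded xs M d s)"
| "loops_bounded xs M (Loop x c) s =
     (fst s x \<le> M \<and> (\<forall>i<fst s x. loops_bounded xs M c ((sem xs c ^^ i) s)))"

section \<open>Correctness of the translation\<close>

definition represents :: "nat list \<Rightarrow> store \<Rightarrow> state \<Rightarrow> bool" where
  "represents xs s \<sigma> \<longleftrightarrow> fst \<sigma> 0 = length xs \<and> (\<forall>x. fst \<sigma> (var x) = fst s x) \<and>
     (\<forall>i<length xs. snd \<sigma> i = xs ! i) \<and>
     (\<forall>a<32. \<forall>i. snd \<sigma> (length xs + (32*i+a)) = snd s a i)"

definition agree_below :: "nat \<Rightarrow> (nat \<Rightarrow> nat) \<Rightarrow> (nat \<Rightarrow> nat) \<Rightarrow> bool" where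
  "agree_below k r r' \<longleftrightarrow> r' 0 = r 0 \<and> (\<forall>x. r' (var x) = r (var x)) \<and> (\<forall>j<k. r' (scr j) = r (scr j))"

text \<open>Weaker than \<open>agree_below\<close>, because commands change variables. What must
  survive at the levels below \<open>k\<close> are pending operands, addresses and loop
  counters.\<close>

definition scratch_agree :: "nat \<Rightarrow> (nat \<Rightarrow> nat) \<Rightarrow> (nat \<Rightarrow> nat) \<Rightarrow> bool" where
  "scratch_agree k r r' \<longleftrightarrow> (\<forall>j<k. r' (scr j) = r (scr j))"

lemma agree_below_trans:
  "agree_below k r r' \<Longrightarrow> agree_below k r' r'' \<Longrightarrow> agree_below k r r''"
  unfolding agree_below_def by auto

lemma agree_below_mono: "agree_below k r r' \<Longrightarrow> l \<le> k \<Longrightarrow> agree_below l r r'"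
  unfolding agree_below_def by auto

lemma agree_below_upd: "agree_below k r r' \<Longrightarrow> k \<le> j \<Longrightarrow> agree_below k r (r'(scr j := a))"
  unfolding agree_below_def by auto

lemma represents_agree: "represents xs s (r, m) \<Longrightarrow> agree_below k r r' \<Longrightarrow> represents xs s (r', m)"
  unfolding represents_def agree_below_def by auto

text \<open>Five doublings multiply the index by 32; adding register 0, the input length, moves the
  address behind the input.\<close>

lemma exec_address:
  "\<exists>r'. exec (address k a) (r, m) 8 (r', m) \<and> agree_below k r r' \<and>
     r' (scr k) = r 0 + (32 * r (scr k) + a)"
proof -
  have dbl: "exec (Add j j j) (r, m) 1 (r(j := 2 * r j), m)" for r j
    using exec.Add[of j j j r m] by (simp add: mult_2)
  let ?j = "scr k"
  let ?r5 = "r(?j := 32 * r ?j)"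
  let ?r6 = "?r5(scr (Suc k) := a)"
  have 1: "exec (Add ?j ?j ?j) (r(?j := i * r ?j), m) 1 (r(?j := l * r ?j), m)" if "l = 2 * i" for i l
    using dbl[of ?j "r(?j := i * r ?j)"] that by (simp add: mult.assoc)
  have 0: "exec (Add ?j ?j ?j) (r, m) 1 (r(?j := 2 * r ?j), m)" by (rule dbl)
  have 2: "exec (Const (scr (Suc k)) a) (?r5, m) 1 (?r6, m)" by (rule exec.Const)
  let ?r7 = "?r6(?j := 32 * r ?j + a)"
  have 3: "exec (Add ?j ?j (scr (Suc k))) (?r6, m) 1 (?r7, m)"
    using exec.Add[of ?j ?j "scr (Suc k)" ?r6 m] by simp
  let ?r8 = "?r7(?j := r 0 + (32 * r ?j + a))"
  have 4: "exec (Add ?j ?j 0) (?r7, m) 1 (?r8, m)"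
    using exec.Add[of ?j ?j 0 ?r7 m] by (simp add: add.commute)
  have "exec (address k a) (r, m) (1+(1+(1+(1+(1+(1+(1+1))))))) (?r8, m)"
    unfolding address_def
    by (rule exec.Seq[OF 0 exec.Seq[OF 1 exec.Seq[OF 1 exec.Seq[OF 1 exec.Seq[OF 1
        exec.Seq[OF 2 exec.Seq[OF 3 4]]]]]]]) simp_all
  then have "exec (address k a) (r, m) 8 (?r8, m)" by (simp add: eval_nat_numeral)
  moreover have "agree_below k r ?r8" unfolding agree_below_def by auto
  moreover have "?r8 ?j = r 0 + (32 * r ?j + a)" by simp
  ultimately show ?thesis by blast
qed

lemma exec_comp_aexp:
  "represents xs s (r, m) \<Longrightarrow> wf_aexp e \<Longrightarrow>
   \<exists>t r'. exec (comp_aexp e k) (r, m) t (r', m) \<and> t \<le> aexp_time e \<and> agree_below k r r' \<and>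
     r' (scr k) = aval xs e s"
proof (induction e arbitrary: k r)
  case (N a)
  have "exec (Const (scr k) a) (r, m) 1 (r(scr k := a), m)" by (rule exec.Const)
  moreover have "agree_below k r (r(scr k := a))" unfolding agree_below_def by auto
  ultimately show ?case by fastforce
next
  case (V x)
  let ?r = "r(scr k := 0)" and ?r' = "r(scr k := r (var x))"
  have ne: "var x \<noteq> scr k" by simp
  have "exec (Const (scr k) 0) (r, m) 1 (?r, m)" by (rule exec.Const)
  moreover have "exec (Add (scr k) (scr k) (var x)) (?r, m) 1 (?r', m)"
    using exec.Add[of "scr k" "scr k" "var x" ?r m] ne by simp
  ultimately have "exec (comp_aexp (V x) k) (r, m) (1+1) (?r', m)"
    unfolding comp_aexp.simps by (rule exec.Seq)
  moreover have "agree_below k r ?r'" unfolding agree_below_def by auto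
  moreover have "?r' (scr k) = aval xs (V x) s" using V unfolding represents_def by simp
  ultimately show ?case by (metis aexp_time.simps(2) nat_1_add_1 order_refl)
next
  case (A a e)
  obtain t r1 where 1: "exec (comp_aexp e k) (r, m) t (r1, m)" "t \<le> aexp_time e"
    "agree_below k r r1" "r1 (scr k) = aval xs e s"
    using A.IH[OF A.prems(1), of k] A.prems(2) by auto
  obtain r2 where 2: "exec (address k a) (r1, m) 8 (r2, m)" "agree_below k r1 r2"
    "r2 (scr k) = r1 0 + (32 * r1 (scr k) + a)" using exec_address by blast
  have 3: "exec (Load (scr k) (scr k)) (r2, m) 1 (r2(scr k := m (r2 (scr k))), m)" by (rule exec.Load)
  have "r1 0 = length xs" using A.prems 1(3) unfolding represents_def agree_below_def by auto
  then have "m (r2 (scr k)) = aval xs (A a e) s"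
    using A.prems 2(3) 1(4) unfolding represents_def by simp
  then have "exec (comp_aexp (A a e) k) (r, m) (t + (8+1)) (r2(scr k := aval xs (A a e) s), m)"
    using exec.Seq[OF 1(1) exec.Seq[OF 2(1) 3]] by simp
  moreover have "agree_below k r (r2(scr k := aval xs (A a e) s))"
    using agree_below_trans[OF 1(3) 2(2)] by (rule agree_below_upd) simp
  ultimately show ?case using 1(2) by (intro exI[of _ "t+9"] exI[of _ "r2(scr k := aval xs (A a e) s)"]) (auto simp del: fun_upd_apply simp: fun_upd_same)
next
  case (In e)
  obtain t r1 where 1: "exec (comp_aexp e k) (r, m) t (r1, m)" "t \<le> aexp_time e"
    "agree_below k r r1" "r1 (scr k) = aval xs e s"
    using In.IH[OF In.prems(1), of k] In.prems(2) by auto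
  \<comment> \<open>The truncated difference with the input length is nonzero exactly for indices
    inside the input. The test is essential, since larger addresses hold array cells whereas
    \<open>In\<close> must yield 0.\<close>
  let ?r2 = "r1(scr (Suc k) := r1 0 - r1 (scr k))"
  have 2: "exec (Sub (scr (Suc k)) 0 (scr k)) (r1, m) 1 (?r2, m)" by (rule exec.Sub)
  have len: "r1 0 = length xs" using In.prems 1(3) unfolding represents_def agree_below_def by auto
  let ?r3 = "?r2(scr k := aval xs (In e) s)"
  have 3: "exec (IfNZ (scr (Suc k)) (Load (scr k) (scr k)) (Const (scr k) 0)) (?r2, m) (Suc 1) (?r3, m)"
  proof (cases "aval xs e s < length xs")
    case True
    have "exec (Load (scr k) (scr k)) (?r2, m) 1 (?r2(scr k := m (?r2 (scr k))), m)" by (rule exec.Load)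
    moreover have "m (?r2 (scr k)) = aval xs (In e) s"
      using True In.prems 1(4) unfolding represents_def by simp
    ultimately show ?thesis using True 1(4) len by (intro exec.If_True) auto
  next
    case False
    have "exec (Const (scr k) 0) (?r2, m) 1 (?r2(scr k := 0), m)" by (rule exec.Const)
    then show ?thesis using False 1(4) len by (intro exec.If_False) auto
  qed
  have "exec (comp_aexp (In e) k) (r, m) (t + (1 + Suc 1)) (?r3, m)"
    using exec.Seq[OF 1(1) exec.Seq[OF 2 3]] by simp
  moreover have "agree_below k r ?r3"
    using 1(3) unfolding agree_below_def by auto
  ultimately show ?case using 1(2) by (intro exI[of _ "t+(1+Suc 1)"] exI[of _ ?r3]) (simp del: fun_upd_apply add: fun_upd_same)
next
  case (Plus e f)
  obtain t r1 where 1: "exec (comp_aexp e k) (r, m) t (r1, m)" "t \<le> aexp_time e"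
    "agree_below k r r1" "r1 (scr k) = aval xs e s"
    using Plus.IH(1)[OF Plus.prems(1), of k] Plus.prems(2) by auto
  obtain u r2 where 2: "exec (comp_aexp f (Suc k)) (r1, m) u (r2, m)" "u \<le> aexp_time f"
    "agree_below (Suc k) r1 r2" "r2 (scr (Suc k)) = aval xs f s"
    using Plus.IH(2)[OF represents_agree[OF Plus.prems(1) 1(3)], of "Suc k"] Plus.prems(2) by auto
  have 3: "exec (Add (scr k) (scr k) (scr (Suc k))) (r2, m) 1 (r2(scr k := r2 (scr k) + r2 (scr (Suc k))), m)"
    by (rule exec.Add)
  have 4: "r2 (scr k) + r2 (scr (Suc k)) = aval xs (Plus e f) s"
    using 2(3,4) 1(4) unfolding agree_below_def by simp
  show ?case
    using exec.Seq[OF 1(1) exec.Seq[OF 2(1) 3]] 1(2) 2(2)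
      agree_below_upd[OF agree_below_trans[OF 1(3) agree_below_mono[OF 2(3)]], of k] 4
    by (intro exI[of _ "t+(u+1)"] exI[of _ "r2(scr k := r2 (scr k) + r2 (scr (Suc k)))"])
       (simp del: fun_upd_apply add: fun_upd_same)
next
  case (Minus e f)
  obtain t r1 where 1: "exec (comp_aexp e k) (r, m) t (r1, m)" "t \<le> aexp_time e"
    "agree_below k r r1" "r1 (scr k) = aval xs e s"
    using Minus.IH(1)[OF Minus.prems(1), of k] Minus.prems(2) by auto
  obtain u r2 where 2: "exec (comp_aexp f (Suc k)) (r1, m) u (r2, m)" "u \<le> aexp_time f"
    "agree_below (Suc k) r1 r2" "r2 (scr (Suc k)) = aval xs f s"
    using Minus.IH(2)[OF represents_agree[OF Minus.prems(1) 1(3)], of "Suc k"] Minus.prems(2) by auto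
  have 3: "exec (Sub (scr k) (scr k) (scr (Suc k))) (r2, m) 1 (r2(scr k := r2 (scr k) - r2 (scr (Suc k))), m)"
    by (rule exec.Sub)
  have 4: "r2 (scr k) - r2 (scr (Suc k)) = aval xs (Minus e f) s"
    using 2(3,4) 1(4) unfolding agree_below_def by simp
  show ?case
    using exec.Seq[OF 1(1) exec.Seq[OF 2(1) 3]] 1(2) 2(2)
      agree_below_upd[OF agree_below_trans[OF 1(3) agree_below_mono[OF 2(3)]], of k] 4
    by (intro exI[of _ "t+(u+1)"] exI[of _ "r2(scr k := r2 (scr k) - r2 (scr (Suc k)))"])
       (simp del: fun_upd_apply add: fun_upd_same)
qed

lemma scratch_agree_if_agree_below: "agree_below k r r' \<Longrightarrow> scratch_agree k r r'"
  unfolding agree_below_def scratch_agree_def by auto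

lemma scratch_agree_trans: "scratch_agree k r r' \<Longrightarrow> scratch_agree k r' r'' \<Longrightarrow> scratch_agree k r r''"
  unfolding scratch_agree_def by auto

lemma cell_address_inj:
  fixes a b i j :: nat
  assumes "a < 32" "b < 32" "32*i+a = 32*j+b"
  shows "a = b \<and> i = j"
proof -
  have "a = (32*i+a) mod 32" "b = (32*j+b) mod 32" using assms(1,2) by simp_all
  then have "a = b" using assms(3) by metis
  then show ?thesis using assms(3) by simp
qed

lemma represents_Put:
  assumes rep: "represents xs s (r, m)" and a: "a < 32"
  shows "represents xs (fst s, (snd s)(a := (snd s a)(i := v))) (r, m(length xs + (32*i+a) := v))"
proof -
  let ?m = "m(length xs + (32*i+a) := v)" and ?A = "(snd s)(a := (snd s a)(i := v))"
  have "?m (length xs + (32*j+b)) = ?A b j" if b: "b < 32" for b j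
  proof (cases "b = a \<and> j = i")
    case False
    then have "length xs + (32*j+b) \<noteq> length xs + (32*i+a)"
      using cell_address_inj[OF b a, of j i] by linarith
    then have "?m (length xs + (32*j+b)) = m (length xs + (32*j+b))" by (rule fun_upd_other)
    also have "\<dots> = snd s b j" using rep b unfolding represents_def by simp
    finally show ?thesis using False by auto
  qed simp
  moreover have "?m j = xs ! j" if "j < length xs" for j
    using rep that unfolding represents_def by simp
  ultimately show ?thesis using rep unfolding represents_def fst_conv snd_conv by blast
qed

text \<open>Simulation and cost are proved together by induction on the command; the level
  \<open>k\<close> is arbitrary because loop bodies are translated one level higher.\<close>

lemma exec_comp_com:
  "represents xs s \<sigma> \<Longrightarrow> wf_com c \<Longrightarrow> loops_bounded xs M c s \<Longrightarrow>
   \<exists>t \<sigma>'. exec (comp_com c k) \<sigma> t \<sigma>' \<and> t \<le> com_time M c \<and> scratch_agree k (fst \<sigma>) (fst \<sigma>') \<and>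
     represents xs (sem xs c s) \<sigma>'"
proof (induction c arbitrary: k s \<sigma>)
  case (Asg x e)
  obtain r m where \<sigma>: "\<sigma> = (r, m)" by (cases \<sigma>)
  obtain t r1 where 1: "exec (comp_aexp e k) (r, m) t (r1, m)" "t \<le> aexp_time e"
    "agree_below k r r1" "r1 (scr k) = aval xs e s"
    using exec_comp_aexp[of xs s r m e k] Asg \<sigma> by auto
  let ?r2 = "r1(scr (Suc k) := 0)"
  have 2: "exec (Const (scr (Suc k)) 0) (r1, m) 1 (?r2, m)" by (rule exec.Const)
  let ?r3 = "?r2(var x := aval xs e s)"
  have 3: "exec (Add (var x) (scr k) (scr (Suc k))) (?r2, m) 1 (?r3, m)"
    using exec.Add[of "var x" "scr k" "scr (Suc k)" ?r2 m] 1(4) by simp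
  have rep: "represents xs s (r1, m)" using represents_agree[OF _ 1(3)] Asg \<sigma> by simp
  have "represents xs (sem xs (Asg x e) s) (?r3, m)"
    using rep unfolding represents_def by auto
  moreover have "scratch_agree k r ?r3"
    using scratch_agree_if_agree_below[OF 1(3)] unfolding scratch_agree_def by auto
  ultimately show ?case using exec.Seq[OF 1(1) exec.Seq[OF 2 3]] 1(2) \<sigma>
    by (intro exI[of _ "t+(1+1)"] exI[of _ "(?r3, m)"]) (simp del: fun_upd_apply)
next
  case (Put a e f)
  obtain r m where \<sigma>: "\<sigma> = (r, m)" by (cases \<sigma>)
  obtain t r1 where 1: "exec (comp_aexp e k) (r, m) t (r1, m)" "t \<le> aexp_time e"
    "agree_below k r r1" "r1 (scr k) = aval xs e s"
    using exec_comp_aexp[of xs s r m e k] Put \<sigma> by auto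
  obtain r2 where 2: "exec (address k a) (r1, m) 8 (r2, m)" "agree_below k r1 r2"
    "r2 (scr k) = r1 0 + (32 * r1 (scr k) + a)" using exec_address by blast
  have rep: "represents xs s (r2, m)"
    using represents_agree[OF _ agree_below_trans[OF 1(3) 2(2)]] Put \<sigma> by simp
  obtain u r3 where 3: "exec (comp_aexp f (Suc k)) (r2, m) u (r3, m)" "u \<le> aexp_time f"
    "agree_below (Suc k) r2 r3" "r3 (scr (Suc k)) = aval xs f s"
    using exec_comp_aexp[OF rep, of f "Suc k"] Put by auto
  have len: "r1 0 = length xs" using Put.prems(1) 1(3) \<sigma> unfolding represents_def agree_below_def by auto
  have 4: "exec (Store (scr k) (scr (Suc k))) (r3, m) 1 (r3, m(r3 (scr k) := r3 (scr (Suc k))))" by (rule exec.Store)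
  have 5: "r3 (scr k) = length xs + (32 * aval xs e s + a)" "r3 (scr (Suc k)) = aval xs f s"
    using 3(3,4) 2(3) 1(4) len unfolding agree_below_def by auto
  have "represents xs (sem xs (Put a e f) s) (r3, m(r3 (scr k) := r3 (scr (Suc k))))"
    unfolding 5 sem.simps using Put by (intro represents_Put represents_agree[OF rep 3(3)]) simp
  moreover have "agree_below k r r3"
    using agree_below_trans[OF agree_below_trans[OF 1(3) 2(2)] agree_below_mono[OF 3(3)]] by simp
  ultimately show ?case using exec.Seq[OF 1(1) exec.Seq[OF 2(1) exec.Seq[OF 3(1) 4]]] 1(2) 3(2) \<sigma>
    by (intro exI[of _ "t+(8+(u+1))"] exI[of _ "(r3, m(r3 (scr k) := r3 (scr (Suc k))))"])
       (simp add: scratch_agree_if_agree_below)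
next
  case (Semi c d)
  obtain t \<sigma>1 where 1: "exec (comp_com c k) \<sigma> t \<sigma>1" "t \<le> com_time M c" "scratch_agree k (fst \<sigma>) (fst \<sigma>1)"
    "represents xs (sem xs c s) \<sigma>1" using Semi.IH(1)[OF Semi.prems(1), of k] Semi.prems(2,3) by auto
  obtain u \<sigma>2 where 2: "exec (comp_com d k) \<sigma>1 u \<sigma>2" "u \<le> com_time M d" "scratch_agree k (fst \<sigma>1) (fst \<sigma>2)"
    "represents xs (sem xs d (sem xs c s)) \<sigma>2" using Semi.IH(2)[OF 1(4), of k] Semi.prems(2,3) by auto
  show ?case using exec.Seq[OF 1(1) 2(1)] 1(2) 2(2,4) scratch_agree_trans[OF 1(3) 2(3)]
    by (intro exI[of _ "t+u"] exI[of _ \<sigma>2]) simp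
next
  case (Cond e c d)
  obtain r m where \<sigma>: "\<sigma> = (r, m)" by (cases \<sigma>)
  obtain t r1 where 1: "exec (comp_aexp e k) (r, m) t (r1, m)" "t \<le> aexp_time e"
    "agree_below k r r1" "r1 (scr k) = aval xs e s"
    using exec_comp_aexp[of xs s r m e k] Cond.prems \<sigma> by auto
  have rep: "represents xs s (r1, m)" using represents_agree[OF _ 1(3)] Cond.prems \<sigma> by simp
  show ?case
  proof (cases "aval xs e s = 0")
    case True
    obtain u \<sigma>2 where 2: "exec (comp_com d k) (r1, m) u \<sigma>2" "u \<le> com_time M d"
      "scratch_agree k r1 (fst \<sigma>2)" "represents xs (sem xs d s) \<sigma>2"
      using Cond.IH(2)[OF rep, of k] Cond.prems True by auto
    have "exec (comp_com (Cond e c d) k) (r, m) (t + Suc u) \<sigma>2"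
      unfolding comp_com.simps
      by (rule exec.Seq[OF 1(1) exec.If_False[OF _ 2(1)]]) (use True 1 in simp)
    then show ?thesis
      using 1(2) 2 True \<sigma> scratch_agree_trans[OF scratch_agree_if_agree_below[OF 1(3)] 2(3)]
      by (intro exI[of _ "t+Suc u"] exI[of _ \<sigma>2]) simp
  next
    case False
    obtain u \<sigma>2 where 2: "exec (comp_com c k) (r1, m) u \<sigma>2" "u \<le> com_time M c"
      "scratch_agree k r1 (fst \<sigma>2)" "represents xs (sem xs c s) \<sigma>2"
      using Cond.IH(1)[OF rep, of k] Cond.prems False by auto
    have "exec (comp_com (Cond e c d) k) (r, m) (t + Suc u) \<sigma>2"
      unfolding comp_com.simps
      by (rule exec.Seq[OF 1(1) exec.If_True[OF _ 2(1)]]) (use False 1 in simp)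
    then show ?thesis
      using 1(2) 2 False \<sigma> scratch_agree_trans[OF scratch_agree_if_agree_below[OF 1(3)] 2(3)]
      by (intro exI[of _ "t+Suc u"] exI[of _ \<sigma>2]) simp
  qed
next
  case (Loop x c)
  obtain r m where \<sigma>: "\<sigma> = (r, m)" by (cases \<sigma>)
  obtain t r1 where 1: "exec (comp_aexp (V x) k) (r, m) t (r1, m)" "t \<le> 2"
    "agree_below k r r1" "r1 (scr k) = fst s x"
    using exec_comp_aexp[of xs s r m "V x" k] Loop.prems \<sigma> by auto
  have rep: "represents xs s (r1, m)" using represents_agree[OF _ 1(3)] Loop.prems \<sigma> by simp
  let ?body = "Seq (comp_com c (Suc k)) (Seq (Const (scr (Suc k)) 1) (Sub (scr k) (scr k) (scr (Suc k))))"
  \<comment> \<open>The number of rounds is copied to \<open>scr k\<close> on entry, so the body may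
    change \<open>x\<close>. The induction is on this counter, with the store generalised to that of
    the current round.\<close>
  have loop: "\<exists>t \<sigma>'. exec (WhileNZ (scr k) ?body) \<tau> t \<sigma>' \<and> t \<le> 1 + l * (com_time M c + 3) \<and>
      scratch_agree k (fst \<tau>) (fst \<sigma>') \<and> represents xs ((sem xs c ^^ l) u) \<sigma>'"
    if "represents xs u \<tau>" "fst \<tau> (scr k) = l" "\<forall>i<l. loops_bounded xs M c ((sem xs c ^^ i) u)" for l u \<tau>
    using that
  proof (induction l arbitrary: u \<tau>)
    case 0
    have "exec (WhileNZ (scr k) ?body) \<tau> 1 \<tau>" using 0 by (intro exec.While_False) simp
    then show ?case using 0 by (intro exI[of _ 1] exI[of _ \<tau>]) (auto simp: scratch_agree_def)
  next
    case (Suc l)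
    have "loops_bounded xs M c ((sem xs c ^^ 0) u)" using Suc.prems(3) by blast
    then have "loops_bounded xs M c u" by simp
    then obtain v \<sigma>1 where 1: "exec (comp_com c (Suc k)) \<tau> v \<sigma>1" "v \<le> com_time M c"
      "scratch_agree (Suc k) (fst \<tau>) (fst \<sigma>1)" "represents xs (sem xs c u) \<sigma>1"
      using Loop.IH[OF Suc.prems(1), of "Suc k"] Loop.prems(2) by auto
    obtain r1 m1 where \<sigma>1: "\<sigma>1 = (r1, m1)" by (cases \<sigma>1)
    let ?r2 = "r1(scr (Suc k) := 1)" and ?r3 = "r1(scr (Suc k) := 1, scr k := l)"
    have "r1 (scr k) = Suc l" using 1(3) Suc.prems(2) \<sigma>1 unfolding scratch_agree_def by simp
    then have 3: "exec (Sub (scr k) (scr k) (scr (Suc k))) (?r2, m1) 1 (?r3, m1)"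
      using exec.Sub[of "scr k" "scr k" "scr (Suc k)" ?r2 m1] by simp
    have 2: "exec (Const (scr (Suc k)) 1) (r1, m1) 1 (?r2, m1)" by (rule exec.Const)
    have body: "exec ?body \<tau> (v + (1 + 1)) (?r3, m1)"
      using 1(1) unfolding \<sigma>1 by (rule exec.Seq[OF _ exec.Seq[OF 2 3]])
    have "agree_below k r1 ?r3" unfolding agree_below_def by auto
    then have rep: "represents xs (sem xs c u) (?r3, m1)" using 1(4) \<sigma>1 represents_agree by blast
    have "\<exists>t \<sigma>'. exec (WhileNZ (scr k) ?body) (?r3, m1) t \<sigma>' \<and> t \<le> 1 + l * (com_time M c + 3) \<and>
      scratch_agree k ?r3 (fst \<sigma>') \<and> represents xs ((sem xs c ^^ l) (sem xs c u)) \<sigma>'"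
    proof (rule Suc.IH[OF rep, unfolded fst_conv])
      show "?r3 (scr k) = l" by simp
      show "\<forall>i<l. loops_bounded xs M c ((sem xs c ^^ i) (sem xs c u))"
      proof (intro allI impI)
        fix i assume "i < l"
        then have "loops_bounded xs M c ((sem xs c ^^ Suc i) u)" using Suc.prems(3) by blast
        then show "loops_bounded xs M c ((sem xs c ^^ i) (sem xs c u))" by (simp add: funpow_swap1)
      qed
    qed
    then obtain w \<sigma>' where 4: "exec (WhileNZ (scr k) ?body) (?r3, m1) w \<sigma>'"
      "w \<le> 1 + l * (com_time M c + 3)" "scratch_agree k ?r3 (fst \<sigma>')"
      "represents xs ((sem xs c ^^ l) (sem xs c u)) \<sigma>'" by blast
    have "exec (WhileNZ (scr k) ?body) \<tau> (Suc (v + (1 + 1) + w)) \<sigma>'"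
      by (rule exec.While_True[OF _ body 4(1)]) (use Suc.prems(2) in simp)
    moreover have "scratch_agree k (fst \<tau>) (fst \<sigma>')"
      using 1(3) 4(3) \<sigma>1 unfolding scratch_agree_def by simp
    ultimately show ?case using 1(2) 4(2,4)
      by (intro exI[of _ "Suc (v + (1 + 1) + w)"] exI[of _ \<sigma>']) (simp add: funpow_swap1)
  qed
  obtain w \<sigma>' where 4: "exec (WhileNZ (scr k) ?body) (r1, m) w \<sigma>'"
      "w \<le> 1 + fst s x * (com_time M c + 3)" "scratch_agree k r1 (fst \<sigma>')"
      "represents xs ((sem xs c ^^ fst s x) s) \<sigma>'"
    using loop[OF rep, of "fst s x"] 1(4) Loop.prems(3) by auto
  have "fst s x * (com_time M c + 3) \<le> M * (com_time M c + 3)"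
    using Loop.prems(3) by (intro mult_right_mono) auto
  then have "t + w \<le> com_time M (Loop x c)" using 1(2) 4(2) unfolding com_time.simps by linarith
  then show ?case using exec.Seq[OF 1(1) 4(1)] 4(4) \<sigma>
      scratch_agree_trans[OF scratch_agree_if_agree_below[OF 1(3)] 4(3)]
    by (intro exI[of _ "t+w"] exI[of _ \<sigma>']) (simp del: com_time.simps)
qed

text \<open>Each enclosing loop raises the degree by one. Since \<open>K\<close> and
  \<open>p\<close> are chosen before \<open>M\<close>, they depend on the program text
  alone.\<close>

lemma com_time_poly: "\<exists>K p. \<forall>M. com_time M c \<le> K * Suc M ^ p"
proof (induction c)
  case (Asg x e)
  show ?case by (intro exI[of _ "aexp_time e + 2"] exI[of _ 0]) simp
next
  case (Put a e f)
  show ?case by (intro exI[of _ "aexp_time e + aexp_time f + 9"] exI[of _ 0]) simp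
next
  case (Semi c d)
  then obtain K p K' p' where *: "\<And>M. com_time M c \<le> K * Suc M ^ p" "\<And>M. com_time M d \<le> K' * Suc M ^ p'"
    by blast
  have "com_time M (Semi c d) \<le> (K + K') * Suc M ^ (p + p')" for M
  proof -
    have "K * Suc M ^ p \<le> K * Suc M ^ (p+p')" "K' * Suc M ^ p' \<le> K' * Suc M ^ (p+p')"
      by (intro mult_left_mono power_increasing; simp)+
    then show ?thesis using *(1)[of M] *(2)[of M] unfolding com_time.simps distrib_right by linarith
  qed
  then show ?case by blast
next
  case (Cond e c d)
  then obtain K p K' p' where *: "\<And>M. com_time M c \<le> K * Suc M ^ p" "\<And>M. com_time M d \<le> K' * Suc M ^ p'"
    by blast
  have "com_time M (Cond e c d) \<le> (aexp_time e + 1 + K + K') * Suc M ^ (p + p')" for M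
  proof -
    have "K * Suc M ^ p \<le> K * Suc M ^ (p+p')" "K' * Suc M ^ p' \<le> K' * Suc M ^ (p+p')"
      by (intro mult_left_mono power_increasing; simp)+
    moreover have "(aexp_time e + 1) * 1 \<le> (aexp_time e + 1) * Suc M ^ (p+p')"
      by (intro mult_left_mono) auto
    ultimately show ?thesis using *(1)[of M] *(2)[of M] unfolding com_time.simps distrib_right by linarith
  qed
  then show ?case by blast
next
  case (Loop x c)
  then obtain K p where *: "\<And>M. com_time M c \<le> K * Suc M ^ p" by blast
  have "com_time M (Loop x c) \<le> (K + 6) * Suc M ^ (Suc p)" for M
  proof -
    have "M * (com_time M c + 3) \<le> Suc M * (K * Suc M ^ p + 3 * Suc M ^ p)"
      by (intro mult_mono add_mono *) auto
    moreover have "1 \<le> Suc M ^ Suc p" by (rule one_le_power) simp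
    ultimately show ?thesis unfolding com_time.simps by (simp add: algebra_simps)
  qed
  then show ?case by blast
qed

definition initial_store :: store where
  "initial_store = (\<lambda>_. 0, \<lambda>_ _. 0)"

definition answer_prog :: "com \<Rightarrow> nat \<Rightarrow> prog" where
  "answer_prog c x = Seq (comp_com c 0) (Seq (Const (scr 0) 0) (Add 0 (var x) (scr 0)))"

lemma exec_answer_prog:
  assumes "wf_com c" "loops_bounded xs M c initial_store"
  shows "\<exists>t \<sigma>. exec (answer_prog c x) (initial_state xs) t \<sigma> \<and> t \<le> com_time M c + 2 \<and>
    result \<sigma> = fst (sem xs c initial_store) x"
proof -
  have "represents xs initial_store (initial_state xs)"
    unfolding represents_def initial_store_def initial_state_def by auto
  then obtain t \<sigma> where 1: "exec (comp_com c 0) (initial_state xs) t \<sigma>" "t \<le> com_time M c"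
    "represents xs (sem xs c initial_store) \<sigma>" using exec_comp_com[OF _ assms] by blast
  obtain r m where \<sigma>: "\<sigma> = (r, m)" by (cases \<sigma>)
  let ?r1 = "r(scr 0 := 0)" and ?r2 = "r(scr 0 := 0, 0 := r (var x))"
  have 2: "exec (Const (scr 0) 0) (r, m) 1 (?r1, m)" by (rule exec.Const)
  have 3: "exec (Add 0 (var x) (scr 0)) (?r1, m) 1 (?r2, m)"
    using exec.Add[of 0 "var x" "scr 0" ?r1 m] by simp
  show ?thesis unfolding answer_prog_def
    using exec.Seq[OF 1(1)[unfolded \<sigma>] exec.Seq[OF 2 3]] 1(2,3) \<sigma>
    by (intro exI[of _ "t+(1+1)"] exI[of _ "(?r2, m)"]) (simp add: result_def represents_def)
qed

section \<open>Alliances and type classes\<close>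

locale vertex_graph =
  fixes n :: nat and E :: "nat set set"
  assumes graph: "simple_graph {..<n} E"
begin

section \<open>Types as an equivalence relation, and the type classes\<close>

definition adj :: "nat \<Rightarrow> nat \<Rightarrow> bool" where "adj u v \<longleftrightarrow> {u, v} \<in> E"

lemma adj_sym: "adj u v \<longleftrightarrow> adj v u"
  unfolding adj_def by (simp add: insert_commute)

lemma adj_less: "adj u v \<Longrightarrow> u < n \<and> v < n"
  using graph unfolding adj_def simple_graph_def by (auto simp: doubleton_eq_iff)

lemma adj_irrefl [simp]: "\<not> adj u u"
  using graph unfolding adj_def simple_graph_def by (auto simp: doubleton_eq_iff)

lemma open_nbhd_adj: "open_nbhd E v = {u. adj v u}"
  unfolding open_nbhd_def using adj_sym by (auto simp: adj_def)

text \<open>At \<open>w = u\<close> and \<open>w = v\<close> both sides of the set equation are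
  false: one by irreflexivity, the other by the removed vertex. So true and false twins are treated
  alike.\<close>

lemma same_type_iff: "same_type E u v \<longleftrightarrow> (\<forall>w. w \<noteq> u \<longrightarrow> w \<noteq> v \<longrightarrow> adj u w = adj v w)"
  unfolding same_type_def open_nbhd_adj set_eq_iff by (simp, metis adj_irrefl)

lemma same_type_refl [simp]: "same_type E u u"
  by (simp add: same_type_def)

lemma same_type_sym: "same_type E u v \<longleftrightarrow> same_type E v u"
  by (auto simp: same_type_def)

text \<open>The delicate point is the middle vertex \<open>v\<close> itself: \<open>adj u v\<close>
  equals \<open>adj w u\<close> by the second hypothesis at \<open>u\<close>, and
  \<open>adj u w\<close> equals \<open>adj v w\<close> by the first at \<open>w\<close>.\<close>

lemma same_type_trans: "same_type E u v \<Longrightarrow> same_type E v w \<Longrightarrow> same_type E u w"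
  unfolding same_type_iff using adj_sym by metis

text \<open>The least vertex of each type; this choice is what a scan through the vertices can
  recognise.\<close>

definition reps :: "nat list" where
  "reps = filter (\<lambda>v. \<forall>u<v. \<not> same_type E u v) [0..<n]"

definition d :: nat where "d = length reps"

definition rep :: "nat \<Rightarrow> nat" where "rep i = reps ! i"

definition cls :: "nat \<Rightarrow> nat set" where "cls i = {v. v < n \<and> same_type E (rep i) v}"

lemma rep_props:
  assumes "i < d"
  shows "rep i < n" "\<And>u. u < rep i \<Longrightarrow> \<not> same_type E u (rep i)"
  using nth_mem[of i reps] assms unfolding d_def rep_def by (auto simp: reps_def)

lemma rep_cls: "i < d \<Longrightarrow> rep i \<in> cls i"
  unfolding cls_def using rep_props by simp

lemma rep_distinct:
  assumes "i < d" "j < d" "same_type E (rep i) (rep j)"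
  shows "i = j"
proof -
  have "rep i = rep j"
    using rep_props[OF assms(1)] rep_props[OF assms(2)] assms(3) same_type_sym
    by (metis linorder_neqE_nat)
  moreover have "distinct reps" unfolding reps_def by simp
  ultimately show ?thesis using assms unfolding rep_def d_def by (simp add: nth_eq_iff_index_eq)
qed

lemma cls_cover:
  assumes "v < n"
  shows "\<exists>i<d. v \<in> cls i"
proof -
  let ?u = "LEAST u. same_type E u v"
  have u: "same_type E ?u v" by (rule LeastI[of _ v]) simp
  have le: "?u \<le> v" by (rule Least_le) simp
  have "\<not> same_type E w ?u" if "w < ?u" for w
    using not_less_Least[OF that] same_type_trans[OF _ u] by blast
  then have "?u \<in> set reps" unfolding reps_def using le assms by auto
  then obtain i where "i < d" "rep i = ?u" unfolding in_set_conv_nth d_def rep_def by blast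
  then show ?thesis using u assms unfolding cls_def by auto
qed

lemma cls_disjoint: "i < d \<Longrightarrow> j < d \<Longrightarrow> i \<noteq> j \<Longrightarrow> cls i \<inter> cls j = {}"
  unfolding cls_def using rep_distinct same_type_trans same_type_sym by blast

lemma cls_subset: "cls i \<subseteq> {..<n}"
  unfolding cls_def by auto

lemma finite_cls [simp]: "finite (cls i)"
  using finite_subset[OF cls_subset] by simp

lemma cls_same: "v \<in> cls i \<Longrightarrow> w \<in> cls i \<Longrightarrow> same_type E v w"
  unfolding cls_def using same_type_trans same_type_sym by blast

text \<open>Representatives have pairwise different types, hence lie in different blocks of any
  partition into types. This direction turns bounds in \<open>d\<close> into bounds in the
  parameter.\<close>

lemma d_le_neighbourhood_diversity: "d \<le> neighbourhood_diversity {..<n} E"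
proof -
  let ?Q = "\<lambda>m. \<exists>P. partition_on {..<n} P \<and> card P = m \<and> (\<forall>C\<in>P. \<forall>u\<in>C. \<forall>v\<in>C. same_type E u v)"
  \<comment> \<open>The partition into singletons shows that the \<open>LEAST\<close> is attained by
    some partition.\<close>
  have "partition_on {..<n} ((\<lambda>v. {v}) ` {..<n})"
    unfolding partition_on_def by (auto simp: disjoint_def)
  then have "?Q (card ((\<lambda>v. {v}) ` {..<n}))"
    by (intro exI[of _ "(\<lambda>v. {v}) ` {..<n}"]) auto
  then have "?Q (LEAST m. ?Q m)" by (rule LeastI)
  then obtain P where P: "partition_on {..<n} P" "card P = neighbourhood_diversity {..<n} E"
    "\<forall>C\<in>P. \<forall>u\<in>C. \<forall>v\<in>C. same_type E u v" unfolding neighbourhood_diversity_def by blast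
  have "\<exists>C\<in>P. rep i \<in> C" if "i < d" for i
    using rep_props(1)[OF that] P(1) unfolding partition_on_def by blast
  then obtain f where f: "\<And>i. i < d \<Longrightarrow> f i \<in> P \<and> rep i \<in> f i" by metis
  have "inj_on f {..<d}"
    using f P(3) rep_distinct by (intro inj_onI) (metis lessThan_iff)
  moreover have "f ` {..<d} \<subseteq> P" using f by auto
  moreover have "finite P" using finite_elements[OF _ P(1)] by simp
  ultimately have "card {..<d} \<le> card P" by (intro card_inj_on_le)
  then show ?thesis using P(2) by simp
qed

text \<open>The diagonal entry tells cliques from independent sets; it is false for a class with one
  vertex.\<close>

definition cadj :: "nat \<Rightarrow> nat \<Rightarrow> bool" where
  "cadj i j \<longleftrightarrow> (if i = j then \<exists>v\<in>cls i. adj (rep i) v else adj (rep i) (rep j))"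

abbreviation a :: "nat \<Rightarrow> nat \<Rightarrow> nat" where "a i j \<equiv> of_bool (cadj i j)"

text \<open>The endpoints are exchanged for representatives one at a time: vertices of the same type
  see every third vertex alike. Inside a class this makes all pairs adjacent or none.\<close>

lemma adj_iff_cadj:
  assumes "i < d" "j < d" "v \<in> cls i" "w \<in> cls j" "v \<noteq> w"
  shows "adj v w \<longleftrightarrow> cadj i j"
proof (cases "i = j")
  case False
  have "w \<noteq> rep i" "rep i \<noteq> rep j" "v \<noteq> rep j"
    using cls_disjoint[OF assms(1,2) False] rep_cls[OF assms(1)] rep_cls[OF assms(2)] assms(3,4)
    by auto
  moreover have "same_type E v (rep i)" "same_type E w (rep j)"
    using cls_same rep_cls assms by auto
  ultimately have "adj v w = adj (rep i) w" "adj w (rep i) = adj (rep j) (rep i)"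
    using assms(5) unfolding same_type_iff by metis+
  then show ?thesis unfolding cadj_def using False adj_sym by auto
next
  case True
  have r: "rep i \<in> cls i" using rep_cls assms by simp
  have ij: "v \<in> cls i" "w \<in> cls i" using assms True by auto
  \<comment> \<open>The vertices \<open>y\<close> and \<open>z\<close> have the same type, and
    \<open>x\<close> differs from both, so an edge at \<open>x\<close> can be moved from
    \<open>y\<close> to \<open>z\<close>.\<close>
  have shift: "adj x z" if "x \<in> cls i" "y \<in> cls i" "z \<in> cls i" "x \<noteq> z" "adj x y" for x y z
    using cls_same[OF that(2,3)] that(4,5) unfolding same_type_iff using adj_sym adj_irrefl by metis
  have "adj v w \<longleftrightarrow> (\<exists>u\<in>cls i. adj (rep i) u)"
  proof
    assume vw: "adj v w"
    show "\<exists>u\<in>cls i. adj (rep i) u"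
    proof (cases "v = rep i")
      case False
      then have "adj v (rep i)" using shift[OF ij r False vw] by simp
      then show ?thesis using adj_sym ij by blast
    qed (use vw ij in blast)
  next
    assume "\<exists>u\<in>cls i. adj (rep i) u"
    then obtain u where u: "u \<in> cls i" "adj (rep i) u" by blast
    show "adj v w"
    proof (cases "v = rep i")
      case True
      then show ?thesis using shift[OF r u(1) ij(2) _ u(2)] assms by simp
    next
      case False
      then have "adj v (rep i)" using shift[OF r u(1) ij(1) _ u(2)] adj_sym by blast
      then show ?thesis using shift[OF ij(1) r ij(2) assms(5)] by simp
    qed
  qed
  then show ?thesis unfolding cadj_def using True by simp
qed

section \<open>Neighbours counted by class\<close>

definition deg :: "nat \<Rightarrow> nat" where "deg v = card (open_nbhd E v)"

lemma finite_nbhd [simp]: "finite (open_nbhd E v)"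
  using finite_subset[of _ "{..<n}"] adj_less unfolding open_nbhd_adj by blast

lemma card_by_classes:
  assumes "S \<subseteq> {..<n}"
  shows "card S = (\<Sum>j<d. card (S \<inter> cls j))"
proof -
  have "\<exists>j<d. v \<in> cls j" if "v \<in> S" for v using cls_cover assms that by blast
  then have "S = (\<Union>j<d. S \<inter> cls j)" by auto
  moreover have "card (\<Union>j<d. S \<inter> cls j) = (\<Sum>j<d. card (S \<inter> cls j))"
  proof (rule card_UN_disjoint)
    show "\<forall>i\<in>{..<d}. \<forall>j\<in>{..<d}. i \<noteq> j \<longrightarrow> (S \<inter> cls i) \<inter> (S \<inter> cls j) = {}"
      using cls_disjoint by blast
  qed simp_all
  ultimately show ?thesis by simp
qed

text \<open>The weighted sum counts \<open>v\<close> as a neighbour of itself when \<open>v\<close>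
  is in \<open>S\<close> and its class is a clique; the extra summand on the left compensates for
  this single error.\<close>

lemma card_nbhd_Int:
  assumes S: "S \<subseteq> {..<n}" and i: "i < d" and v: "v \<in> cls i"
  shows "card (open_nbhd E v \<inter> S) + (if v \<in> S then a i i else 0) = (\<Sum>j<d. a i j * card (S \<inter> cls j))"
proof -
  have *: "card (open_nbhd E v \<inter> S \<inter> cls j) + (if j = i then (if v \<in> S then a i i else 0) else 0)
      = a i j * card (S \<inter> cls j)" if j: "j < d" for j
  proof -
    have "adj v w \<longleftrightarrow> cadj i j \<and> w \<noteq> v" if "w \<in> cls j" for w
      using adj_iff_cadj[OF i j v that] adj_irrefl[of v] by (cases "w = v") auto
    then have eq: "open_nbhd E v \<inter> S \<inter> cls j = (if cadj i j then (S \<inter> cls j) - {v} else {})"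
      unfolding open_nbhd_adj by auto
    have "v \<in> cls j \<longleftrightarrow> j = i" using cls_disjoint[OF i j] v by blast
    moreover have "card (S \<inter> cls j) > 0" if "v \<in> S \<inter> cls j"
      using that by (auto simp: card_gt_0_iff)
    ultimately show ?thesis unfolding eq by (auto simp: card_Diff_singleton_if)
  qed
  have "card (open_nbhd E v \<inter> S) = (\<Sum>j<d. card (open_nbhd E v \<inter> S \<inter> cls j))"
    using S by (intro card_by_classes) blast
  moreover have "(\<Sum>j<d. if j = i then (if v \<in> S then a i i else 0) else 0) = (if v \<in> S then a i i else 0)"
    using i by simp
  moreover have "(\<Sum>j<d. card (open_nbhd E v \<inter> S \<inter> cls j) +
      (if j = i then (if v \<in> S then a i i else 0) else 0)) = (\<Sum>j<d. a i j * card (S \<inter> cls j))"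
    by (rule sum.cong[OF refl], rule *) simp
  ultimately show ?thesis by (simp only: sum.distrib)
qed

text \<open>Taking all vertices for \<open>S\<close> in the preceding count gives a sum in which
  only the class of the vertex occurs.\<close>

lemma deg_cls:
  assumes "i < d" "v \<in> cls i"
  shows "deg v = deg (rep i)"
proof -
  have "open_nbhd E w \<inter> {..<n} = open_nbhd E w" for w
    using adj_less unfolding open_nbhd_adj by auto
  moreover have "w \<in> {..<n}" if "w \<in> cls i" for w using that cls_subset by blast
  ultimately have "deg w + a i i = (\<Sum>j<d. a i j * card ({..<n} \<inter> cls j))" if "w \<in> cls i" for w
    using card_nbhd_Int[OF subset_refl assms(1) that] that unfolding deg_def by simp
  then show ?thesis using assms rep_cls by (metis add_right_imp_eq)
qed

section \<open>Alliance conditions in terms of counts\<close>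

text \<open>With \<open>x\<close> neighbours inside, \<open>v\<close> also counts itself, so the
  condition is \<open>deg v - x \<le> x + 1\<close>, that is \<open>deg v \<le> 2 * x + 1\<close>,
  which rounds to \<open>deg v div 2 \<le> x\<close>.\<close>

lemma defensive_alliance_iff:
  "defensive_alliance {..<n} E S \<longleftrightarrow>
     S \<noteq> {} \<and> S \<subseteq> {..<n} \<and> (\<forall>v\<in>S. deg v div 2 \<le> card (open_nbhd E v \<inter> S))"
proof -
  have "card (open_nbhd E v - S) \<le> card (closed_nbhd E v \<inter> S) \<longleftrightarrow> deg v div 2 \<le> card (open_nbhd E v \<inter> S)"
    if "v \<in> S" for v
  proof -
    have "closed_nbhd E v \<inter> S = insert v (open_nbhd E v \<inter> S)" "v \<notin> open_nbhd E v"
      using that unfolding closed_nbhd_def open_nbhd_adj by auto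
    then have "card (closed_nbhd E v \<inter> S) = Suc (card (open_nbhd E v \<inter> S))" by simp
    moreover have "card (open_nbhd E v \<inter> S) + card (open_nbhd E v - S) = deg v"
      unfolding deg_def by (metis card_Int_Diff finite_nbhd)
    ultimately show ?thesis by presburger
  qed
  then show ?thesis unfolding defensive_alliance_def by blast
qed

text \<open>Removing \<open>v\<close> lowers the inner degree only of the neighbours of
  \<open>v\<close>, and by exactly one. So a violation arises precisely at a neighbour that met its
  bound with equality, unless nothing is left.\<close>

lemma not_defensive_alliance_remove:
  assumes S: "defensive_alliance {..<n} E S" and v: "v \<in> S"
  shows "\<not> defensive_alliance {..<n} E (S - {v}) \<longleftrightarrow>
    S = {v} \<or> (\<exists>u\<in>S. adj u v \<and> card (open_nbhd E u \<inter> S) = deg u div 2)"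
proof -
  have "deg u div 2 \<le> card (open_nbhd E u \<inter> (S - {v})) \<longleftrightarrow>
      \<not> (adj u v \<and> card (open_nbhd E u \<inter> S) = deg u div 2)" if "u \<in> S" for u
  proof -
    have le: "deg u div 2 \<le> card (open_nbhd E u \<inter> S)"
      using S that unfolding defensive_alliance_iff by simp
    have eq: "open_nbhd E u \<inter> (S - {v}) = (open_nbhd E u \<inter> S) - {v}" by blast
    show ?thesis
    proof (cases "adj u v")
      case True
      then have "v \<in> open_nbhd E u \<inter> S" using v unfolding open_nbhd_adj by simp
      moreover from this have "card (open_nbhd E u \<inter> S) > 0" by (auto simp: card_gt_0_iff)
      ultimately show ?thesis unfolding eq using True le by auto
    next
      case False
      then have "v \<notin> open_nbhd E u \<inter> S" unfolding open_nbhd_adj by simp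
      then show ?thesis unfolding eq using False le by simp
    qed
  qed
  then have "(\<forall>u\<in>S - {v}. deg u div 2 \<le> card (open_nbhd E u \<inter> (S - {v}))) \<longleftrightarrow>
      \<not> (\<exists>u\<in>S. adj u v \<and> card (open_nbhd E u \<inter> S) = deg u div 2)"
    using adj_irrefl by blast
  moreover have "S - {v} \<noteq> {} \<longleftrightarrow> S \<noteq> {v}" using v by blast
  moreover have "S - {v} \<subseteq> {..<n}" using S unfolding defensive_alliance_iff by blast
  ultimately show ?thesis unfolding defensive_alliance_iff[of "S - {v}"] by blast
qed

text \<open>If \<open>S\<close> has \<open>x j\<close> vertices in each class \<open>j\<close>, a vertex of class \<open>i\<close> in \<open>S\<close> has \<open>y x i - a i i\<close> neighbours
  in \<open>S\<close>; it satisfies the alliance condition iff \<open>h i \<le> y x i\<close>, and the removal of a neighbour from \<open>S\<close>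
  violates the condition iff equality holds.\<close>

definition h :: "nat \<Rightarrow> nat" where "h i = deg (rep i) div 2 + a i i"

definition y :: "(nat \<Rightarrow> nat) \<Rightarrow> nat \<Rightarrow> nat" where "y x i = (\<Sum>j<d. a i j * x j)"

text \<open>Here \<open>i\<close> is the class of the deleted vertex and \<open>j\<close> that of a
  tight neighbour. The premise on the total exempts a one-vertex set, and \<open>2 \<le> x i\<close>
  provides a second vertex when both lie in one class.\<close>

definition lmda_counts :: "(nat \<Rightarrow> nat) \<Rightarrow> bool" where
  "lmda_counts x \<longleftrightarrow> (\<exists>i<d. 0 < x i) \<and> (\<forall>i<d. x i \<le> card (cls i)) \<and>
     (\<forall>i<d. 0 < x i \<longrightarrow> h i \<le> y x i \<and>
        (2 \<le> (\<Sum>j<d. x j) \<longrightarrow> (\<exists>j<d. 0 < x j \<and> y x j = h j \<and> cadj i j \<and> (i \<noteq> j \<or> 2 \<le> x i))))"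

text \<open>Each condition on a vertex of \<open>S\<close> has the same truth value for all vertices
  of \<open>S\<close> in one class, so vertices can be replaced by non-empty classes
  throughout.\<close>

lemma locally_minimal_iff_counts:
  assumes S: "S \<subseteq> {..<n}"
  shows "locally_minimal_defensive_alliance {..<n} E S \<longleftrightarrow> lmda_counts (\<lambda>i. card (S \<inter> cls i))"
proof -
  let ?x = "\<lambda>i. card (S \<inter> cls i)"
  have finS: "finite S" using S finite_subset by blast
  have mem: "\<exists>i<d. v \<in> cls i" if "v \<in> S" for v using cls_cover S that by blast
  have pos: "0 < ?x i \<longleftrightarrow> (\<exists>v. v \<in> S \<and> v \<in> cls i)" for i by (auto simp: card_gt_0_iff)
  \<comment> \<open>The transfer principle used for both the alliance and the minimality
    condition.\<close>
  have by_class: "(\<forall>v\<in>S. P v) \<longleftrightarrow> (\<forall>i<d. 0 < ?x i \<longrightarrow> Q i)"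
    if "\<And>i v. i < d \<Longrightarrow> v \<in> cls i \<Longrightarrow> v \<in> S \<Longrightarrow> P v \<longleftrightarrow> Q i" for P Q
    unfolding pos using that mem by meson
  have yx: "y ?x i = card (open_nbhd E v \<inter> S) + a i i" if "i < d" "v \<in> cls i" "v \<in> S" for i v
    using card_nbhd_Int[OF S that(1,2)] that(3) unfolding y_def by simp
  have ge: "deg v div 2 \<le> card (open_nbhd E v \<inter> S) \<longleftrightarrow> h i \<le> y ?x i"
    and tight: "card (open_nbhd E v \<inter> S) = deg v div 2 \<longleftrightarrow> y ?x i = h i"
    if "i < d" "v \<in> cls i" "v \<in> S" for i v
    using yx[OF that] deg_cls[OF that(1,2)] unfolding h_def by auto
  have ne: "S \<noteq> {} \<longleftrightarrow> (\<exists>i<d. 0 < ?x i)" unfolding pos using mem by blast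
  have da: "defensive_alliance {..<n} E S \<longleftrightarrow> (\<exists>i<d. 0 < ?x i) \<and> (\<forall>i<d. 0 < ?x i \<longrightarrow> h i \<le> y ?x i)"
  proof -
    have "(\<forall>v\<in>S. deg v div 2 \<le> card (open_nbhd E v \<inter> S)) \<longleftrightarrow> (\<forall>i<d. 0 < ?x i \<longrightarrow> h i \<le> y ?x i)"
      by (rule by_class[OF ge])
    then show ?thesis unfolding defensive_alliance_iff ne using S by simp
  qed
  have card_S: "(\<Sum>j<d. ?x j) = card S" using card_by_classes[OF S] by simp
  have one: "S = {v} \<longleftrightarrow> \<not> 2 \<le> card S" if "v \<in> S" for v
  proof -
    have "S = {v} \<longleftrightarrow> card S = 1" using that by (auto simp: card_1_singleton_iff)
    moreover have "card S > 0" using that finS by (auto simp: card_gt_0_iff)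
    ultimately show ?thesis by linarith
  qed
  \<comment> \<open>A tight neighbour is never \<open>v\<close> itself, so within one class its
    existence amounts to having two vertices of \<open>S\<close> there.\<close>
  have ex: "(\<exists>u\<in>S. adj u v \<and> card (open_nbhd E u \<inter> S) = deg u div 2) \<longleftrightarrow>
     (\<exists>j<d. 0 < ?x j \<and> y ?x j = h j \<and> cadj i j \<and> (i \<noteq> j \<or> 2 \<le> ?x i))" (is "?L \<longleftrightarrow> ?R")
    if v: "i < d" "v \<in> cls i" "v \<in> S" for i v
  proof
    assume ?L
    then obtain u where u: "u \<in> S" "adj u v" "card (open_nbhd E u \<inter> S) = deg u div 2" by blast
    obtain j where j: "j < d" "u \<in> cls j" using mem u(1) by blast
    have uv: "u \<noteq> v" using u(2) adj_irrefl by auto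
    have "cadj i j" using adj_iff_cadj[OF v(1) j(1) v(2) j(2)] u(2) uv adj_sym by auto
    moreover have "2 \<le> ?x i" if "i = j"
    proof -
      have "{u, v} \<subseteq> S \<inter> cls i" using u v j that by auto
      then show ?thesis using card_mono[of "S \<inter> cls i" "{u, v}"] uv by auto
    qed
    moreover have "0 < ?x j" unfolding pos using u(1) j(2) by blast
    moreover have "y ?x j = h j" using tight[OF j u(1)] u(3) by simp
    ultimately show ?R using j(1) by blast
  next
    assume ?R
    then obtain j where j: "j < d" "0 < ?x j" "y ?x j = h j" "cadj i j" "i \<noteq> j \<or> 2 \<le> ?x i" by blast
    have "\<exists>u. u \<in> S \<and> u \<in> cls j \<and> u \<noteq> v"
    proof (cases "i = j")
      case True
      then have "\<not> S \<inter> cls j \<subseteq> {v}" using j(5) card_mono[of "{v}" "S \<inter> cls j"] by auto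
      then show ?thesis by blast
    next
      case False
      then have "v \<notin> cls j" using cls_disjoint[OF v(1) j(1)] v(2) by blast
      then show ?thesis using j(2) unfolding pos by blast
    qed
    then obtain u where u: "u \<in> S" "u \<in> cls j" "u \<noteq> v" by blast
    have "adj u v" using adj_iff_cadj[OF v(1) j(1) v(2) u(2)] u(3) j(4) adj_sym by auto
    moreover have "card (open_nbhd E u \<inter> S) = deg u div 2" using tight[OF j(1) u(2,1)] j(3) by simp
    ultimately show ?L using u(1) by blast
  qed
  have lm: "(\<forall>v\<in>S. \<not> defensive_alliance {..<n} E (S - {v})) \<longleftrightarrow>
      (\<forall>i<d. 0 < ?x i \<longrightarrow> 2 \<le> (\<Sum>j<d. ?x j) \<longrightarrow>
        (\<exists>j<d. 0 < ?x j \<and> y ?x j = h j \<and> cadj i j \<and> (i \<noteq> j \<or> 2 \<le> ?x i)))"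
    (is "_ \<longleftrightarrow> (\<forall>i<d. 0 < ?x i \<longrightarrow> ?C i)") if da: "defensive_alliance {..<n} E S"
  proof -
    have "\<not> defensive_alliance {..<n} E (S - {v}) \<longleftrightarrow> ?C i" if "i < d" "v \<in> cls i" "v \<in> S" for i v
      unfolding not_defensive_alliance_remove[OF da that(3)] card_S one[OF that(3)] ex[OF that]
      by (rule imp_conv_disj[symmetric, of "2 \<le> card S", unfolded not_not])
    then show ?thesis by (rule by_class)
  qed
  have le: "\<forall>i<d. ?x i \<le> card (cls i)" by (simp add: card_mono)
  show ?thesis
  proof (cases "defensive_alliance {..<n} E S")
    case True
    note * = True[unfolded da]
    show ?thesis
      unfolding locally_minimal_defensive_alliance_def lmda_counts_def lm[OF True]
      using True conjunct1[OF *] conjunct2[OF *] le by blast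
  next
    case False
    then show ?thesis
      unfolding locally_minimal_defensive_alliance_def lmda_counts_def da by auto
  qed
qed

text \<open>The classes are disjoint, so subsets of the prescribed sizes can be chosen
  independently.\<close>

lemma ex_set_with_counts:
  assumes "\<forall>i<d. x i \<le> card (cls i)"
  shows "\<exists>S\<subseteq>{..<n}. \<forall>i<d. card (S \<inter> cls i) = x i"
proof -
  have "\<exists>T\<subseteq>cls i. card T = x i" if "i < d" for i
    using assms that by (meson obtain_subset_with_card_n)
  then obtain T where T: "\<And>i. i < d \<Longrightarrow> T i \<subseteq> cls i \<and> card (T i) = x i" by metis
  have "(\<Union>i<d. T i) \<inter> cls j = T j" if "j < d" for j
  proof -
    have "T i \<inter> cls j = {}" if "i < d" "i \<noteq> j" for i
      using cls_disjoint[OF that(1) \<open>j < d\<close> that(2)] T[OF that(1)] by blast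
    then show ?thesis using T[OF that] that by blast
  qed
  moreover have "(\<Union>i<d. T i) \<subseteq> {..<n}" using T cls_subset by blast
  ultimately show ?thesis using T by (intro exI[of _ "\<Union>i<d. T i"]) simp
qed

lemma lmda_counts_cong:
  assumes "\<And>i. i < d \<Longrightarrow> x i = x' i"
  shows "lmda_counts x \<longleftrightarrow> lmda_counts x'"
proof -
  have "y x i = y x' i" for i unfolding y_def using assms by (intro sum.cong) auto
  moreover have "(\<Sum>j<d. x j) = (\<Sum>j<d. x' j)" using assms by (intro sum.cong) auto
  ultimately show ?thesis unfolding lmda_counts_def using assms by (smt (verit))
qed

lemma lmda_problem_iff_counts:
  "lmda_problem (n, E, k) \<longleftrightarrow> (\<exists>x. lmda_counts x \<and> k \<le> int (\<Sum>j<d. x j))"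
proof
  assume "lmda_problem (n, E, k)"
  then obtain S where S: "locally_minimal_defensive_alliance {..<n} E S" "k \<le> int (card S)" by auto
  then have sub: "S \<subseteq> {..<n}"
    unfolding locally_minimal_defensive_alliance_def defensive_alliance_def by blast
  show "\<exists>x. lmda_counts x \<and> k \<le> int (\<Sum>j<d. x j)"
    using S(1)[unfolded locally_minimal_iff_counts[OF sub]] S(2)[unfolded card_by_classes[OF sub]] by blast
next
  assume "\<exists>x. lmda_counts x \<and> k \<le> int (\<Sum>j<d. x j)"
  then obtain x where x: "lmda_counts x" "k \<le> int (\<Sum>j<d. x j)" by blast
  have "\<forall>i<d. x i \<le> card (cls i)" using x(1) unfolding lmda_counts_def by (elim conjE)
  then obtain S where S: "S \<subseteq> {..<n}" "\<forall>i<d. card (S \<inter> cls i) = x i"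
    using ex_set_with_counts by blast
  have "locally_minimal_defensive_alliance {..<n} E S"
    unfolding locally_minimal_iff_counts[OF S(1)] using lmda_counts_cong[of x] S(2) x(1) by simp
  moreover have "k \<le> int (card S)" unfolding card_by_classes[OF S(1)] using S(2) x(2) by simp
  ultimately show "lmda_problem (n, E, k)" by auto
qed

end

section \<open>Threshold tests by carry propagation\<close>

text \<open>Two's complement comparison: instead of subtracting the threshold, its complement is
  added. The summand \<open>2^i\<close> keeps the truncated subtraction exact; only the low
  \<open>i\<close> bits of the threshold enter.\<close>

definition carry :: "nat \<Rightarrow> (nat \<Rightarrow> nat \<Rightarrow> nat) \<Rightarrow> (nat \<Rightarrow> nat) \<Rightarrow> nat \<Rightarrow> (nat \<Rightarrow> nat) \<Rightarrow> nat \<Rightarrow> nat" where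
  "carry d a \<theta> i x c = ((\<Sum>j<d. a c j * x j) + 2^i - \<theta> c mod 2^i) div 2^i"

text \<open>Passing from \<open>2^i\<close> to \<open>2^Suc i\<close> adds \<open>2^i\<close> times
  the bits of \<open>x\<close> and the complemented threshold bit; dividing by \<open>2^i\<close>
  first loses nothing, since iterated integer division composes.\<close>

lemma carry_step:
  "carry d a \<theta> (Suc i) (\<lambda>j. x j + 2^i * e j) c =
     (carry d a \<theta> i x c + (\<Sum>j<d. a c j * e j) + (1 - (\<theta> c div 2^i) mod 2)) div 2"
proof -
  let ?s = "\<Sum>j<d. a c j * x j" and ?e = "\<Sum>j<d. a c j * e j"
  let ?b = "(\<theta> c div 2^i) mod 2"
  have 1: "(\<Sum>j<d. a c j * (x j + 2^i * e j)) = ?s + 2^i * ?e"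
    by (simp add: sum.distrib sum_distrib_left distrib_left mult.left_commute)
  have 2: "\<theta> c mod 2^Suc i = \<theta> c mod 2^i + 2^i * ?b"
    using mod_mult2_eq[of "\<theta> c" "2^i" 2] by (simp add: mult.commute)
  have 3: "\<theta> c mod 2^i \<le> 2^i" by (simp add: less_imp_le)
  have 4: "?b \<le> 1" by simp
  have "2^i * (1 - ?b) + 2^i * ?b = 2^i" using 4 by (metis distrib_left le_add_diff_inverse2 mult.right_neutral)
  then have 5: "?s + 2^i * ?e + 2^Suc i - \<theta> c mod 2^Suc i = (?s + 2^i - \<theta> c mod 2^i) + 2^i * (?e + (1 - ?b))"
    unfolding 2[unfolded power_Suc] distrib_left power_Suc using 3 by linarith
  have 6: "z div 2^Suc i = z div 2^i div 2" for z :: nat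
    by (metis div_mult2_eq power_Suc2)
  have "carry d a \<theta> (Suc i) (\<lambda>j. x j + 2^i * e j) c =
      ((?s + 2^i - \<theta> c mod 2^i) + 2^i * (?e + (1 - ?b))) div 2^i div 2"
    unfolding carry_def 1 5 6 ..
  also have "((?s + 2^i - \<theta> c mod 2^i) + 2^i * (?e + (1 - ?b))) div 2^i = carry d a \<theta> i x c + (?e + (1 - ?b))"
    unfolding carry_def by (simp add: add.commute)
  finally show ?thesis by (simp add: add.assoc)
qed

text \<open>The initial carry 1 is the unit added to the complemented bits in two's
  complement.\<close>

lemma carry_0: "(\<And>j. j < d \<Longrightarrow> x j = 0) \<Longrightarrow> carry d a \<theta> 0 x c = 1"
  by (simp add: carry_def)

text \<open>The bound does not involve \<open>i\<close> or the threshold; this makes the set of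
  states finite in terms of \<open>d\<close>.\<close>

lemma carry_le:
  assumes "\<And>j. j < d \<Longrightarrow> a c j \<le> 1" "\<And>j. j < d \<Longrightarrow> x j < 2^i"
  shows "carry d a \<theta> i x c \<le> Suc d"
proof -
  have "(\<Sum>j<d. a c j * x j) \<le> (\<Sum>j<d. 1 * 2^i)"
    using assms by (intro sum_mono mult_mono) (auto simp: less_imp_le)
  then have "(\<Sum>j<d. a c j * x j) + 2^i - \<theta> c mod 2^i \<le> Suc d * 2^i" by simp
  then show ?thesis unfolding carry_def by (metis div_le_mono nonzero_mult_div_cancel_right power_not_zero zero_neq_numeral)
qed

text \<open>Once all bits of the threshold are read, the quotient is positive iff the sum makes up
  for the subtracted threshold.\<close>

lemma carry_pos_iff:
  assumes "\<theta> c < 2^i"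
  shows "0 < carry d a \<theta> i x c \<longleftrightarrow> \<theta> c \<le> (\<Sum>j<d. a c j * x j)"
  using assms unfolding carry_def by (auto simp: div_greater_zero_iff)

section \<open>Vectors of digits packed into numbers\<close>

definition code :: "nat \<Rightarrow> nat \<Rightarrow> (nat \<Rightarrow> nat) \<Rightarrow> nat" where
  "code B m v = (\<Sum>c<m. v c * B^c)"

lemma code_Suc: "code B (Suc m) v = v 0 + B * code B m (\<lambda>c. v (Suc c))"
  unfolding code_def by (simp add: sum.lessThan_Suc_shift sum_distrib_left mult.left_commute del: sum.lessThan_Suc)

lemma code_less:
  assumes "\<And>c. c < m \<Longrightarrow> v c < B"
  shows "code B m v < B^m"
  using assms
proof (induction m arbitrary: v)
  case (Suc m)
  then have "code B m (\<lambda>c. v (Suc c)) < B^m" by simp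
  then have "B * Suc (code B m (\<lambda>c. v (Suc c))) \<le> B * B^m" by (intro mult_left_mono) auto
  moreover have "v 0 < B" using Suc.prems by simp
  ultimately show ?case unfolding code_Suc by simp
qed (simp add: code_def)

lemma code_add: "code B m u + code B m v = code B m (\<lambda>c. u c + v c)"
  unfolding code_def by (simp add: sum.distrib distrib_right)

lemma code_mult: "x * code B m v = code B m (\<lambda>c. x * v c)"
  unfolding code_def by (simp add: sum_distrib_left mult.assoc)

lemma code_cong: "(\<And>c. c < m \<Longrightarrow> u c = v c) \<Longrightarrow> code B m u = code B m v"
  unfolding code_def by (intro sum.cong) auto

lemma code_digit:
  assumes "\<And>c. c < m \<Longrightarrow> v c < B" "c < m"
  shows "code B m v div B^c mod B = v c"
  using assms
proof (induction c arbitrary: m v)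
  case 0
  then obtain m' where "m = Suc m'" by (cases m) auto
  then show ?case using 0 by (simp add: code_Suc)
next
  case (Suc c)
  then obtain m' where m: "m = Suc m'" by (cases m) auto
  have "v 0 < B" using Suc.prems(1) m by simp
  then have "code B m v div B^Suc c = code B m' (\<lambda>c. v (Suc c)) div B^c"
    unfolding m code_Suc power_Suc div_mult2_eq by simp
  then show ?case using Suc.IH[of m' "\<lambda>c. v (Suc c)"] Suc.prems m by simp
qed

definition half_digits :: "nat \<Rightarrow> nat \<Rightarrow> nat \<Rightarrow> nat" where
  "half_digits B m \<sigma> = code B m (\<lambda>c. (\<sigma> div B^c mod B) div 2)"

lemma half_digits_code:
  assumes "\<And>c. c < m \<Longrightarrow> v c < B"
  shows "half_digits B m (code B m v) = code B m (\<lambda>c. v c div 2)"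
  unfolding half_digits_def by (intro code_cong) (simp add: code_digit assms)

lemma half_digits_0 [simp]: "half_digits B m 0 = 0"
  unfolding half_digits_def code_def by simp

text \<open>Reduces a code to the smaller code without its lowest digit, so a table of halves can be
  filled in increasing order.\<close>

lemma half_digits_rec:
  assumes "\<sigma> < B^m"
  shows "half_digits B m \<sigma> = B * half_digits B m (\<sigma> div B) + (\<sigma> mod B) div 2"
proof (cases m)
  case 0
  then show ?thesis using assms by (simp add: half_digits_def code_def)
next
  case (Suc m')
  \<comment> \<open>After removal of the lowest digit the top one is 0, so the number
    \<open>m\<close> of digits can be kept in the recursion.\<close>
  have "\<sigma> div B div B^m' = 0" using assms unfolding Suc power_Suc
    by (simp flip: div_mult2_eq)
  then have "half_digits B m (\<sigma> div B) = code B m' (\<lambda>c. (\<sigma> div B div B^c mod B) div 2)"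
    unfolding half_digits_def Suc code_def by simp
  then show ?thesis
    unfolding Suc half_digits_def[of B "Suc m'" \<sigma>] code_Suc by (simp add: div_mult2_eq)
qed

text \<open>A system of \<open>m\<close> threshold tests \<open>\<theta> c \<le> (\<Sum>j<d. a c j * x j)\<close> is evaluated by an automaton
  that reads the bits of \<open>x\<close>, least significant first, and whose state is the vector of carries
  arising in the addition of \<open>2^i - \<theta> c\<close> to the left-hand sides. The coefficients being 0 or 1,
  carries never exceed \<open>d + 1\<close>.\<close>

locale threshold_system =
  fixes d m :: nat and a :: "nat \<Rightarrow> nat \<Rightarrow> nat" and \<theta> :: "nat \<Rightarrow> nat"
  assumes a_le_1: "\<And>c j. a c j \<le> 1"
begin

text \<open>A power of two, so multiplication by \<open>B\<close> is \<open>d + 2\<close> doublings.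
  Before halving, a digit is at most \<open>(d + 1) + d + 1\<close>: old carry, bits read, threshold
  bit. Hence \<open>2 * d + 3 \<le> B\<close> excludes overflow between digits.\<close>

definition B :: nat where "B = 2^(d+2)"

text \<open>Adding \<open>col j\<close> to a state means reading a bit 1 of \<open>x j\<close> in
  all tests at once.\<close>

definition col :: "nat \<Rightarrow> nat" where "col j = code B m (\<lambda>c. a c j)"

definition bits :: "nat \<Rightarrow> nat" where "bits i = code B m (\<lambda>c. 1 - (\<theta> c div 2^i) mod 2)"

definition reach :: "nat \<Rightarrow> nat set" where
  "reach i = {code B m (carry d a \<theta> i x) | x. \<forall>j<d. x j < 2^i}"

text \<open>The bits at position \<open>i\<close> are guessed one variable at a time, so that each
  update is a single binary choice instead of one among \<open>2^d\<close>.\<close>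

definition reach_part :: "nat \<Rightarrow> nat \<Rightarrow> nat set" where
  "reach_part i j = {code B m (carry d a \<theta> i x) + (\<Sum>j'<j. e j' * col j') | x e.
     (\<forall>j<d. x j < 2^i) \<and> (\<forall>j. e j \<le> 1)}"

lemma B_bound: "2 * d + 3 \<le> B"
proof -
  have "Suc d \<le> 2^d" by (rule Suc_leI) simp
  then show ?thesis unfolding B_def by simp
qed

lemma reach_0: "reach 0 = {code B m (\<lambda>_. 1)}"
proof -
  have "code B m (carry d a \<theta> 0 x) = code B m (\<lambda>_. 1)" if "\<forall>j<d. x j < 2^0" for x
    using that by (intro code_cong carry_0) auto
  then show ?thesis unfolding reach_def by (auto intro!: exI[of _ "\<lambda>_. 0"])
qed

lemma reach_part_0: "reach_part i 0 = reach i"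
proof -
  have "\<exists>e::nat \<Rightarrow> nat. \<forall>j. e j \<le> 1" by (rule exI[of _ "\<lambda>_. 0"]) simp
  then show ?thesis unfolding reach_part_def reach_def by auto
qed

lemma reach_part_Suc: "reach_part i (Suc j) = reach_part i j \<union> (\<lambda>\<sigma>. \<sigma> + col j) ` reach_part i j"
proof (intro equalityI subsetI)
  fix \<sigma> assume "\<sigma> \<in> reach_part i (Suc j)"
  then obtain x e where *: "\<sigma> = code B m (carry d a \<theta> i x) + (\<Sum>j'<Suc j. e j' * col j')"
    "\<forall>j<d. x j < 2^i" "\<forall>j. e j \<le> 1" unfolding reach_part_def by blast
  let ?\<tau> = "code B m (carry d a \<theta> i x) + (\<Sum>j'<j. e j' * col j')"
  have "?\<tau> \<in> reach_part i j" unfolding reach_part_def using *(2,3) by blast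
  moreover have "e j = 0 \<or> e j = 1" using *(3) by (metis le_antisym less_one not_le zero_le)
  then have "\<sigma> = ?\<tau> \<or> \<sigma> = ?\<tau> + col j" using *(1) by auto
  ultimately show "\<sigma> \<in> reach_part i j \<union> (\<lambda>\<sigma>. \<sigma> + col j) ` reach_part i j" by blast
next
  fix \<sigma> assume "\<sigma> \<in> reach_part i j \<union> (\<lambda>\<sigma>. \<sigma> + col j) ` reach_part i j"
  then obtain \<tau> where "\<tau> \<in> reach_part i j" "\<sigma> = \<tau> + 0 * col j \<or> \<sigma> = \<tau> + 1 * col j" by auto
  then obtain b where b: "\<tau> \<in> reach_part i j" "\<sigma> = \<tau> + b * col j" "b \<le> 1"
    by (metis le_numeral_extra(4) zero_le)
  from b(1) obtain x e where *: "\<tau> = code B m (carry d a \<theta> i x) + (\<Sum>j'<j. e j' * col j')"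
    "\<forall>j<d. x j < 2^i" "\<forall>j. e j \<le> 1" unfolding reach_part_def by blast
  have "(\<Sum>j'<j. (e(j := b)) j' * col j') = (\<Sum>j'<j. e j' * col j')"
    by (rule sum.cong) auto
  then have "(\<Sum>j'<Suc j. (e(j := b)) j' * col j') = (\<Sum>j'<j. e j' * col j') + b * col j"
    by (simp only: sum.lessThan_Suc fun_upd_same)
  then have "\<sigma> = code B m (carry d a \<theta> i x) + (\<Sum>j'<Suc j. (e(j := b)) j' * col j')"
    using b(2) *(1) by simp
  moreover have "\<forall>j'. (e(j := b)) j' \<le> 1" using *(3) b(3) by simp
  ultimately show "\<sigma> \<in> reach_part i (Suc j)" unfolding reach_part_def using *(2) by blast
qed

lemma sum_col: "(\<Sum>j'<j. e j' * col j') = code B m (\<lambda>c. \<Sum>j'<j. a c j' * e j')"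
proof (induction j)
  case 0
  show ?case by (simp add: code_def)
next
  case (Suc j)
  have "(\<Sum>j'<Suc j. e j' * col j') = code B m (\<lambda>c. \<Sum>j'<j. a c j' * e j') + code B m (\<lambda>c. e j * a c j)"
    using Suc by (simp add: col_def code_mult)
  then show ?case unfolding code_add by (simp add: mult.commute)
qed

lemma digits_less_B:
  assumes "\<forall>j<d. x j < 2^i" "\<forall>j. e j \<le> 1" "j \<le> d"
  shows "carry d a \<theta> i x c + (\<Sum>j'<j. a c j' * e j') + (1 - (\<theta> c div 2^i) mod 2) < B"
proof -
  have "carry d a \<theta> i x c \<le> Suc d" using a_le_1 assms(1) by (intro carry_le) auto
  moreover have "(\<Sum>j'<j. a c j' * e j') \<le> (\<Sum>j'<j. 1 * 1)"
    using a_le_1 assms(2) by (intro sum_mono mult_mono) auto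
  ultimately show ?thesis using B_bound assms(3) by simp
qed

text \<open>Keeps the index at which the table of halves is consulted inside the table.\<close>

lemma reach_part_bits_less:
  assumes "\<sigma> \<in> reach_part i j" "j \<le> d"
  shows "\<sigma> + bits i < B^m"
proof -
  obtain x e where *: "\<sigma> = code B m (carry d a \<theta> i x) + (\<Sum>j'<j. e j' * col j')"
    "\<forall>j<d. x j < 2^i" "\<forall>j. e j \<le> 1" using assms(1) unfolding reach_part_def by blast
  show ?thesis unfolding *(1) sum_col bits_def code_add
    using digits_less_B[OF *(2,3) assms(2)] by (intro code_less)
qed

lemma reach_part_less: "\<sigma> \<in> reach_part i j \<Longrightarrow> j \<le> d \<Longrightarrow> \<sigma> < B^m"
  using reach_part_bits_less by fastforce

lemma reach_less: "\<sigma> \<in> reach i \<Longrightarrow> \<sigma> < B^m"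
  using reach_part_less[of \<sigma> i 0] reach_part_0 by simp

text \<open>As no digit overflows, addition of codes and digitwise halving perform
  \<open>carry_step\<close> for all tests simultaneously.\<close>

lemma half_digits_step:
  assumes "\<forall>j<d. x j < 2^i" "\<forall>j. e j \<le> 1"
  shows "half_digits B m (code B m (carry d a \<theta> i x) + (\<Sum>j'<d. e j' * col j') + bits i)
    = code B m (carry d a \<theta> (Suc i) (\<lambda>j. x j + 2^i * e j))"
proof -
  have "half_digits B m (code B m (carry d a \<theta> i x) + (\<Sum>j'<d. e j' * col j') + bits i)
    = code B m (\<lambda>c. (carry d a \<theta> i x c + (\<Sum>j<d. a c j * e j) + (1 - (\<theta> c div 2^i) mod 2)) div 2)"
    unfolding sum_col bits_def code_add
    using digits_less_B[OF assms order_refl] by (intro half_digits_code)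
  also have "\<dots> = code B m (carry d a \<theta> (Suc i) (\<lambda>j. x j + 2^i * e j))"
    by (intro code_cong) (rule carry_step[symmetric])
  finally show ?thesis .
qed

lemma reach_Suc: "reach (Suc i) = (\<lambda>\<sigma>. half_digits B m (\<sigma> + bits i)) ` reach_part i d"
proof (intro equalityI subsetI)
  fix \<sigma> assume "\<sigma> \<in> reach (Suc i)"
  then obtain x where x: "\<sigma> = code B m (carry d a \<theta> (Suc i) x)" "\<forall>j<d. x j < 2^Suc i"
    unfolding reach_def by blast
  define x' where "x' j = x j mod 2^i" for j
  \<comment> \<open>The reduction modulo 2 matters for \<open>j \<ge> d\<close>, where
    \<open>x j\<close> is unrestricted but \<open>e j \<le> 1\<close> is still required.\<close>
  define e where "e j = (x j div 2^i) mod 2" for j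
  have "x j = x' j + 2^i * e j" if "j < d" for j
  proof -
    have "x j div 2^i < 2" using x(2) that by (simp add: less_mult_imp_div_less)
    then show ?thesis unfolding x'_def e_def by simp
  qed
  then have "carry d a \<theta> (Suc i) x c = carry d a \<theta> (Suc i) (\<lambda>j. x' j + 2^i * e j) c" for c
    unfolding carry_def by (metis (no_types, lifting) lessThan_iff sum.cong)
  moreover have *: "\<forall>j<d. x' j < 2^i" "\<forall>j. e j \<le> 1" unfolding x'_def e_def by auto
  ultimately have "\<sigma> = half_digits B m (code B m (carry d a \<theta> i x') + (\<Sum>j'<d. e j' * col j') + bits i)"
    using half_digits_step[OF *] x(1) code_cong by metis
  then show "\<sigma> \<in> (\<lambda>\<sigma>. half_digits B m (\<sigma> + bits i)) ` reach_part i d"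
    unfolding reach_part_def using * by blast
next
  fix \<sigma> assume "\<sigma> \<in> (\<lambda>\<sigma>. half_digits B m (\<sigma> + bits i)) ` reach_part i d"
  then obtain x e where *: "\<forall>j<d. x j < 2^i" "\<forall>j. e j \<le> 1"
    "\<sigma> = half_digits B m (code B m (carry d a \<theta> i x) + (\<Sum>j'<d. e j' * col j') + bits i)"
    unfolding reach_part_def by blast
  have "\<forall>j<d. x j + 2^i * e j < 2^Suc i"
  proof (intro allI impI)
    fix j assume "j < d"
    then have "x j < 2^i" using *(1) by blast
    moreover have "2^i * e j \<le> 2^i * 1" using *(2) by (intro mult_left_mono) auto
    ultimately show "x j + 2^i * e j < 2^Suc i" unfolding power_Suc by linarith
  qed
  then show "\<sigma> \<in> reach (Suc i)"
    unfolding *(3) half_digits_step[OF *(1,2)] reach_def by blast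
qed

lemma reach_digit:
  assumes "\<forall>j<d. x j < 2^i" "c < m"
  shows "code B m (carry d a \<theta> i x) div B^c mod B = carry d a \<theta> i x c"
proof (rule code_digit[OF _ assms(2)])
  fix c
  have "carry d a \<theta> i x c \<le> Suc d" using a_le_1 assms(1) by (intro carry_le) auto
  then show "carry d a \<theta> i x c < B" using B_bound by simp
qed

end

section \<open>Reasoning about loops\<close>

fun wvars :: "com \<Rightarrow> nat set" where
  "wvars (Asg x e) = {x}"
| "wvars (Put a e f) = {}"
| "wvars (Semi c d) = wvars c \<union> wvars d"
| "wvars (Cond e c d) = wvars c \<union> wvars d"
| "wvars (Loop x c) = wvars c"

fun warrs :: "com \<Rightarrow> nat set" where
  "warrs (Asg x e) = {}"
| "warrs (Put a e f) = {a}"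
| "warrs (Semi c d) = warrs c \<union> warrs d"
| "warrs (Cond e c d) = warrs c \<union> warrs d"
| "warrs (Loop x c) = warrs c"

fun loop_vars :: "com \<Rightarrow> nat set" where
  "loop_vars (Asg x e) = {}"
| "loop_vars (Put a e f) = {}"
| "loop_vars (Semi c d) = loop_vars c \<union> loop_vars d"
| "loop_vars (Cond e c d) = loop_vars c \<union> loop_vars d"
| "loop_vars (Loop x c) = insert x (loop_vars c)"

lemma funpow_invariant: "P s \<Longrightarrow> (\<And>s. P s \<Longrightarrow> P (f s)) \<Longrightarrow> P ((f ^^ i) s)"
  by (induction i) auto

lemma sem_frame_var: "x \<notin> wvars c \<Longrightarrow> fst (sem xs c s) x = fst s x"
proof (induction c arbitrary: s)
  case (Loop y c)
  have "fst ((sem xs c ^^ i) s) x = fst s x" for i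
    by (rule funpow_invariant[where P = "\<lambda>t. fst t x = fst s x"]) (use Loop in auto)
  then show ?case by simp
qed auto

lemma sem_frame_arr: "b \<notin> warrs c \<Longrightarrow> snd (sem xs c s) b = snd s b"
proof (induction c arbitrary: s)
  case (Loop y c)
  have "snd ((sem xs c ^^ i) s) b = snd s b" for i
    by (rule funpow_invariant[where P = "\<lambda>t. snd t b = snd s b"]) (use Loop in auto)
  then show ?case by simp
qed auto

text \<open>If no loop bound is assigned within \<open>c\<close>, the values on entry govern all
  loops. This fails for a program that computes its own bounds, which is therefore cut into
  phases.\<close>

lemma loops_bounded_static:
  "loop_vars c \<inter> wvars c = {} \<Longrightarrow> (\<And>x. x \<in> loop_vars c \<Longrightarrow> fst s x \<le> M) \<Longrightarrow> loops_bounded xs M c s"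
proof (induction c arbitrary: s)
  case (Semi c d)
  have "loops_bounded xs M d (sem xs c s)"
  proof (rule Semi.IH(2))
    fix x assume x: "x \<in> loop_vars d"
    then have "x \<notin> wvars c" using Semi.prems(1) by auto
    then show "fst (sem xs c s) x \<le> M" using Semi.prems(2)[of x] x by (simp add: sem_frame_var)
  qed (use Semi.prems in auto)
  moreover have "loops_bounded xs M c s" using Semi.prems by (intro Semi.IH(1)) auto
  ultimately show ?case by simp
next
  case (Cond e c d)
  have "loops_bounded xs M c s" using Cond.prems by (intro Cond.IH(1)) auto
  moreover have "loops_bounded xs M d s" using Cond.prems by (intro Cond.IH(2)) auto
  ultimately show ?case by simp
next
  case (Loop y c)
  have "loops_bounded xs M c ((sem xs c ^^ i) s)" for i
  proof (rule Loop.IH)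
    fix x assume x: "x \<in> loop_vars c"
    then have "x \<notin> wvars c" using Loop.prems(1) by auto
    then have "fst ((sem xs c ^^ i) s) x = fst s x"
      by (intro funpow_invariant[where P = "\<lambda>t. fst t x = fst s x"]) (auto simp: sem_frame_var)
    then show "fst ((sem xs c ^^ i) s) x \<le> M" using Loop.prems(2)[of x] x by simp
  qed (use Loop.prems in auto)
  then show ?case using Loop.prems(2)[of y] by simp
qed auto

definition For :: "nat \<Rightarrow> nat \<Rightarrow> com \<Rightarrow> com" where
  "For x b c = Semi (Asg x (N 0)) (Loop b (Semi c (Asg x (Plus (V x) (N 1)))))"

lemma For_sets [simp]:
  "wvars (For x b c) = insert x (wvars c)" "warrs (For x b c) = warrs c"
  "loop_vars (For x b c) = insert b (loop_vars c)" "wf_com (For x b c) = wf_com c"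
  unfolding For_def by auto

text \<open>The step may assume, besides the invariant, that everything the body never writes is
  unchanged; invariants need only mention what changes.\<close>

lemma For_rule:
  assumes init: "P 0 ((fst s)(x := 0), snd s)"
    and step: "\<And>i t. i < fst s b \<Longrightarrow> fst t x = i \<Longrightarrow> (\<forall>z. z \<notin> insert x (wvars c) \<longrightarrow> fst t z = fst s z) \<Longrightarrow>
      (\<forall>z. z \<notin> warrs c \<longrightarrow> snd t z = snd s z) \<Longrightarrow> P i t \<Longrightarrow>
      P (Suc i) ((fst (sem xs c t))(x := Suc i), snd (sem xs c t))"
    and x: "x \<notin> wvars c" "b \<noteq> x"
  shows "P (fst s b) (sem xs (For x b c) s)"
proof -
  define f where "f = sem xs (Semi c (Asg x (Plus (V x) (N 1))))"
  define s0 where "s0 = ((fst s)(x := 0), snd s)"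
  let ?I = "\<lambda>i t. fst t x = i \<and> (\<forall>z. z \<notin> insert x (wvars c) \<longrightarrow> fst t z = fst s z) \<and>
      (\<forall>z. z \<notin> warrs c \<longrightarrow> snd t z = snd s z) \<and> P i t"
  have f: "f t = ((fst (sem xs c t))(x := Suc (fst t x)), snd (sem xs c t))" for t
    unfolding f_def using x(1) by (simp add: sem_frame_var)
  have "?I i ((f ^^ i) s0)" if "i \<le> fst s b" for i
    using that
  proof (induction i)
    case 0
    have "P 0 s0" unfolding s0_def by (rule init)
    then show ?case by (simp add: s0_def)
  next
    case (Suc i)
    define t where "t = (f ^^ i) s0"
    have I: "?I i t" using Suc unfolding t_def by simp
    have "P (Suc i) ((fst (sem xs c t))(x := Suc i), snd (sem xs c t))"
      using I Suc.prems by (intro step) auto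
    then have "P (Suc i) (f t)" using I f[of t] by simp
    moreover have "(f ^^ Suc i) s0 = f t" unfolding t_def by simp
    moreover have "fst (f t) x = Suc i" "\<forall>z. z \<notin> insert x (wvars c) \<longrightarrow> fst (f t) z = fst s z"
      "\<forall>z. z \<notin> warrs c \<longrightarrow> snd (f t) z = snd s z"
      using I f[of t] by (simp_all add: sem_frame_var sem_frame_arr)
    ultimately show ?case by simp
  qed
  then have "P (fst s b) ((f ^^ fst s b) s0)" by blast
  moreover have "sem xs (For x b c) s = (f ^^ fst s b) s0"
    unfolding For_def f_def s0_def using x(2) by simp
  ultimately show ?thesis by simp
qed

lemma Loop_rule:
  assumes "P 0 s"
    and "\<And>i t. i < fst s b \<Longrightarrow> (\<forall>z. z \<notin> wvars c \<longrightarrow> fst t z = fst s z) \<Longrightarrow>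
      (\<forall>z. z \<notin> warrs c \<longrightarrow> snd t z = snd s z) \<Longrightarrow> P i t \<Longrightarrow> P (Suc i) (sem xs c t)"
  shows "P (fst s b) (sem xs (Loop b c) s)"
proof -
  let ?I = "\<lambda>i t. (\<forall>z. z \<notin> wvars c \<longrightarrow> fst t z = fst s z) \<and>
      (\<forall>z. z \<notin> warrs c \<longrightarrow> snd t z = snd s z) \<and> P i t"
  have "?I i ((sem xs c ^^ i) s)" if "i \<le> fst s b" for i
    using that assms by (induction i) (auto simp: sem_frame_var sem_frame_arr)
  then show ?thesis by simp
qed

declare sem.simps(5) [simp del]

lemma length_concat_rows: "length (concat (map (\<lambda>i. map (f i) [0..<n]) [0..<m])) = m * n"
  by (induction m) auto

lemma nth_concat_rows:
  assumes "u < m" "w < n"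
  shows "concat (map (\<lambda>i. map (f i) [0..<n]) [0..<m]) ! (u * n + w) = f u w"
  using assms
proof (induction m)
  case (Suc m)
  let ?r = "\<lambda>m. concat (map (\<lambda>i. map (f i) [0..<n]) [0..<m])"
  have r: "?r (Suc m) = ?r m @ map (f m) [0..<n]" by simp
  have len: "length (?r m) = m * n" by (rule length_concat_rows)
  show ?case
  proof (cases "u = m")
    case True
    then show ?thesis unfolding r nth_append len using Suc.prems by simp
  next
    case False
    then have u: "u < m" using Suc.prems by simp
    have "Suc u * n \<le> m * n" using u by (intro mult_right_mono) auto
    then have "u * n + w < m * n" using Suc.prems by simp
    then show ?thesis unfolding r nth_append len using Suc.IH[OF u Suc.prems(2)] by simp
  qed
qed simp

locale lmda_input = vertex_graph +
  fixes k :: int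
begin

definition xs :: "nat list" where "xs = lmda_encoding (n, E, k)"

lemma input_sign: "xs ! 0 = of_bool (k < 0)" and input_k: "xs ! 1 = nat \<bar>k\<bar>"
  and input_n: "xs ! 2 = n" and input_length: "length xs = 3 + n * n"
  by (simp_all add: xs_def length_concat_rows)

lemma input_adj:
  assumes "u < n" "w < n"
  shows "3 + (u * n + w) < length xs" "xs ! (3 + (u * n + w)) = of_bool (adj u w)"
proof -
  have "Suc u * n \<le> n * n" using assms by (intro mult_right_mono) auto
  then show "3 + (u * n + w) < length xs" unfolding input_length using assms by simp
  show "xs ! (3 + (u * n + w)) = of_bool (adj u w)"
    using nth_concat_rows[OF assms, of "\<lambda>i j. if {i, j} \<in> E then 1 else 0 :: nat"]
    by (simp add: xs_def nth_append adj_def)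
qed

end

section \<open>The decision program\<close>

text \<open>The variables hold: \<open>vn\<close>, \<open>vd\<close> the numbers of vertices and of type classes; \<open>vm\<close>, \<open>vB\<close>, \<open>vb\<close>, \<open>vW\<close> the
  number of digits of a state, the base \<open>2 ^ vb\<close> of its code, and the number of codes; \<open>vL\<close> the number
  of bits read by the automaton; \<open>vZ\<close> the length of the table of halves; \<open>vk\<close> the truncated size bound;
  \<open>vi, \<dots>, vc\<close> loop counters; the rest is temporary. The arrays hold: \<open>aROW\<close> the input addresses of
  the rows of the adjacency matrix; \<open>aREP\<close>, \<open>aCNT\<close>, \<open>aCLQ\<close>, \<open>aDEG\<close> a representative, the cardinality,
  whether it is a clique, and the degree, for each class; \<open>aPW\<close> the powers of the base; \<open>aQ\<close>, \<open>aR\<close>, \<open>aH\<close>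
  quotient and remainder modulo the base and the digitwise half of each code; \<open>aTH\<close> the thresholds;
  \<open>aCOL\<close> the columns of the coefficient matrix; \<open>aT\<close>, \<open>aU\<close>, \<open>aX\<close> characteristic functions of sets of
  codes; \<open>aDG\<close> the digits of a code.\<close>

abbreviation (input) "vn \<equiv> 0 :: nat"
abbreviation (input) "vd \<equiv> 1 :: nat"
abbreviation (input) "vb \<equiv> 2 :: nat"
abbreviation (input) "vm \<equiv> 3 :: nat"
abbreviation (input) "vB \<equiv> 4 :: nat"
abbreviation (input) "vW \<equiv> 5 :: nat"
abbreviation (input) "vL \<equiv> 6 :: nat"
abbreviation (input) "vZ \<equiv> 7 :: nat"
abbreviation (input) "vk \<equiv> 8 :: nat"
abbreviation (input) "vi \<equiv> 9 :: nat"
abbreviation (input) "vj \<equiv> 10 :: nat"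
abbreviation (input) "vu \<equiv> 11 :: nat"
abbreviation (input) "vv \<equiv> 12 :: nat"
abbreviation (input) "vw \<equiv> 13 :: nat"
abbreviation (input) "vs \<equiv> 14 :: nat"
abbreviation (input) "vl \<equiv> 15 :: nat"
abbreviation (input) "vc \<equiv> 16 :: nat"
abbreviation (input) "vp \<equiv> 17 :: nat"
abbreviation (input) "vq \<equiv> 18 :: nat"
abbreviation (input) "vr \<equiv> 19 :: nat"
abbreviation (input) "vf \<equiv> 20 :: nat"
abbreviation (input) "vg \<equiv> 21 :: nat"
abbreviation (input) "vans \<equiv> 22 :: nat"
abbreviation (input) "vnop \<equiv> 23 :: nat"

abbreviation (input) "aROW \<equiv> 0 :: nat"
abbreviation (input) "aHALF \<equiv> 1 :: nat"
abbreviation (input) "aREP \<equiv> 2 :: nat"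
abbreviation (input) "aCNT \<equiv> 3 :: nat"
abbreviation (input) "aCLQ \<equiv> 4 :: nat"
abbreviation (input) "aDEG \<equiv> 5 :: nat"
abbreviation (input) "aPW \<equiv> 6 :: nat"
abbreviation (input) "aQ \<equiv> 7 :: nat"
abbreviation (input) "aR \<equiv> 8 :: nat"
abbreviation (input) "aH \<equiv> 9 :: nat"
abbreviation (input) "aTH \<equiv> 10 :: nat"
abbreviation (input) "aCOL \<equiv> 11 :: nat"
abbreviation (input) "aT \<equiv> 12 :: nat"
abbreviation (input) "aU \<equiv> 13 :: nat"
abbreviation (input) "aX \<equiv> 14 :: nat"
abbreviation (input) "aDG \<equiv> 15 :: nat"

notation Semi (infixr ";;" 60)

abbreviation Nop :: com where "Nop \<equiv> Asg vnop (V vnop)"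
text \<open>Nonzero means true; since subtraction is truncated, \<open>Minus e f\<close> serves as
  the test that \<open>f\<close> is smaller than \<open>e\<close>.\<close>

abbreviation guard :: "aexp \<Rightarrow> com \<Rightarrow> com" where "guard e c \<equiv> Cond e c Nop"
definition neqE :: "nat \<Rightarrow> nat \<Rightarrow> aexp" where
  "neqE x y = Plus (Minus (V x) (V y)) (Minus (V y) (V x))"

lemma neqE_simps [simp]: "aval xs (neqE x y) s = 0 \<longleftrightarrow> fst s x = fst s y" "wf_aexp (neqE x y)"
  unfolding neqE_def by auto

abbreviation adjE :: "aexp \<Rightarrow> aexp \<Rightarrow> aexp" where "adjE e f \<equiv> In (Plus (A aROW e) f)"

section \<open>Computing the type classes from the input\<close>

text \<open>Repeated addition replaces the product in the row address \<open>3 + u * n\<close>; the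
  3 skips the sign, the absolute value and \<open>n\<close>.\<close>

definition P_rows :: com where
  "P_rows = Asg vp (N 3) ;; For vv vn (Put aROW (V vv) (V vp) ;; Asg vp (Plus (V vp) (V vn)))"

definition P_same :: com where
  "P_same = Asg vf (N 1) ;; For vw vn (guard (neqE vw vu) (guard (neqE vw vv)
     (Cond (adjE (V vu) (V vw)) (guard (Minus (N 1) (adjE (V vv) (V vw))) (Asg vf (N 0)))
       (guard (adjE (V vv) (V vw)) (Asg vf (N 0))))))"

definition P_reps :: com where
  "P_reps = Asg vd (N 0) ;; For vv vn (Asg vg (N 1) ;;
     For vu vn (guard (Minus (V vv) (V vu)) (P_same ;; guard (V vf) (Asg vg (N 0)))) ;;
     guard (V vg) (Put aREP (V vd) (V vv) ;; Asg vd (Plus (V vd) (N 1))))"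

definition P_class :: com where
  "P_class = Asg vp (N 0) ;; Asg vq (N 0) ;; Asg vr (N 0) ;;
     For vv vn (P_same ;; guard (V vf) (Asg vp (Plus (V vp) (N 1))) ;;
       guard (adjE (V vu) (V vv)) (Asg vr (Plus (V vr) (N 1)) ;; guard (V vf) (Asg vq (N 1))))"

definition P_classes :: com where
  "P_classes = For vi vd (Asg vu (A aREP (V vi)) ;; P_class ;;
     Put aCNT (V vi) (V vp) ;; Put aCLQ (V vi) (V vq) ;; Put aDEG (V vi) (V vr))"

lemma P_rows_sets [simp]:
  "wvars P_rows = {vp, vv}" "warrs P_rows = {aROW}" "loop_vars P_rows = {vn}" "wf_com P_rows"
  unfolding P_rows_def by auto

lemma P_same_sets [simp]:
  "wvars P_same = {vf, vw, vnop}" "warrs P_same = {}" "loop_vars P_same = {vn}" "wf_com P_same"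
  unfolding P_same_def by auto

lemma P_reps_sets [simp]:
  "wvars P_reps = {vd, vv, vg, vu, vf, vw, vnop}" "warrs P_reps = {aREP}" "loop_vars P_reps = {vn}"
  "wf_com P_reps"
  unfolding P_reps_def by auto

lemma P_class_sets [simp]:
  "wvars P_class = {vp, vq, vr, vv, vf, vw, vnop}" "warrs P_class = {}" "loop_vars P_class = {vn}"
  "wf_com P_class"
  unfolding P_class_def by auto

lemma P_classes_sets [simp]:
  "wvars P_classes = {vi, vu, vp, vq, vr, vv, vf, vw, vnop}" "warrs P_classes = {aCNT, aCLQ, aDEG}"
  "loop_vars P_classes = {vn, vd}" "wf_com P_classes"
  unfolding P_classes_def by auto

context lmda_input
begin

definition rows_ok :: "store \<Rightarrow> bool" where
  "rows_ok s \<longleftrightarrow> fst s vn = n \<and> (\<forall>u<n. snd s aROW u = 3 + u * n)"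

lemma rows_ok_frame:
  "rows_ok s \<Longrightarrow> fst t vn = fst s vn \<Longrightarrow> snd t aROW = snd s aROW \<Longrightarrow> rows_ok t"
  unfolding rows_ok_def by simp

lemma aval_adjE:
  assumes "rows_ok s" "aval xs e s < n" "aval xs f s < n"
  shows "aval xs (adjE e f) s = of_bool (adj (aval xs e s) (aval xs f s))"
  using assms input_adj[of "aval xs e s" "aval xs f s"] unfolding rows_ok_def
  by (simp add: Let_def add.assoc)

lemma rows_spec:
  assumes "fst s vn = n"
  shows "rows_ok (sem xs P_rows s)"
proof -
  let ?s = "((fst s)(vp := 3), snd s)"
  let ?c = "Put aROW (V vv) (V vp) ;; Asg vp (Plus (V vp) (V vn))"
  let ?P = "\<lambda>i t. fst t vp = 3 + i * n \<and> (\<forall>u<i. snd t aROW u = 3 + u * n)"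
  have "?P (fst ?s vn) (sem xs (For vv vn ?c) ?s)"
    by (rule For_rule[where P = ?P]) (use assms in \<open>auto simp: less_Suc_eq\<close>)
  then show ?thesis unfolding rows_ok_def P_rows_def using assms by (simp add: sem_frame_var)
qed

lemma same_spec:
  assumes "rows_ok s" "fst s vu < n" "fst s vv < n"
  shows "fst (sem xs P_same s) vf = of_bool (same_type E (fst s vu) (fst s vv))"
proof -
  let ?u = "fst s vu" and ?v = "fst s vv"
  let ?s = "((fst s)(vf := 1), snd s)"
  let ?c = "guard (neqE vw vu) (guard (neqE vw vv)
     (Cond (adjE (V vu) (V vw)) (guard (Minus (N 1) (adjE (V vv) (V vw))) (Asg vf (N 0)))
       (guard (adjE (V vv) (V vw)) (Asg vf (N 0)))))"
  let ?P = "\<lambda>i t. fst t vf = of_bool (\<forall>w<i. w \<noteq> ?u \<longrightarrow> w \<noteq> ?v \<longrightarrow> adj ?u w = adj ?v w)"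
  have "?P (fst ?s vn) (sem xs (For vw vn ?c) ?s)"
  proof (rule For_rule[where P = ?P])
    fix i t assume i: "i < fst ?s vn" "fst t vw = i"
      and fr: "\<forall>z. z \<notin> insert vw (wvars ?c) \<longrightarrow> fst t z = fst ?s z"
        "\<forall>z. z \<notin> warrs ?c \<longrightarrow> snd t z = snd ?s z" and P: "?P i t"
    have vars: "fst t vu = ?u" "fst t vv = ?v" "fst t vn = fst s vn" using fr(1) by simp_all
    have rows: "rows_ok t" by (rule rows_ok_frame[OF assms(1)]) (use fr in simp_all)
    have n: "i < n" using i(1) assms(1) unfolding rows_ok_def by simp
    have "aval xs (adjE (V vu) (V vw)) t = of_bool (adj ?u i)" "aval xs (adjE (V vv) (V vw)) t = of_bool (adj ?v i)"
      using aval_adjE[OF rows, of "V vu" "V vw"] aval_adjE[OF rows, of "V vv" "V vw"] vars i n assms(2,3)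
      by simp_all
    moreover have "(\<forall>w<Suc i. w \<noteq> ?u \<longrightarrow> w \<noteq> ?v \<longrightarrow> adj ?u w = adj ?v w) \<longleftrightarrow>
        (\<forall>w<i. w \<noteq> ?u \<longrightarrow> w \<noteq> ?v \<longrightarrow> adj ?u w = adj ?v w) \<and> (i \<noteq> ?u \<longrightarrow> i \<noteq> ?v \<longrightarrow> adj ?u i = adj ?v i)"
      by (auto simp: less_Suc_eq)
    ultimately show "?P (Suc i) ((fst (sem xs ?c t))(vw := Suc i), snd (sem xs ?c t))"
      using P vars i by (simp del: aval.simps(3,4) split: if_splits)
  qed auto
  moreover have "(\<forall>w<n. w \<noteq> ?u \<longrightarrow> w \<noteq> ?v \<longrightarrow> adj ?u w = adj ?v w) \<longleftrightarrow> same_type E ?u ?v"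
    unfolding same_type_iff using adj_less by blast
  ultimately show ?thesis unfolding P_same_def using assms(1) by (simp add: rows_ok_def)
qed

definition reps_ok :: "store \<Rightarrow> bool" where
  "reps_ok s \<longleftrightarrow> rows_ok s \<and> fst s vd = d \<and> (\<forall>i<d. snd s aREP i = rep i)"

lemma reps_spec:
  assumes "rows_ok s"
  shows "reps_ok (sem xs P_reps s)"
proof -
  let ?s = "((fst s)(vd := 0), snd s)"
  let ?b = "guard (Minus (V vv) (V vu)) (P_same ;; guard (V vf) (Asg vg (N 0)))"
  let ?a = "guard (V vg) (Put aREP (V vd) (V vv) ;; Asg vd (Plus (V vd) (N 1)))"
  let ?c = "Asg vg (N 1) ;; For vu vn ?b ;; ?a"
  define Q where "Q v \<longleftrightarrow> (\<forall>u<v. \<not> same_type E u v)" for v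
  let ?R = "\<lambda>i. filter Q [0..<i]"
  let ?P = "\<lambda>i t. fst t vd = length (?R i) \<and> (\<forall>j<length (?R i). snd t aREP j = ?R i ! j)"
  have "?P (fst ?s vn) (sem xs (For vv vn ?c) ?s)"
  proof (rule For_rule[where P = ?P])
    fix i t assume i: "i < fst ?s vn" "fst t vv = i"
      and fr: "\<forall>z. z \<notin> insert vv (wvars ?c) \<longrightarrow> fst t z = fst ?s z"
        "\<forall>z. z \<notin> warrs ?c \<longrightarrow> snd t z = snd ?s z" and P: "?P i t"
    have vn: "fst t vn = n" using fr(1) assms unfolding rows_ok_def by simp
    have rows: "rows_ok t" by (rule rows_ok_frame[OF assms]) (use fr in simp_all)
    have n: "i < n" using i(1) assms unfolding rows_ok_def by simp
    let ?t = "((fst t)(vg := 1), snd t)"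
    \<comment> \<open>The inner loop visits all \<open>n\<close> vertices, but the guard lets only
      those below \<open>i\<close> count; hence the minimum.\<close>
    let ?I = "\<lambda>l r. fst r vg = of_bool (\<forall>u<min l i. \<not> same_type E u i)"
    have "?I (fst ?t vn) (sem xs (For vu vn ?b) ?t)"
    proof (rule For_rule[where P = ?I])
      fix l r assume l: "l < fst ?t vn" "fst r vu = l"
        and fr: "\<forall>z. z \<notin> insert vu (wvars ?b) \<longrightarrow> fst r z = fst ?t z"
          "\<forall>z. z \<notin> warrs ?b \<longrightarrow> snd r z = snd ?t z" and I: "?I l r"
      have vars: "fst r vv = i" "fst r vn = n" using fr(1) i(2) vn by simp_all
      have "rows_ok r" by (rule rows_ok_frame[OF rows]) (use fr vars vn in simp_all)
      then have "fst (sem xs P_same r) vf = of_bool (same_type E l i)"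
        using same_spec[of r] vars l vn n by simp
      moreover have "(\<forall>u<min (Suc l) i. \<not> same_type E u i) \<longleftrightarrow>
          (\<forall>u<min l i. \<not> same_type E u i) \<and> (l < i \<longrightarrow> \<not> same_type E l i)"
        by (auto simp: less_Suc_eq)
      ultimately show "?I (Suc l) ((fst (sem xs ?b r))(vu := Suc l), snd (sem xs ?b r))"
        using I vars l by (simp add: sem_frame_var)
    qed auto
    moreover have "fst ?t vn = n" using vn by simp
    ultimately have "fst (sem xs (For vu vn ?b) ?t) vg = of_bool (Q i)"
      using n unfolding Q_def by (simp add: min_def)
    moreover have "fst (sem xs (For vu vn ?b) ?t) vd = fst t vd" "fst (sem xs (For vu vn ?b) ?t) vv = i"
      "snd (sem xs (For vu vn ?b) ?t) aREP = snd t aREP"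
      using i by (simp_all add: sem_frame_var sem_frame_arr)
    ultimately show "?P (Suc i) ((fst (sem xs ?c t))(vv := Suc i), snd (sem xs ?c t))"
      using P by (simp add: nth_append less_Suc_eq)
  qed auto
  moreover have "?R n = reps" unfolding reps_def Q_def ..
  moreover have "rows_ok (sem xs P_reps s)"
    by (rule rows_ok_frame[OF assms]) (simp_all add: sem_frame_var sem_frame_arr)
  ultimately show ?thesis
    using assms unfolding reps_ok_def P_reps_def d_def rep_def rows_ok_def by simp
qed

lemma card_less_Suc: "card {w. w < Suc i \<and> Q w} = card {w. w < i \<and> Q w} + of_bool (Q i)"
proof -
  have "{w. w < Suc i \<and> Q w} = (if Q i then insert i {w. w < i \<and> Q w} else {w. w < i \<and> Q w})"
    by (auto simp: less_Suc_eq)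
  then show ?thesis by simp
qed

lemma class_spec:
  assumes "rows_ok s" "fst s vu < n"
  defines "u \<equiv> fst s vu" and "t \<equiv> sem xs P_class s"
  shows "fst t vp = card {w. w < n \<and> same_type E u w}"
    "fst t vq = of_bool (\<exists>w<n. same_type E u w \<and> adj u w)" "fst t vr = deg u"
proof -
  let ?s = "((fst s)(vp := 0, vq := 0, vr := 0), snd s)"
  let ?c = "P_same ;; guard (V vf) (Asg vp (Plus (V vp) (N 1))) ;;
       guard (adjE (V vu) (V vv)) (Asg vr (Plus (V vr) (N 1)) ;; guard (V vf) (Asg vq (N 1)))"
  let ?P = "\<lambda>i t. fst t vp = card {w. w < i \<and> same_type E u w} \<and>
    fst t vq = of_bool (\<exists>w<i. same_type E u w \<and> adj u w) \<and> fst t vr = card {w. w < i \<and> adj u w}"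
  have "?P (fst ?s vn) (sem xs (For vv vn ?c) ?s)"
  proof (rule For_rule[where P = ?P])
    fix i r assume i: "i < fst ?s vn" "fst r vv = i"
      and fr: "\<forall>z. z \<notin> insert vv (wvars ?c) \<longrightarrow> fst r z = fst ?s z"
        "\<forall>z. z \<notin> warrs ?c \<longrightarrow> snd r z = snd ?s z" and P: "?P i r"
    have vars: "fst r vu = u" "fst r vn = fst s vn" using fr(1) unfolding u_def by simp_all
    have rows: "rows_ok r" by (rule rows_ok_frame[OF assms(1)]) (use fr in simp_all)
    have n: "i < n" using i(1) assms(1) unfolding rows_ok_def by simp
    define r1 where "r1 = sem xs P_same r"
    have r1: "fst r1 vf = of_bool (same_type E u i)" "fst r1 vu = u" "fst r1 vv = i"
      "fst r1 vp = fst r vp" "fst r1 vq = fst r vq" "fst r1 vr = fst r vr" "fst r1 vn = fst r vn"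
      "snd r1 aROW = snd r aROW"
      using same_spec[OF rows] vars i n assms(2) unfolding r1_def u_def
      by (simp_all add: sem_frame_var sem_frame_arr)
    define r2 where "r2 = sem xs (guard (V vf) (Asg vp (Plus (V vp) (N 1)))) r1"
    have r2: "fst r2 vf = of_bool (same_type E u i)" "fst r2 vu = u" "fst r2 vv = i"
      "fst r2 vp = fst r vp + of_bool (same_type E u i)" "fst r2 vq = fst r vq" "fst r2 vr = fst r vr"
      "fst r2 vn = fst r vn" "snd r2 aROW = snd r aROW"
      using r1 unfolding r2_def by simp_all
    have "rows_ok r2" using rows r2(7,8) by (rule rows_ok_frame)
    then have "aval xs (adjE (V vu) (V vv)) r2 = of_bool (adj u i)"
      using aval_adjE[of r2 "V vu" "V vv"] r2 n assms(2) unfolding u_def by simp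
    moreover have "(\<exists>w<Suc i. same_type E u w \<and> adj u w) \<longleftrightarrow>
      (\<exists>w<i. same_type E u w \<and> adj u w) \<or> same_type E u i \<and> adj u i" by (auto simp: less_Suc_eq)
    ultimately show "?P (Suc i) ((fst (sem xs ?c r))(vv := Suc i), snd (sem xs ?c r))"
      using P r2 unfolding card_less_Suc sem.simps(3) r1_def[symmetric] r2_def[symmetric]
      by (simp del: aval.simps(3,4))
  qed auto
  moreover have "fst ?s vn = n" using assms(1) unfolding rows_ok_def by simp
  moreover have "{w. w < n \<and> adj u w} = open_nbhd E u" unfolding open_nbhd_adj using adj_less by auto
  ultimately show "fst t vp = card {w. w < n \<and> same_type E u w}"
    "fst t vq = of_bool (\<exists>w<n. same_type E u w \<and> adj u w)" "fst t vr = deg u"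
    unfolding t_def P_class_def deg_def by simp_all
qed

definition classes_ok :: "store \<Rightarrow> bool" where
  "classes_ok s \<longleftrightarrow> reps_ok s \<and> (\<forall>i<d. snd s aCNT i = card (cls i) \<and> snd s aCLQ i = a i i \<and>
     snd s aDEG i = deg (rep i))"

lemma reps_ok_frame:
  "reps_ok s \<Longrightarrow> fst t vn = fst s vn \<Longrightarrow> fst t vd = fst s vd \<Longrightarrow> snd t aROW = snd s aROW \<Longrightarrow>
   snd t aREP = snd s aREP \<Longrightarrow> reps_ok t"
  unfolding reps_ok_def rows_ok_def by simp

lemma classes_spec:
  assumes "reps_ok s"
  shows "classes_ok (sem xs P_classes s)"
proof -
  let ?c = "Asg vu (A aREP (V vi)) ;; P_class ;;
     Put aCNT (V vi) (V vp) ;; Put aCLQ (V vi) (V vq) ;; Put aDEG (V vi) (V vr)"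
  let ?P = "\<lambda>i t. \<forall>j<i. snd t aCNT j = card (cls j) \<and> snd t aCLQ j = a j j \<and> snd t aDEG j = deg (rep j)"
  have "?P (fst s vd) (sem xs (For vi vd ?c) s)"
  proof (rule For_rule[where P = ?P])
    fix i t assume i: "i < fst s vd" "fst t vi = i"
      and fr: "\<forall>z. z \<notin> insert vi (wvars ?c) \<longrightarrow> fst t z = fst s z"
        "\<forall>z. z \<notin> warrs ?c \<longrightarrow> snd t z = snd s z" and P: "?P i t"
    have reps: "reps_ok t" by (rule reps_ok_frame[OF assms]) (use fr in simp_all)
    have d: "i < d" using i(1) assms unfolding reps_ok_def by simp
    let ?t = "((fst t)(vu := rep i), snd t)"
    have rows: "rows_ok ?t" using reps unfolding reps_ok_def rows_ok_def by simp
    have rep: "snd t aREP i = rep i" using reps d unfolding reps_ok_def by simp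
    define t1 where "t1 = sem xs P_class ?t"
    have "fst t1 vp = card (cls i)" "fst t1 vq = a i i" "fst t1 vr = deg (rep i)"
      using class_spec[OF rows] rep_props(1)[OF d] unfolding t1_def cls_def cadj_def by auto
    moreover have "fst t1 vi = i" "\<And>z. snd t1 z = snd t z"
      unfolding t1_def using i by (simp_all add: sem_frame_var sem_frame_arr)
    ultimately show "?P (Suc i) ((fst (sem xs ?c t))(vi := Suc i), snd (sem xs ?c t))"
      using P rep i(2) by (simp add: less_Suc_eq t1_def[symmetric])
  qed auto
  moreover have "reps_ok (sem xs P_classes s)"
    by (rule reps_ok_frame[OF assms]) (simp_all add: sem_frame_var sem_frame_arr)
  ultimately show ?thesis using assms unfolding classes_ok_def P_classes_def reps_ok_def by simp
qed

end

section \<open>Tables, thresholds and coefficient columns\<close>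

abbreviation doubleC :: "nat \<Rightarrow> com" where "doubleC x \<equiv> Asg x (Plus (V x) (V x))"

text \<open>Seven digits per class; \<open>n + 2\<close> bits, because thresholds are at most
  \<open>n + 2\<close> and class counts at most \<open>n\<close>, all below
  \<open>2 ^ (n + 2)\<close>.\<close>

definition P_sizes :: com where
  "P_sizes = Asg vb (Plus (V vd) (N 2)) ;;
     Asg vm (Plus (V vd) (Plus (V vd) (Plus (V vd) (Plus (V vd) (Plus (V vd) (Plus (V vd) (V vd))))))) ;;
     Asg vL (Plus (V vn) (N 2)) ;; Asg vB (N 1) ;; Asg vp (N 1)"

definition P_powers :: com where
  "P_powers = Loop vb (doubleC vB) ;; For vc vm (Put aPW (V vc) (V vp) ;; Loop vb (doubleC vp)) ;;
     Asg vW (V vp) ;; Asg vZ (Plus (V vW) (Plus (V vn) (N 3)))"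

text \<open>Uses \<open>(v + 2) div 2 = v div 2 + 1\<close>; the entries 0 and 1 are correct in the
  initial store. The length \<open>vZ\<close> is large enough for remainders of codes, degrees and
  thresholds.\<close>

definition P_halves :: com where
  "P_halves = For vv vZ (Put aHALF (Plus (V vv) (N 2)) (Plus (A aHALF (V vv)) (N 1)))"

text \<open>Quotient and remainder of the loop counter are carried along by counting, and the halves
  follow \<open>half_digits_rec\<close>: \<open>B\<close> times the entry of the quotient plus half
  the remainder.\<close>

definition P_table :: com where
  "P_table = Asg vq (N 0) ;; Asg vr (N 0) ;;
     For vs vW (Put aQ (V vs) (V vq) ;; Put aR (V vs) (V vr) ;;
       Asg vp (A aH (V vq)) ;; Loop vb (doubleC vp) ;;
       Put aH (V vs) (Plus (V vp) (A aHALF (V vr))) ;;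
       Asg vr (Plus (V vr) (N 1)) ;;
       Cond (Minus (V vB) (V vr)) Nop (Asg vr (N 0) ;; Asg vq (Plus (V vq) (N 1))))"


text \<open>With truncated subtraction, \<open>z - (z - k)\<close> is the minimum of
  \<open>z\<close> and \<open>k\<close>.\<close>

definition P_bound :: com where
  "P_bound = Cond (In (N 0)) (Asg vk (N 0))
     (Asg vk (Minus (Plus (V vn) (N 1)) (Minus (Plus (V vn) (N 1)) (In (N 1)))))"

definition P_thresholds :: com where
  "P_thresholds = Asg vc (N 0) ;;
     For vi vd (Put aTH (V vc) (N 1) ;; Put aTH (Plus (V vc) (N 1)) (N 2) ;;
       Put aTH (Plus (V vc) (N 2)) (Plus (A aCNT (V vi)) (N 1)) ;;
       Asg vp (Plus (A aHALF (A aDEG (V vi))) (A aCLQ (V vi))) ;;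
       Put aTH (Plus (V vc) (N 3)) (V vp) ;; Put aTH (Plus (V vc) (N 4)) (Plus (V vp) (N 1)) ;;
       Put aTH (Plus (V vc) (N 5)) (V vk) ;; Put aTH (Plus (V vc) (N 6)) (N 2) ;;
       Asg vc (Plus (V vc) (N 7)))"

definition P_cadj :: com where
  "P_cadj = Cond (neqE vi vj) (Asg vf (adjE (A aREP (V vi)) (A aREP (V vj)))) (Asg vf (A aCLQ (V vi)))"

abbreviation powerE :: "nat \<Rightarrow> aexp" where "powerE t \<equiv> A aPW (Plus (V vc) (N t))"

text \<open>As coefficients are 0 or 1, the code of a column is the sum of the powers of the base at
  which the coefficient is 1.\<close>

definition P_column :: com where
  "P_column = P_cadj ;;
     Cond (neqE vi vj) Nop (Asg vp (Plus (V vp) (Plus (powerE 0) (Plus (powerE 1) (powerE 2))))) ;;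
     guard (V vf) (Asg vp (Plus (V vp) (Plus (powerE 3) (powerE 4)))) ;;
     Asg vp (Plus (V vp) (Plus (powerE 5) (powerE 6))) ;;
     Asg vc (Plus (V vc) (N 7))"

definition P_columns :: com where
  "P_columns = For vj vd (Asg vp (N 0) ;; Asg vc (N 0) ;; For vi vd P_column ;; Put aCOL (V vj) (V vp))"

lemma P_sizes_sets [simp]:
  "wvars P_sizes = {vb, vm, vL, vB, vp}" "warrs P_sizes = {}" "loop_vars P_sizes = {}" "wf_com P_sizes"
  unfolding P_sizes_def by auto

lemma P_powers_sets [simp]:
  "wvars P_powers = {vB, vp, vc, vW, vZ}" "warrs P_powers = {aPW}" "loop_vars P_powers = {vb, vm}"
  "wf_com P_powers"
  unfolding P_powers_def by auto

lemma P_halves_sets [simp]: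
  "wvars P_halves = {vv}" "warrs P_halves = {aHALF}" "loop_vars P_halves = {vZ}" "wf_com P_halves"
  unfolding P_halves_def by auto

lemma P_table_sets [simp]:
  "wvars P_table = {vq, vr, vs, vp, vnop}" "warrs P_table = {aQ, aR, aH}"
  "loop_vars P_table = {vW, vb}" "wf_com P_table"
  unfolding P_table_def by auto

lemma P_bound_sets [simp]:
  "wvars P_bound = {vk}" "warrs P_bound = {}" "loop_vars P_bound = {}" "wf_com P_bound"
  unfolding P_bound_def by auto

lemma P_thresholds_sets [simp]:
  "wvars P_thresholds = {vc, vi, vp}" "warrs P_thresholds = {aTH}" "loop_vars P_thresholds = {vd}"
  "wf_com P_thresholds"
  unfolding P_thresholds_def by auto

lemma P_cadj_sets [simp]:
  "wvars P_cadj = {vf}" "warrs P_cadj = {}" "loop_vars P_cadj = {}" "wf_com P_cadj"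
  unfolding P_cadj_def by auto

lemma P_column_sets [simp]:
  "wvars P_column = {vf, vnop, vp, vc}" "warrs P_column = {}" "loop_vars P_column = {}" "wf_com P_column"
  unfolding P_column_def by auto

lemma P_columns_sets [simp]:
  "wvars P_columns = {vj, vp, vc, vi, vf, vnop}" "warrs P_columns = {aCOL}" "loop_vars P_columns = {vd}"
  "wf_com P_columns"
  unfolding P_columns_def by auto

lemma Loop_double:
  assumes "b \<noteq> x"
  shows "fst (sem xs (Loop b (doubleC x)) s) x = 2 ^ fst s b * fst s x"
  by (rule Loop_rule[where P = "\<lambda>i t. fst t x = 2^i * fst s x"]) auto

lemma less_7_cases:
  assumes "c < 7 * Suc i"
  obtains "c < 7 * i" | "c = 7*i" | "c = 7*i+1" | "c = 7*i+2" | "c = 7*i+3" | "c = 7*i+4" | "c = 7*i+5" | "c = 7*i+6"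
  using assms by (cases "c < 7 * i") force+

lemma sum_lessThan_7: "(\<Sum>c<7 * Suc i. f c) = (\<Sum>c<7 * i. f c) + (f (7*i) + f (7*i+1) + f (7*i+2)) +
    (f (7*i+3) + f (7*i+4)) + (f (7*i+5) + f (7*i+6))" for f :: "nat \<Rightarrow> nat"
proof -
  have "7 * Suc i = Suc (Suc (Suc (Suc (Suc (Suc (Suc (7 * i)))))))" by simp
  then show ?thesis by (simp only: sum.lessThan_Suc) (simp add: eval_nat_numeral)
qed

context lmda_input
begin

text \<open>Each class \<open>i\<close> has seven digits \<open>7 * i + t\<close>: they compare \<open>x i\<close> with 1, 2 and \<open>card (cls i) + 1\<close>, \<open>y x i\<close>
  with \<open>h i\<close> and \<open>h i + 1\<close>, and the total size with the size bound and 2. (The last two do not depend on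
  \<open>i\<close>.)\<close>

definition coef :: "nat \<Rightarrow> nat \<Rightarrow> nat" where
  "coef c j = (let i = c div 7 in
     if c mod 7 < 3 then of_bool (i = j) else if c mod 7 < 5 then a i j else 1)"

text \<open>As \<open>k\<close> may be exponentially large in the input size, it is cut off at \<open>n + 1\<close>.\<close>

definition size_bound :: nat where
  "size_bound = (if k < 0 then 0 else min (nat \<bar>k\<bar>) (Suc n))"

definition thr :: "nat \<Rightarrow> nat" where
  "thr c = (let i = c div 7 in [1, 2, card (cls i) + 1, h i, h i + 1, size_bound, 2] ! (c mod 7))"

lemma coef_at: "t < 7 \<Longrightarrow> coef (7*i+t) j = (if t < 3 then of_bool (i = j) else if t < 5 then a i j else 1)"
  unfolding coef_def by simp

lemma thr_at: "t < 7 \<Longrightarrow> thr (7*i+t) = [1, 2, card (cls i) + 1, h i, h i + 1, size_bound, 2] ! t"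
  unfolding thr_def by simp

lemma coef_simps:
  "coef (7*i) j = of_bool (i = j)" "coef (7*i+1) j = of_bool (i = j)" "coef (7*i+2) j = of_bool (i = j)"
  "coef (7*i+3) j = a i j" "coef (7*i+4) j = a i j" "coef (7*i+5) j = 1" "coef (7*i+6) j = 1"
  using coef_at[of 0] coef_at[of 1] coef_at[of 2] coef_at[of 3] coef_at[of 4] coef_at[of 5] coef_at[of 6]
  by simp_all

lemma thr_simps:
  "thr (7*i) = 1" "thr (7*i+1) = 2" "thr (7*i+2) = card (cls i) + 1" "thr (7*i+3) = h i"
  "thr (7*i+4) = h i + 1" "thr (7*i+5) = size_bound" "thr (7*i+6) = 2"
  using thr_at[of 0] thr_at[of 1] thr_at[of 2] thr_at[of 3] thr_at[of 4] thr_at[of 5] thr_at[of 6]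
  by simp_all

sublocale ts: threshold_system d "7 * d" coef thr
  by unfold_locales (simp add: coef_def Let_def)

abbreviation W :: nat where "W \<equiv> ts.B ^ (7 * d)"

definition sizes_ok :: "store \<Rightarrow> bool" where
  "sizes_ok s \<longleftrightarrow> fst s vn = n \<and> fst s vd = d \<and> fst s vb = d + 2 \<and> fst s vm = 7 * d \<and> fst s vL = n + 2"

definition consts_ok :: "store \<Rightarrow> bool" where
  "consts_ok s \<longleftrightarrow> sizes_ok s \<and> fst s vB = ts.B \<and> fst s vW = W \<and> fst s vZ = W + n + 3 \<and>
     (\<forall>c<7*d. snd s aPW c = ts.B ^ c)"

definition halves_ok :: "store \<Rightarrow> bool" where
  "halves_ok s \<longleftrightarrow> (\<forall>t<W + n + 5. snd s aHALF t = t div 2)"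

lemma sizes_spec:
  assumes "reps_ok s"
  shows "sizes_ok (sem xs P_sizes s)" "fst (sem xs P_sizes s) vB = 1" "fst (sem xs P_sizes s) vp = 1"
  using assms unfolding reps_ok_def rows_ok_def sizes_ok_def P_sizes_def by simp_all

lemma powers_spec:
  assumes "sizes_ok s" "fst s vB = 1" "fst s vp = 1"
  shows "consts_ok (sem xs P_powers s)"
proof -
  let ?c = "Put aPW (V vc) (V vp) ;; Loop vb (doubleC vp)"
  define s1 where "s1 = sem xs (Loop vb (doubleC vB)) s"
  have s1: "fst s1 vB = ts.B" "fst s1 vp = 1" "sizes_ok s1"
    using assms Loop_double[of vb vB xs s] unfolding s1_def sizes_ok_def ts.B_def
    by (simp_all add: sem_frame_var)
  let ?P = "\<lambda>i t. fst t vp = ts.B ^ i \<and> (\<forall>c<i. snd t aPW c = ts.B ^ c)"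
  define s2 where "s2 = sem xs (For vc vm ?c) s1"
  have "?P (fst s1 vm) s2" unfolding s2_def
  proof (rule For_rule[where P = ?P])
    fix i t assume i: "i < fst s1 vm" "fst t vc = i"
      and fr: "\<forall>z. z \<notin> insert vc (wvars ?c) \<longrightarrow> fst t z = fst s1 z" and P: "?P i t"
    have "fst t vb = d + 2" using fr s1(3) unfolding sizes_ok_def by simp
    then have "fst (sem xs ?c t) vp = ts.B * ts.B ^ i"
      using P by (simp add: Loop_double ts.B_def)
    then show "?P (Suc i) ((fst (sem xs ?c t))(vc := Suc i), snd (sem xs ?c t))"
      using P i(2) by (simp add: sem_frame_arr less_Suc_eq)
  qed (use s1 in simp_all)
  moreover have "fst s2 vB = ts.B" "sizes_ok s2"
    using s1 unfolding s2_def sizes_ok_def by (simp_all add: sem_frame_var)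
  ultimately show ?thesis using s1(3)
    unfolding consts_ok_def P_powers_def sizes_ok_def by (simp add: s1_def[symmetric] s2_def[symmetric])
qed

lemma halves_spec:
  assumes "consts_ok s" "snd s aHALF = (\<lambda>_. 0)"
  shows "halves_ok (sem xs P_halves s)"
proof -
  let ?P = "\<lambda>i t. \<forall>j<i + 2. snd t aHALF j = j div 2"
  have "?P (fst s vZ) (sem xs P_halves s)" unfolding P_halves_def
    by (rule For_rule[where P = ?P]) (use assms in \<open>auto simp: less_Suc_eq\<close>)
  then show ?thesis using assms(1) unfolding halves_ok_def consts_ok_def by simp
qed

definition table_ok :: "store \<Rightarrow> bool" where
  "table_ok s \<longleftrightarrow> (\<forall>\<sigma><W. snd s aQ \<sigma> = \<sigma> div ts.B \<and> snd s aR \<sigma> = \<sigma> mod ts.B \<and>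
     snd s aH \<sigma> = half_digits ts.B (7*d) \<sigma>)"

lemma table_spec:
  assumes s: "consts_ok s" "halves_ok s" "snd s aH 0 = 0"
  shows "table_ok (sem xs P_table s)"
proof -
  let ?upd = "Asg vr (Plus (V vr) (N 1)) ;;
       Cond (Minus (V vB) (V vr)) Nop (Asg vr (N 0) ;; Asg vq (Plus (V vq) (N 1)))"
  let ?c = "Put aQ (V vs) (V vq) ;; Put aR (V vs) (V vr) ;;
       Asg vp (A aH (V vq)) ;; Loop vb (doubleC vp) ;;
       Put aH (V vs) (Plus (V vp) (A aHALF (V vr))) ;; ?upd"
  let ?P = "\<lambda>i t. fst t vq = i div ts.B \<and> fst t vr = i mod ts.B \<and> snd t aH 0 = 0 \<and>
    (\<forall>\<sigma><i. snd t aQ \<sigma> = \<sigma> div ts.B \<and> snd t aR \<sigma> = \<sigma> mod ts.B \<and>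
     snd t aH \<sigma> = half_digits ts.B (7*d) \<sigma>)"
  let ?s = "((fst s)(vq := 0, vr := 0), snd s)"
  have B: "3 \<le> ts.B" using ts.B_bound by simp
  have "?P (fst ?s vW) (sem xs (For vs vW ?c) ?s)"
  proof (rule For_rule[where P = ?P])
    fix i t assume i: "i < fst ?s vW" "fst t vs = i"
      and fr: "\<forall>z. z \<notin> insert vs (wvars ?c) \<longrightarrow> fst t z = fst ?s z"
        "\<forall>z. z \<notin> warrs ?c \<longrightarrow> snd t z = snd ?s z" and P: "?P i t"
    have W: "i < W" using i(1) s(1) unfolding consts_ok_def by simp
    have c: "fst t vb = d + 2" "fst t vB = ts.B"
      using fr(1) s(1) unfolding consts_ok_def sizes_ok_def by simp_all
    have "i mod ts.B < W + n + 5" using W mod_less_eq_dividend[of i ts.B] by linarith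
    then have half: "snd t aHALF (i mod ts.B) = i mod ts.B div 2"
      using fr(2) s(2) unfolding halves_ok_def by simp
    \<comment> \<open>For \<open>i = 0\<close> the table is read at the very entry about to be
      written; the initial value 0 is the right one.\<close>
    have H: "snd t aH (i div ts.B) = half_digits ts.B (7*d) (i div ts.B)"
    proof (cases "i = 0")
      case False
      then have "i div ts.B < i" using B by simp
      then show ?thesis using P by simp
    qed (use P in simp)
    define t1 where "t1 = sem xs (Put aQ (V vs) (V vq) ;; Put aR (V vs) (V vr) ;; Asg vp (A aH (V vq))) t"
    define t2 where "t2 = sem xs (Loop vb (doubleC vp)) t1"
    have t1: "fst t1 = (fst t)(vp := snd t aH (i div ts.B))"
      "snd t1 = (snd t)(aQ := (snd t aQ)(i := i div ts.B), aR := (snd t aR)(i := i mod ts.B))"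
      using P i(2) unfolding t1_def by simp_all
    have t2: "fst t2 vp = ts.B * snd t aH (i div ts.B)" "fst t2 vq = i div ts.B" "fst t2 vr = i mod ts.B"
      "fst t2 vs = i" "fst t2 vB = ts.B" "snd t2 = snd t1"
      using t1 c P i(2) unfolding t2_def
      by (auto simp: Loop_double ts.B_def sem_frame_var sem_frame_arr)
    define t3 where "t3 = sem xs (Put aH (V vs) (Plus (V vp) (A aHALF (V vr)))) t2"
    have t3: "fst t3 = fst t2" "snd t3 = (snd t1)(aH := (snd t aH)(i := half_digits ts.B (7*d) i))"
      using t2 t1 half H half_digits_rec[OF W] unfolding t3_def by simp_all
    have t4: "sem xs ?c t = sem xs ?upd t3" unfolding t3_def t2_def t1_def by simp
    have le: "Suc (i mod ts.B) \<le> ts.B" using B by (intro Suc_leI mod_less_divisor) simp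
    have upd: "fst (sem xs ?upd t3) vq = Suc i div ts.B" "fst (sem xs ?upd t3) vr = Suc i mod ts.B"
      "snd (sem xs ?upd t3) = snd t3"
      using t3(1) t2 le by (cases "Suc (i mod ts.B) = ts.B"; simp add: div_Suc mod_Suc)+
    show "?P (Suc i) ((fst (sem xs ?c t))(vs := Suc i), snd (sem xs ?c t))"
      unfolding t4 using upd t3(2) t1(2) P by (auto simp: less_Suc_eq)
  qed (use s(3) in auto)
  then show ?thesis using s(1) unfolding table_ok_def P_table_def consts_ok_def by simp
qed

lemma bound_spec:
  assumes "fst s vn = n"
  shows "fst (sem xs P_bound s) vk = size_bound"
  using assms input_length unfolding P_bound_def size_bound_def
  by (simp add: input_sign input_k[unfolded One_nat_def] Let_def min_def)

lemma deg_rep_le: "i < d \<Longrightarrow> deg (rep i) \<le> n"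
proof -
  have "open_nbhd E v \<subseteq> {..<n}" for v unfolding open_nbhd_adj using adj_less by auto
  then show ?thesis unfolding deg_def using card_mono[of "{..<n}"] by fastforce
qed

definition thresholds_ok :: "store \<Rightarrow> bool" where
  "thresholds_ok s \<longleftrightarrow> (\<forall>c<7*d. snd s aTH c = thr c)"

lemma thresholds_spec:
  assumes s: "classes_ok s" "halves_ok s" "fst s vk = size_bound"
  shows "thresholds_ok (sem xs P_thresholds s)"
proof -
  let ?c = "Put aTH (V vc) (N 1) ;; Put aTH (Plus (V vc) (N 1)) (N 2) ;;
       Put aTH (Plus (V vc) (N 2)) (Plus (A aCNT (V vi)) (N 1)) ;;
       Asg vp (Plus (A aHALF (A aDEG (V vi))) (A aCLQ (V vi))) ;;
       Put aTH (Plus (V vc) (N 3)) (V vp) ;; Put aTH (Plus (V vc) (N 4)) (Plus (V vp) (N 1)) ;;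
       Put aTH (Plus (V vc) (N 5)) (V vk) ;; Put aTH (Plus (V vc) (N 6)) (N 2) ;;
       Asg vc (Plus (V vc) (N 7))"
  let ?P = "\<lambda>i t. fst t vc = 7 * i \<and> (\<forall>c<7*i. snd t aTH c = thr c)"
  let ?s = "((fst s)(vc := 0), snd s)"
  have "?P (fst ?s vd) (sem xs (For vi vd ?c) ?s)"
  proof (rule For_rule[where P = ?P])
    fix i t assume i: "i < fst ?s vd" "fst t vi = i"
      and fr: "\<forall>z. z \<notin> insert vi (wvars ?c) \<longrightarrow> fst t z = fst ?s z"
        "\<forall>z. z \<notin> warrs ?c \<longrightarrow> snd t z = snd ?s z" and P: "?P i t"
    have d: "i < d" using i(1) s(1) unfolding classes_ok_def reps_ok_def by simp
    have "snd t aCNT i = card (cls i)" "snd t aCLQ i = a i i" "snd t aDEG i = deg (rep i)"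
      using fr(2) s(1) d unfolding classes_ok_def by simp_all
    moreover have "snd t aHALF (deg (rep i)) = deg (rep i) div 2"
      using fr(2) s(2) deg_rep_le[OF d] unfolding halves_ok_def by simp
    moreover have "fst t vk = size_bound" using fr(1) s(3) by simp
    ultimately have *: "fst (sem xs ?c t) vc = 7 * Suc i" "snd (sem xs ?c t) aTH =
      (snd t aTH)(7*i := 1, 7*i+1 := 2, 7*i+2 := card (cls i) + 1, 7*i+3 := h i, 7*i+4 := h i + 1,
        7*i+5 := size_bound, 7*i+6 := 2)"
      using P i(2) by (simp_all add: h_def)
    have "snd (sem xs ?c t) aTH c = thr c" if "c < 7 * Suc i" for c
      using that by (rule less_7_cases) (use P in \<open>simp_all only: *(2) fun_upd_def thr_simps, simp_all\<close>)
    then show "?P (Suc i) ((fst (sem xs ?c t))(vi := Suc i), snd (sem xs ?c t))"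
      using *(1) by (simp del: sem.simps)
  qed auto
  then show ?thesis using s(1)
    unfolding thresholds_ok_def P_thresholds_def classes_ok_def reps_ok_def by simp
qed

lemma cadj_spec:
  assumes "classes_ok s" "fst s vi < d" "fst s vj < d"
  shows "fst (sem xs P_cadj s) vf = a (fst s vi) (fst s vj)"
proof -
  have rows: "rows_ok s" and rep: "snd s aREP (fst s vi) = rep (fst s vi)" "snd s aREP (fst s vj) = rep (fst s vj)"
    and clq: "snd s aCLQ (fst s vi) = a (fst s vi) (fst s vi)"
    using assms unfolding classes_ok_def reps_ok_def by auto
  show ?thesis
    using aval_adjE[OF rows, of "A aREP (V vi)" "A aREP (V vj)"] rep clq rep_props(1) assms(2,3)
    unfolding P_cadj_def cadj_def
    by (cases "fst s vi = fst s vj") (simp_all del: aval.simps(4,5))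
qed

definition columns_ok :: "store \<Rightarrow> bool" where
  "columns_ok s \<longleftrightarrow> (\<forall>j<d. snd s aCOL j = ts.col j)"

lemma classes_ok_frame:
  assumes "classes_ok s" "fst t vn = fst s vn" "fst t vd = fst s vd"
    "\<And>b. b \<in> {aROW, aREP, aCNT, aCLQ, aDEG} \<Longrightarrow> snd t b = snd s b"
  shows "classes_ok t"
  using assms unfolding classes_ok_def reps_ok_def rows_ok_def by simp

lemma columns_spec:
  assumes s: "classes_ok s" "consts_ok s"
  shows "columns_ok (sem xs P_columns s)"
proof -
  let ?c = "Asg vp (N 0) ;; Asg vc (N 0) ;; For vi vd P_column ;; Put aCOL (V vj) (V vp)"
  have vd: "fst s vd = d" using s(1) unfolding classes_ok_def reps_ok_def by simp
  let ?P = "\<lambda>i t. \<forall>j<i. snd t aCOL j = ts.col j"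
  have "?P (fst s vd) (sem xs (For vj vd ?c) s)"
  proof (rule For_rule[where P = ?P])
    fix j t assume j: "j < fst s vd" "fst t vj = j"
      and fr: "\<forall>z. z \<notin> insert vj (wvars ?c) \<longrightarrow> fst t z = fst s z"
        "\<forall>z. z \<notin> warrs ?c \<longrightarrow> snd t z = snd s z" and P: "?P j t"
    define t0 where "t0 = ((fst t)(vp := 0, vc := 0), snd t)"
    have t0: "classes_ok t0" by (rule classes_ok_frame[OF s(1)]) (use fr t0_def in auto)
    have pw: "\<forall>c<7*d. snd t0 aPW c = ts.B ^ c" using s(2) fr(2) unfolding consts_ok_def t0_def by simp
    let ?I = "\<lambda>i r. fst r vc = 7 * i \<and> fst r vp = (\<Sum>c<7*i. coef c j * ts.B ^ c)"
    have "?I (fst t0 vd) (sem xs (For vi vd P_column) t0)"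
    proof (rule For_rule[where P = ?I])
      fix i r assume i: "i < fst t0 vd" "fst r vi = i"
        and fr': "\<forall>z. z \<notin> insert vi (wvars P_column) \<longrightarrow> fst r z = fst t0 z"
          "\<forall>z. z \<notin> warrs P_column \<longrightarrow> snd r z = snd t0 z" and I: "?I i r"
      have d: "i < d" using i(1) vd fr(1) unfolding t0_def by simp
      have rc: "classes_ok r" by (rule classes_ok_frame[OF t0]) (use fr' in auto)
      have vj: "fst r vj = j" using fr'(1) j(2) unfolding t0_def by simp
      define r1 where "r1 = sem xs P_cadj r"
      have r1: "fst r1 vf = a i j" "fst r1 vi = i" "fst r1 vj = j" "fst r1 vc = 7*i" "fst r1 vp = fst r vp"
        "snd r1 = snd r"
        using cadj_spec[OF rc] i(2) d j(1) vj vd I unfolding r1_def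
        by (auto simp: sem_frame_var sem_frame_arr)
      have pw': "snd r aPW c = ts.B ^ c" if "c < 7 * Suc i" for c
      proof -
        have "7 * Suc i \<le> 7 * d" using d by (intro mult_left_mono) auto
        then show ?thesis using pw fr'(2) that by simp
      qed
      have "fst (sem xs P_column r) vc = 7 * Suc i"
        unfolding P_column_def using r1 by (simp add: r1_def[symmetric])
      moreover have "fst (sem xs P_column r) vp = (\<Sum>c<7 * Suc i. coef c j * ts.B ^ c)"
        unfolding P_column_def sum_lessThan_7 coef_simps
        using r1 pw'[of "7*i"] pw'[of "7*i+1"] pw'[of "7*i+2"] pw'[of "7*i+3"] pw'[of "7*i+4"]
          pw'[of "7*i+5"] pw'[of "7*i+6"] I
        by (cases "i = j") (simp_all add: r1_def[symmetric])
      ultimately show "?I (Suc i) ((fst (sem xs P_column r))(vi := Suc i), snd (sem xs P_column r))" by simp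
    qed (auto simp: t0_def)
    moreover have "fst t0 vd = d" using vd fr(1) unfolding t0_def by simp
    ultimately have "fst (sem xs (For vi vd P_column) t0) vp = ts.col j"
      unfolding ts.col_def code_def by simp
    moreover have "fst (sem xs (For vi vd P_column) t0) vj = j" "snd (sem xs (For vi vd P_column) t0) = snd t"
      using j(2) by (auto simp: sem_frame_var sem_frame_arr t0_def)
    ultimately show "?P (Suc j) ((fst (sem xs ?c t))(vj := Suc j), snd (sem xs ?c t))"
      using P by (simp add: t0_def[symmetric] less_Suc_eq)
  qed auto
  then show ?thesis unfolding columns_ok_def P_columns_def using vd by simp
qed

end

section \<open>Reachable states and acceptance\<close>

definition P_start :: com where
  "P_start = Asg vp (N 0) ;; For vc vm (Asg vp (Plus (V vp) (A aPW (V vc)))) ;;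
     Put aT (V vp) (N 1) ;; Put aU (V vp) (N 1)"

text \<open>Two arrays are needed: reading from \<open>aT\<close> and writing to \<open>aU\<close>
  prevents a code just added from being shifted by the same column again.\<close>

definition P_extend :: com where
  "P_extend = For vs vW (guard (A aT (V vs)) (Put aU (Plus (V vs) (A aCOL (V vj))) (N 1))) ;;
     For vs vW (Put aT (V vs) (A aU (V vs)))"

text \<open>The thresholds are consumed bit by bit: the lowest bit is the value minus twice its
  half, the power of the base is added if this bit is 0, and the half replaces the
  threshold.\<close>

definition P_bits :: com where
  "P_bits = Asg vq (N 0) ;; For vc vm (Asg vr (A aHALF (A aTH (V vc))) ;;
     guard (Minus (N 1) (Minus (A aTH (V vc)) (Plus (V vr) (V vr)))) (Asg vq (Plus (V vq) (A aPW (V vc)))) ;;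
     Put aTH (V vc) (V vr))"

text \<open>Unlike an extension, this image need not contain the old set, so it is built in a
  cleared third array.\<close>

definition P_shift :: com where
  "P_shift = For vs vW (Put aX (V vs) (N 0)) ;;
     For vs vW (guard (A aT (V vs)) (Put aX (A aH (Plus (V vs) (V vq))) (N 1))) ;;
     For vs vW (Put aT (V vs) (A aX (V vs)) ;; Put aU (V vs) (A aX (V vs)))"

definition P_level :: com where
  "P_level = For vj vd P_extend ;; P_bits ;; P_shift"

definition P_reach :: com where
  "P_reach = P_start ;; For vl vL P_level"

definition P_decode :: com where
  "P_decode = Asg vp (V vs) ;; For vc vm (Put aDG (V vc) (A aR (V vp)) ;; Asg vp (A aQ (V vp)))"

abbreviation digitE :: "nat \<Rightarrow> nat \<Rightarrow> aexp" where "digitE x t \<equiv> A aDG (Plus (V x) (N t))"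

text \<open>Here \<open>vp\<close> and \<open>vc\<close> are the digit offsets \<open>7 * j\<close>
  and \<open>7 * i\<close> of the two classes.\<close>

definition P_witness :: com where
  "P_witness = P_cadj ;;
     guard (V vf) (guard (digitE vp 0) (Cond (digitE vp 4) Nop
       (Cond (neqE vi vj) (Asg vr (N 1)) (guard (digitE vc 1) (Asg vr (N 1)))))) ;;
     Asg vp (Plus (V vp) (N 7))"

definition P_search :: com where
  "P_search = Asg vr (N 0) ;; Asg vp (N 0) ;; For vj vd P_witness"

definition P_check :: com where
  "P_check = guard (digitE vc 2) (Asg vg (N 0)) ;;
     guard (digitE vc 0) (Asg vq (N 1) ;; Cond (digitE vc 3) Nop (Asg vg (N 0)) ;;
       Cond (digitE vc 5) Nop (Asg vg (N 0)) ;;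
       guard (digitE vc 6) (P_search ;; Cond (V vr) Nop (Asg vg (N 0)))) ;;
     Asg vc (Plus (V vc) (N 7))"

definition P_accept :: com where
  "P_accept = Asg vq (N 0) ;; Asg vg (N 1) ;; Asg vc (N 0) ;; For vi vd P_check"

definition P_answer :: com where
  "P_answer = Asg vans (N 0) ;; For vs vW (guard (A aT (V vs)) (P_decode ;; P_accept ;;
     guard (V vg) (guard (V vq) (Asg vans (N 1)))))"

lemma P_start_sets [simp]:
  "wvars P_start = {vp, vc}" "warrs P_start = {aT, aU}" "loop_vars P_start = {vm}" "wf_com P_start"
  unfolding P_start_def by auto

lemma P_extend_sets [simp]:
  "wvars P_extend = {vs, vnop}" "warrs P_extend = {aT, aU}" "loop_vars P_extend = {vW}" "wf_com P_extend"
  unfolding P_extend_def by auto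

lemma P_bits_sets [simp]:
  "wvars P_bits = {vq, vc, vr, vnop}" "warrs P_bits = {aTH}" "loop_vars P_bits = {vm}" "wf_com P_bits"
  unfolding P_bits_def by auto

lemma P_shift_sets [simp]:
  "wvars P_shift = {vs, vnop}" "warrs P_shift = {aX, aT, aU}" "loop_vars P_shift = {vW}" "wf_com P_shift"
  unfolding P_shift_def by auto

lemma P_level_sets [simp]:
  "wvars P_level = {vj, vs, vnop, vq, vc, vr}" "warrs P_level = {aT, aU, aTH, aX}"
  "loop_vars P_level = {vd, vW, vm}" "wf_com P_level"
  unfolding P_level_def by auto

lemma P_reach_sets [simp]:
  "wvars P_reach = {vp, vc, vl, vj, vs, vnop, vq, vr}" "warrs P_reach = {aT, aU, aTH, aX}"
  "loop_vars P_reach = {vm, vL, vd, vW}" "wf_com P_reach"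
  unfolding P_reach_def by auto

lemma P_decode_sets [simp]:
  "wvars P_decode = {vp, vc}" "warrs P_decode = {aDG}" "loop_vars P_decode = {vm}" "wf_com P_decode"
  unfolding P_decode_def by auto

lemma P_witness_sets [simp]:
  "wvars P_witness = {vf, vnop, vr, vp}" "warrs P_witness = {}" "loop_vars P_witness = {}" "wf_com P_witness"
  unfolding P_witness_def by auto

lemma P_search_sets [simp]:
  "wvars P_search = {vr, vp, vj, vf, vnop}" "warrs P_search = {}" "loop_vars P_search = {vd}" "wf_com P_search"
  unfolding P_search_def by auto

lemma P_check_sets [simp]:
  "wvars P_check = {vg, vnop, vq, vr, vp, vj, vf, vc}" "warrs P_check = {}" "loop_vars P_check = {vd}"
  "wf_com P_check"
  unfolding P_check_def by auto

lemma P_accept_sets [simp]: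
  "wvars P_accept = {vi, vg, vnop, vq, vr, vp, vj, vf, vc}" "warrs P_accept = {}"
  "loop_vars P_accept = {vd}" "wf_com P_accept"
  unfolding P_accept_def by auto

lemma P_answer_sets [simp]:
  "wvars P_answer = {vans, vs, vi, vg, vnop, vq, vr, vp, vj, vf, vc}" "warrs P_answer = {aDG}"
  "loop_vars P_answer = {vW, vm, vd}" "wf_com P_answer"
  unfolding P_answer_def by auto

context lmda_input
begin

lemma consts_ok_frame:
  assumes "consts_ok s" "\<And>x. x \<in> {vn, vd, vb, vm, vL, vB, vW, vZ} \<Longrightarrow> fst t x = fst s x" "snd t aPW = snd s aPW"
  shows "consts_ok t"
  using assms unfolding consts_ok_def sizes_ok_def by simp

definition marks :: "store \<Rightarrow> nat set \<Rightarrow> bool" where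
  "marks s S \<longleftrightarrow> (\<forall>\<sigma><W. (snd s aT \<sigma> \<noteq> 0 \<longleftrightarrow> \<sigma> \<in> S) \<and> (snd s aU \<sigma> \<noteq> 0 \<longleftrightarrow> \<sigma> \<in> S))"

lemma marks_frame: "marks s S \<Longrightarrow> snd t aT = snd s aT \<Longrightarrow> snd t aU = snd s aU \<Longrightarrow> marks t S"
  unfolding marks_def by simp

lemma start_spec:
  assumes "consts_ok s" "snd s aT = (\<lambda>_. 0)" "snd s aU = (\<lambda>_. 0)"
  shows "marks (sem xs P_start s) (ts.reach 0)"
proof -
  let ?c = "Asg vp (Plus (V vp) (A aPW (V vc)))"
  let ?s = "((fst s)(vp := 0), snd s)"
  let ?P = "\<lambda>i t. i \<le> 7 * d \<longrightarrow> fst t vp = (\<Sum>c<i. ts.B ^ c)"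
  have "?P (fst ?s vm) (sem xs (For vc vm ?c) ?s)"
    by (rule For_rule[where P = ?P]) (use assms(1) in \<open>auto simp: consts_ok_def\<close>)
  then have "fst (sem xs (For vc vm ?c) ?s) vp = code ts.B (7*d) (\<lambda>_. 1)"
    using assms(1) unfolding consts_ok_def sizes_ok_def code_def by simp
  then show ?thesis
    unfolding marks_def ts.reach_0 P_start_def using assms(2,3) by (simp add: sem_frame_arr)
qed

lemma extend_spec:
  assumes "fst s vW = W" "marks s S" "S \<subseteq> {..<W}"
  shows "marks (sem xs P_extend s) (S \<union> (\<lambda>\<sigma>. \<sigma> + snd s aCOL (fst s vj)) ` S)"
proof -
  let ?q = "snd s aCOL (fst s vj)"
  let ?c1 = "guard (A aT (V vs)) (Put aU (Plus (V vs) (A aCOL (V vj))) (N 1))"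
  let ?c2 = "Put aT (V vs) (A aU (V vs))"
  let ?P = "\<lambda>i t. \<forall>\<sigma><W. snd t aU \<sigma> \<noteq> 0 \<longleftrightarrow> \<sigma> \<in> S \<or> (\<exists>\<tau><i. \<tau> \<in> S \<and> \<sigma> = \<tau> + ?q)"
  define s1 where "s1 = sem xs (For vs vW ?c1) s"
  have "?P (fst s vW) s1" unfolding s1_def
  proof (rule For_rule[where P = ?P])
    fix i t assume i: "i < fst s vW" "fst t vs = i"
      and fr: "\<forall>z. z \<notin> insert vs (wvars ?c1) \<longrightarrow> fst t z = fst s z"
        "\<forall>z. z \<notin> warrs ?c1 \<longrightarrow> snd t z = snd s z" and P: "?P i t"
    have "snd t aT i \<noteq> 0 \<longleftrightarrow> i \<in> S" "snd t aCOL (fst t vj) = ?q"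
      using fr i(1) assms(1,2) unfolding marks_def by simp_all
    then show "?P (Suc i) ((fst (sem xs ?c1 t))(vs := Suc i), snd (sem xs ?c1 t))"
      using P i(2) by (auto simp: less_Suc_eq)
  qed (use assms(2) in \<open>auto simp: marks_def\<close>)
  then have U: "\<forall>\<sigma><W. snd s1 aU \<sigma> \<noteq> 0 \<longleftrightarrow> \<sigma> \<in> S \<union> (\<lambda>\<sigma>. \<sigma> + ?q) ` S"
    using assms(1,3) by (auto simp: subset_iff)
  have W: "fst s1 vW = W" unfolding s1_def using assms(1) by (simp add: sem_frame_var)
  let ?Q = "\<lambda>i t. \<forall>\<sigma><i. snd t aT \<sigma> = snd s1 aU \<sigma>"
  have "?Q (fst s1 vW) (sem xs (For vs vW ?c2) s1)"
    by (rule For_rule[where P = ?Q]) (auto simp: less_Suc_eq)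
  moreover have "snd (sem xs (For vs vW ?c2) s1) aU = snd s1 aU" by (simp add: sem_frame_arr)
  ultimately show ?thesis using U W
    unfolding marks_def P_extend_def sem.simps(3) s1_def[symmetric] by simp
qed

definition thr_level :: "store \<Rightarrow> nat \<Rightarrow> bool" where
  "thr_level s l \<longleftrightarrow> (\<forall>c<7*d. snd s aTH c = thr c div 2^l)"

lemma card_cls_le: "card (cls i) \<le> n"
  using card_mono[OF _ cls_subset] by fastforce

text \<open>The value \<open>n + 2\<close> comes from the threshold \<open>h i + 1\<close>, with the
  degree bounded by \<open>n\<close> and the clique term by 1; it explains the number of bits
  read.\<close>

lemma thr_le:
  assumes "c < 7 * d"
  shows "thr c \<le> n + 2"
proof -
  let ?i = "c div 7"
  have i: "?i < d" using assms by simp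
  have "deg (rep ?i) div 2 \<le> n" using deg_rep_le[OF i] by linarith
  moreover have "a ?i ?i \<le> 1" by simp
  ultimately have h: "h ?i \<le> n + 1" unfolding h_def by linarith
  have b: "size_bound \<le> n + 1" unfolding size_bound_def by simp
  have "c mod 7 < 7" by simp
  then consider "c mod 7 = 0" | "c mod 7 = 1" | "c mod 7 = 2" | "c mod 7 = 3" | "c mod 7 = 4"
    | "c mod 7 = 5" | "c mod 7 = 6" by linarith
  then show "thr c \<le> n + 2"
    unfolding thr_def Let_def using h b card_cls_le[of ?i] by cases simp_all
qed

lemma bits_spec:
  assumes s: "consts_ok s" "halves_ok s" "thr_level s l"
  shows "fst (sem xs P_bits s) vq = ts.bits l" "thr_level (sem xs P_bits s) (Suc l)"
proof -
  let ?c = "Asg vr (A aHALF (A aTH (V vc))) ;;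
     guard (Minus (N 1) (Minus (A aTH (V vc)) (Plus (V vr) (V vr)))) (Asg vq (Plus (V vq) (A aPW (V vc)))) ;;
     Put aTH (V vc) (V vr)"
  let ?b = "\<lambda>c. 1 - (thr c div 2^l) mod 2"
  let ?P = "\<lambda>i t. fst t vq = (\<Sum>c<i. ?b c * ts.B^c) \<and>
    (\<forall>c<7*d. snd t aTH c = (if c < i then thr c div 2^Suc l else thr c div 2^l))"
  let ?s = "((fst s)(vq := 0), snd s)"
  have vm: "fst ?s vm = 7 * d" using s(1) unfolding consts_ok_def sizes_ok_def by simp
  have "?P (fst ?s vm) (sem xs (For vc vm ?c) ?s)"
  proof (rule For_rule[where P = ?P])
    fix i t assume i: "i < fst ?s vm" "fst t vc = i"
      and fr: "\<forall>z. z \<notin> insert vc (wvars ?c) \<longrightarrow> fst t z = fst ?s z"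
        "\<forall>z. z \<notin> warrs ?c \<longrightarrow> snd t z = snd ?s z" and P: "?P i t"
    let ?v = "thr i div 2^l"
    have d: "i < 7 * d" using i(1) vm by simp
    have v: "snd t aTH i = ?v" using P d by simp
    have "?v \<le> thr i" by simp
    then have "?v < W + n + 5" using thr_le[OF d] by linarith
    then have half: "snd t aHALF ?v = ?v div 2" using fr(2) s(2) unfolding halves_ok_def by simp
    have pw: "snd t aPW i = ts.B ^ i" using fr(2) s(1) d unfolding consts_ok_def by simp
    have bit: "Suc 0 - (?v - (?v div 2 + ?v div 2)) = ?b i" by (simp add: minus_div_mult_eq_mod[symmetric] mult_2_right[symmetric])
    have b01: "?b i = 0 \<or> ?b i = 1" by auto
    have div: "?v div 2 = thr i div 2^Suc l" by (metis div_mult2_eq power_Suc2)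
    show "?P (Suc i) ((fst (sem xs ?c t))(vc := Suc i), snd (sem xs ?c t))"
      using P i(2) v half pw bit b01 div by (auto simp: less_Suc_eq)
  qed (use s(3) in \<open>auto simp: thr_level_def\<close>)
  then show "fst (sem xs P_bits s) vq = ts.bits l" "thr_level (sem xs P_bits s) (Suc l)"
    using vm unfolding P_bits_def ts.bits_def code_def thr_level_def by simp_all
qed

lemma shift_spec:
  assumes s: "fst s vW = W" "table_ok s" "marks s S" "S \<subseteq> {..<W}" "\<And>\<sigma>. \<sigma> \<in> S \<Longrightarrow> \<sigma> + fst s vq < W"
  shows "marks (sem xs P_shift s) ((\<lambda>\<sigma>. half_digits ts.B (7*d) (\<sigma> + fst s vq)) ` S)"
proof -
  let ?q = "fst s vq" and ?H = "half_digits ts.B (7*d)"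
  let ?c0 = "Put aX (V vs) (N 0)"
  let ?c1 = "guard (A aT (V vs)) (Put aX (A aH (Plus (V vs) (V vq))) (N 1))"
  let ?c2 = "Put aT (V vs) (A aX (V vs)) ;; Put aU (V vs) (A aX (V vs))"
  let ?P0 = "\<lambda>i t. \<forall>\<sigma><i. snd t aX \<sigma> = 0"
  define s1 where "s1 = sem xs (For vs vW ?c0) s"
  have "?P0 (fst s vW) s1" unfolding s1_def
    by (rule For_rule[where P = ?P0]) (auto simp: less_Suc_eq)
  then have s1: "\<forall>\<sigma><W. snd s1 aX \<sigma> = 0" "fst s1 vW = W" "fst s1 vq = ?q"
    "snd s1 aT = snd s aT" "snd s1 aH = snd s aH"
    using s(1) unfolding s1_def by (simp_all add: sem_frame_var sem_frame_arr)
  let ?P = "\<lambda>i t. \<forall>\<sigma><W. snd t aX \<sigma> \<noteq> 0 \<longleftrightarrow> (\<exists>\<tau><i. \<tau> \<in> S \<and> \<sigma> = ?H (\<tau> + ?q))"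
  define s2 where "s2 = sem xs (For vs vW ?c1) s1"
  have "?P (fst s1 vW) s2" unfolding s2_def
  proof (rule For_rule[where P = ?P])
    fix i t assume i: "i < fst s1 vW" "fst t vs = i"
      and fr: "\<forall>z. z \<notin> insert vs (wvars ?c1) \<longrightarrow> fst t z = fst s1 z"
        "\<forall>z. z \<notin> warrs ?c1 \<longrightarrow> snd t z = snd s1 z" and P: "?P i t"
    have T: "snd t aT i \<noteq> 0 \<longleftrightarrow> i \<in> S" "fst t vq = ?q"
      using fr i(1) s(3) s1 unfolding marks_def by simp_all
    have H: "snd t aH (i + ?q) = ?H (i + ?q)" if "i \<in> S"
      using fr(2) s1(5) s(2) s(5)[OF that] unfolding table_ok_def by simp
    show "?P (Suc i) ((fst (sem xs ?c1 t))(vs := Suc i), snd (sem xs ?c1 t))"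
    proof (cases "i \<in> S")
      case True
      then show ?thesis using P T H[OF True] i(2) by (auto simp: less_Suc_eq)
    next
      case False
      then show ?thesis using P T i(2) by (auto simp: less_Suc_eq)
    qed
  qed (use s1(1) in auto)
  then have X: "\<forall>\<sigma><W. snd s2 aX \<sigma> \<noteq> 0 \<longleftrightarrow> \<sigma> \<in> (\<lambda>\<sigma>. ?H (\<sigma> + ?q)) ` S"
    using s1(2) s(4) by (auto simp: subset_iff)
  have W: "fst s2 vW = W" unfolding s2_def using s1(2) by (simp add: sem_frame_var)
  let ?Q = "\<lambda>i t. \<forall>\<sigma><i. snd t aT \<sigma> = snd s2 aX \<sigma> \<and> snd t aU \<sigma> = snd s2 aX \<sigma>"
  have "?Q (fst s2 vW) (sem xs (For vs vW ?c2) s2)"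
    by (rule For_rule[where P = ?Q]) (auto simp: less_Suc_eq)
  then show ?thesis using X W
    unfolding marks_def P_shift_def sem.simps(3) s1_def[symmetric] s2_def[symmetric] by simp
qed

lemma level_spec:
  assumes s: "consts_ok s" "halves_ok s" "table_ok s" "columns_ok s" "thr_level s l" "marks s (ts.reach l)"
  shows "marks (sem xs P_level s) (ts.reach (Suc l))" "thr_level (sem xs P_level s) (Suc l)"
proof -
  have cs: "fst s vd = d" "fst s vW = W" using s(1) unfolding consts_ok_def sizes_ok_def by simp_all
  let ?P = "\<lambda>i t. i \<le> d \<longrightarrow> marks t (ts.reach_part l i)"
  define s1 where "s1 = sem xs (For vj vd P_extend) s"
  have "?P (fst s vd) s1" unfolding s1_def
  proof (rule For_rule[where P = ?P])
    fix i t assume i: "i < fst s vd" "fst t vj = i"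
      and fr: "\<forall>z. z \<notin> insert vj (wvars P_extend) \<longrightarrow> fst t z = fst s z"
        "\<forall>z. z \<notin> warrs P_extend \<longrightarrow> snd t z = snd s z" and P: "?P i t"
    have d: "i < d" using i(1) cs(1) by simp
    have "snd t aCOL (fst t vj) = ts.col i" using fr(2) s(4) i(2) d unfolding columns_ok_def by simp
    moreover have "fst t vW = W" using fr(1) cs(2) by simp
    moreover have "ts.reach_part l i \<subseteq> {..<W}" using ts.reach_part_less[of _ l i] d by auto
    ultimately have "marks (sem xs P_extend t) (ts.reach_part l (Suc i))"
      using extend_spec[of t "ts.reach_part l i"] P d unfolding ts.reach_part_Suc by simp
    then show "?P (Suc i) ((fst (sem xs P_extend t))(vj := Suc i), snd (sem xs P_extend t))"
      by (auto intro: marks_frame)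
  next
    show "?P 0 ((fst s)(vj := 0), snd s)"
      unfolding ts.reach_part_0 using marks_frame[OF s(6)] by simp
  qed auto
  then have m1: "marks s1 (ts.reach_part l d)" using cs by simp
  have c1: "consts_ok s1" by (rule consts_ok_frame[OF s(1)]) (auto simp: s1_def sem_frame_var sem_frame_arr)
  have h1: "halves_ok s1" "thr_level s1 l"
    using s(2,5) unfolding halves_ok_def thr_level_def s1_def by (simp_all add: sem_frame_arr)
  define s2 where "s2 = sem xs P_bits s1"
  have s2: "fst s2 vq = ts.bits l" "thr_level s2 (Suc l)" "fst s2 vW = W"
    using bits_spec[OF c1 h1] c1 unfolding s2_def consts_ok_def by (simp_all add: sem_frame_var)
  have m2: "marks s2 (ts.reach_part l d)" "table_ok s2"
    using m1 s(3) unfolding s2_def s1_def table_ok_def by (auto intro: marks_frame simp: sem_frame_arr)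
  have "marks (sem xs P_shift s2) (ts.reach (Suc l))"
    unfolding ts.reach_Suc s2(1)[symmetric]
  proof (rule shift_spec[OF s2(3) m2(2,1)])
    show "ts.reach_part l d \<subseteq> {..<W}" using ts.reach_part_less[of _ l d] by auto
    show "\<sigma> + fst s2 vq < W" if "\<sigma> \<in> ts.reach_part l d" for \<sigma>
      unfolding s2(1) using ts.reach_part_bits_less[OF that] by simp
  qed
  moreover have "thr_level (sem xs P_shift s2) (Suc l)"
    using s2(2) unfolding thr_level_def by (simp add: sem_frame_arr)
  ultimately show "marks (sem xs P_level s) (ts.reach (Suc l))" "thr_level (sem xs P_level s) (Suc l)"
    unfolding P_level_def sem.simps(3) s1_def[symmetric] s2_def[symmetric] by simp_all
qed

lemma reach_spec:
  assumes s: "consts_ok s" "halves_ok s" "table_ok s" "columns_ok s" "thresholds_ok s"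
    "snd s aT = (\<lambda>_. 0)" "snd s aU = (\<lambda>_. 0)"
  shows "marks (sem xs P_reach s) (ts.reach (n + 2))"
proof -
  define s1 where "s1 = sem xs P_start s"
  have c1: "consts_ok s1" by (rule consts_ok_frame[OF s(1)]) (auto simp: s1_def sem_frame_var sem_frame_arr)
  let ?P = "\<lambda>i t. marks t (ts.reach i) \<and> thr_level t i"
  have "?P (fst s1 vL) (sem xs (For vl vL P_level) s1)"
  proof (rule For_rule[where P = ?P])
    fix i t assume fr: "\<forall>z. z \<notin> insert vl (wvars P_level) \<longrightarrow> fst t z = fst s1 z"
        "\<forall>z. z \<notin> warrs P_level \<longrightarrow> snd t z = snd s1 z" and P: "?P i t"
    have "consts_ok t" by (rule consts_ok_frame[OF c1]) (use fr in auto)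
    moreover have "halves_ok t" "table_ok t" "columns_ok t"
      using s(2-4) fr(2) unfolding s1_def halves_ok_def table_ok_def columns_ok_def
      by (simp_all add: sem_frame_arr)
    ultimately have "?P (Suc i) (sem xs P_level t)" using level_spec P by blast
    then show "?P (Suc i) ((fst (sem xs P_level t))(vl := Suc i), snd (sem xs P_level t))"
      by (auto intro: marks_frame simp: thr_level_def)
  next
    have "marks s1 (ts.reach 0)" unfolding s1_def using start_spec s(1,6,7) by blast
    moreover have "thr_level s1 0"
      using s(5) unfolding thr_level_def thresholds_ok_def s1_def by (simp add: sem_frame_arr)
    ultimately show "?P 0 ((fst s1)(vl := 0), snd s1)"
      by (auto intro: marks_frame simp: thr_level_def)
  qed auto
  then show ?thesis using c1 unfolding P_reach_def consts_ok_def sizes_ok_def by (simp add: s1_def[symmetric])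
qed

lemma decode_spec:
  assumes s: "consts_ok s" "table_ok s" "fst s vs < W"
  shows "\<forall>c<7*d. snd (sem xs P_decode s) aDG c = fst s vs div ts.B^c mod ts.B"
proof -
  let ?\<sigma> = "fst s vs"
  let ?c = "Put aDG (V vc) (A aR (V vp)) ;; Asg vp (A aQ (V vp))"
  let ?s = "((fst s)(vp := ?\<sigma>), snd s)"
  let ?P = "\<lambda>i t. fst t vp = ?\<sigma> div ts.B^i \<and> (\<forall>c<i. snd t aDG c = ?\<sigma> div ts.B^c mod ts.B)"
  have "?P (fst ?s vm) (sem xs (For vc vm ?c) ?s)"
  proof (rule For_rule[where P = ?P])
    fix i t assume i: "fst t vc = i"
      and fr: "\<forall>z. z \<notin> warrs ?c \<longrightarrow> snd t z = snd ?s z" and P: "?P i t"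
    have "?\<sigma> div ts.B^i \<le> ?\<sigma>" by simp
    then have "?\<sigma> div ts.B^i < W" using s(3) by linarith
    then have "snd t aR (?\<sigma> div ts.B^i) = ?\<sigma> div ts.B^i mod ts.B"
      "snd t aQ (?\<sigma> div ts.B^i) = ?\<sigma> div ts.B^i div ts.B"
      using fr s(2) unfolding table_ok_def by simp_all
    moreover have "?\<sigma> div ts.B^i div ts.B = ?\<sigma> div ts.B^Suc i" by (metis div_mult2_eq power_Suc2)
    ultimately show "?P (Suc i) ((fst (sem xs ?c t))(vc := Suc i), snd (sem xs ?c t))"
      using P i by (simp add: less_Suc_eq)
  qed auto
  then show ?thesis using s(1) unfolding P_decode_def consts_ok_def sizes_ok_def by simp
qed

text \<open>The vector \<open>g\<close> holds the final carries, so a digit is nonzero iff its test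
  succeeds. Tightness of class \<open>j\<close> appears as failure of the test with
  \<open>h j + 1\<close>; the opposite inequality is left to \<open>class_ok\<close>.\<close>

definition witness :: "(nat \<Rightarrow> nat) \<Rightarrow> nat \<Rightarrow> nat \<Rightarrow> bool" where
  "witness g i j \<longleftrightarrow> cadj i j \<and> g (7*j) \<noteq> 0 \<and> g (7*j+4) = 0 \<and> (i \<noteq> j \<or> g (7*i+1) \<noteq> 0)"

text \<open>The tests 5 and 6 concern the total size. They may sit under the condition that class
  \<open>i\<close> is non-empty, since \<open>accepting\<close> demands such a class.\<close>

definition class_ok :: "(nat \<Rightarrow> nat) \<Rightarrow> nat \<Rightarrow> bool" where
  "class_ok g i \<longleftrightarrow> g (7*i+2) = 0 \<and> (g (7*i) \<noteq> 0 \<longrightarrow> g (7*i+3) \<noteq> 0 \<and> g (7*i+5) \<noteq> 0 \<and>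
     (g (7*i+6) \<noteq> 0 \<longrightarrow> (\<exists>j<d. witness g i j)))"

definition accepting :: "(nat \<Rightarrow> nat) \<Rightarrow> bool" where
  "accepting g \<longleftrightarrow> (\<exists>i<d. g (7*i) \<noteq> 0) \<and> (\<forall>i<d. class_ok g i)"

lemma search_spec:
  assumes s: "classes_ok s" "fst s vi = i" "i < d" "fst s vc = 7 * i"
  shows "fst (sem xs P_search s) vr \<noteq> 0 \<longleftrightarrow> (\<exists>j<d. witness (snd s aDG) i j)"
proof -
  let ?g = "snd s aDG"
  let ?P = "\<lambda>l t. fst t vp = 7 * l \<and> (fst t vr \<noteq> 0 \<longleftrightarrow> (\<exists>j<l. witness ?g i j))"
  let ?s = "((fst s)(vr := 0, vp := 0), snd s)"
  have d: "fst ?s vd = d" using s(1) unfolding classes_ok_def reps_ok_def by simp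
  have "?P (fst ?s vd) (sem xs (For vj vd P_witness) ?s)"
  proof (rule For_rule[where P = ?P])
    fix j t assume j: "j < fst ?s vd" "fst t vj = j"
      and fr: "\<forall>z. z \<notin> insert vj (wvars P_witness) \<longrightarrow> fst t z = fst ?s z"
        "\<forall>z. z \<notin> warrs P_witness \<longrightarrow> snd t z = snd ?s z" and P: "?P j t"
    have vars: "fst t vi = i" "fst t vc = 7 * i" "snd t aDG = ?g" using fr s(2,4) by simp_all
    have ct: "classes_ok t" by (rule classes_ok_frame[OF s(1)]) (use fr in auto)
    define t1 where "t1 = sem xs P_cadj t"
    have t1: "fst t1 vf = a i j" "fst t1 vi = i" "fst t1 vj = j" "fst t1 vc = 7 * i" "fst t1 vp = fst t vp"
      "fst t1 vr = fst t vr" "snd t1 aDG = ?g"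
      using cadj_spec[OF ct] vars s(3) j d unfolding t1_def by (simp_all add: sem_frame_var sem_frame_arr)
    have ex: "(\<exists>j'<Suc j. witness ?g i j') \<longleftrightarrow> (\<exists>j'<j. witness ?g i j') \<or> witness ?g i j"
      by (auto simp: less_Suc_eq)
    have "fst (sem xs P_witness t) vp = 7 * Suc j"
      unfolding P_witness_def sem.simps(3) t1_def[symmetric] using t1 P by simp
    moreover have "fst (sem xs P_witness t) vr \<noteq> 0 \<longleftrightarrow> fst t vr \<noteq> 0 \<or> witness ?g i j"
      unfolding P_witness_def sem.simps(3) t1_def[symmetric] witness_def using t1 P by auto
    ultimately show "?P (Suc j) ((fst (sem xs P_witness t))(vj := Suc j), snd (sem xs P_witness t))"
      using P ex by simp
  qed auto
  then show ?thesis using d unfolding P_search_def by simp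
qed

lemma accept_spec:
  assumes s: "classes_ok s"
  defines "t \<equiv> sem xs P_accept s"
  shows "fst t vg \<noteq> 0 \<and> fst t vq \<noteq> 0 \<longleftrightarrow> accepting (snd s aDG)"
proof -
  let ?g = "snd s aDG"
  let ?P = "\<lambda>l t. fst t vc = 7 * l \<and> (fst t vq \<noteq> 0 \<longleftrightarrow> (\<exists>i<l. ?g (7*i) \<noteq> 0)) \<and>
    (fst t vg \<noteq> 0 \<longleftrightarrow> (\<forall>i<l. class_ok ?g i))"
  let ?s = "((fst s)(vq := 0, vg := 1, vc := 0), snd s)"
  have d: "fst ?s vd = d" using s(1) unfolding classes_ok_def reps_ok_def by simp
  have "?P (fst ?s vd) (sem xs (For vi vd P_check) ?s)"
  proof (rule For_rule[where P = ?P])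
    fix i t assume i: "i < fst ?s vd" "fst t vi = i"
      and fr: "\<forall>z. z \<notin> insert vi (wvars P_check) \<longrightarrow> fst t z = fst ?s z"
        "\<forall>z. z \<notin> warrs P_check \<longrightarrow> snd t z = snd ?s z" and P: "?P i t"
    have id: "i < d" using i(1) d by simp
    have g: "snd t aDG = ?g" using fr by simp
    have cl: "classes_ok t" by (rule classes_ok_frame[OF s]) (use fr in auto)
    have search: "fst (sem xs P_search r) vr \<noteq> 0 \<longleftrightarrow> (\<exists>j<d. witness ?g i j)"
      "fst (sem xs P_search r) vg = fst r vg" "fst (sem xs P_search r) vq = fst r vq"
      "fst (sem xs P_search r) vc = 7 * i" "snd (sem xs P_search r) = snd r"
      if "snd r = snd t" "fst r vn = fst t vn" "fst r vd = fst t vd" "fst r vi = i" "fst r vc = 7 * i" for r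
    proof -
      have "classes_ok r" by (rule classes_ok_frame[OF cl]) (use that in auto)
      then show "fst (sem xs P_search r) vr \<noteq> 0 \<longleftrightarrow> (\<exists>j<d. witness ?g i j)"
        using search_spec[of r i] that id g by simp
    qed (use that in \<open>auto simp: sem_frame_var sem_frame_arr\<close>)
    have "fst (sem xs P_check t) vc = 7 * Suc i"
      unfolding P_check_def using P i(2) by (simp add: sem_frame_var)
    moreover have "fst (sem xs P_check t) vq \<noteq> 0 \<longleftrightarrow> fst t vq \<noteq> 0 \<or> ?g (7*i) \<noteq> 0"
      unfolding P_check_def using P g by (simp add: sem_frame_var)
    moreover have "fst (sem xs P_check t) vg \<noteq> 0 \<longleftrightarrow> fst t vg \<noteq> 0 \<and> class_ok ?g i"
      unfolding P_check_def class_ok_def using P g i(2)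
      by (simp add: search del: neq0_conv)
    moreover have "(\<exists>i'<Suc i. ?g (7*i') \<noteq> 0) \<longleftrightarrow> (\<exists>i'<i. ?g (7*i') \<noteq> 0) \<or> ?g (7*i) \<noteq> 0"
      "(\<forall>i'<Suc i. class_ok ?g i') \<longleftrightarrow> (\<forall>i'<i. class_ok ?g i') \<and> class_ok ?g i"
      by (auto simp: less_Suc_eq)
    ultimately show "?P (Suc i) ((fst (sem xs P_check t))(vi := Suc i), snd (sem xs P_check t))"
      using P by simp
  qed auto
  then show ?thesis using d unfolding t_def P_accept_def accepting_def by auto
qed

lemma class_ok_cong:
  assumes "\<And>c. c < 7 * d \<Longrightarrow> g c = g' c" "i < d"
  shows "class_ok g i = class_ok g' i"
proof -
  have "witness g i j = witness g' i j" if "j < d" for j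
  proof -
    have "g (7*j) = g' (7*j)" "g (7*j+4) = g' (7*j+4)" "g (7*i+1) = g' (7*i+1)"
      using assms that by auto
    then show ?thesis unfolding witness_def by simp
  qed
  then have "(\<exists>j<d. witness g i j) = (\<exists>j<d. witness g' i j)" by auto
  moreover have "g (7*i) = g' (7*i)" "g (7*i+2) = g' (7*i+2)" "g (7*i+3) = g' (7*i+3)"
    "g (7*i+5) = g' (7*i+5)" "g (7*i+6) = g' (7*i+6)"
    using assms by auto
  ultimately show ?thesis unfolding class_ok_def by simp
qed

lemma accepting_cong:
  assumes "\<And>c. c < 7 * d \<Longrightarrow> g c = g' c"
  shows "accepting g = accepting g'"
  unfolding accepting_def using class_ok_cong[OF assms] assms by auto

lemma answer_spec:
  assumes s: "classes_ok s" "consts_ok s" "table_ok s" "marks s S" "S \<subseteq> {..<W}"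
  shows "fst (sem xs P_answer s) vans \<noteq> 0 \<longleftrightarrow> (\<exists>\<sigma>\<in>S. accepting (\<lambda>c. \<sigma> div ts.B^c mod ts.B))"
proof -
  let ?acc = "\<lambda>\<sigma>. accepting (\<lambda>c. \<sigma> div ts.B^c mod ts.B)"
  let ?e = "guard (V vg) (guard (V vq) (Asg vans (N 1)))"
  let ?c = "guard (A aT (V vs)) (P_decode ;; P_accept ;; ?e)"
  let ?P = "\<lambda>i t. fst t vans \<noteq> 0 \<longleftrightarrow> (\<exists>\<sigma><i. \<sigma> \<in> S \<and> ?acc \<sigma>)"
  let ?s = "((fst s)(vans := 0), snd s)"
  have W: "fst ?s vW = W" using s(2) unfolding consts_ok_def by simp
  have "?P (fst ?s vW) (sem xs (For vs vW ?c) ?s)"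
  proof (rule For_rule[where P = ?P])
    fix i t assume i: "i < fst ?s vW" "fst t vs = i"
      and fr: "\<forall>z. z \<notin> insert vs (wvars ?c) \<longrightarrow> fst t z = fst ?s z"
        "\<forall>z. z \<notin> warrs ?c \<longrightarrow> snd t z = snd ?s z" and P: "?P i t"
    have iW: "i < W" using i(1) W by simp
    have T: "snd t aT i \<noteq> 0 \<longleftrightarrow> i \<in> S" using fr(2) s(4) iW unfolding marks_def by simp
    have cl: "classes_ok t" by (rule classes_ok_frame[OF s(1)]) (use fr in auto)
    have co: "consts_ok t" by (rule consts_ok_frame[OF s(2)]) (use fr in auto)
    have ta: "table_ok t" using s(3) fr(2) unfolding table_ok_def by simp
    define t1 where "t1 = sem xs P_decode t"
    have "\<forall>c<7*d. snd t1 aDG c = i div ts.B^c mod ts.B"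
      using decode_spec[OF co ta] iW i(2) unfolding t1_def by simp
    then have acc: "accepting (snd t1 aDG) \<longleftrightarrow> ?acc i" by (intro accepting_cong) simp
    have "classes_ok t1"
      by (rule classes_ok_frame[OF cl]) (auto simp: t1_def sem_frame_var sem_frame_arr)
    from accept_spec[OF this]
    have "fst (sem xs P_accept t1) vg \<noteq> 0 \<and> fst (sem xs P_accept t1) vq \<noteq> 0 \<longleftrightarrow> ?acc i"
      using acc by simp
    moreover have "fst (sem xs P_accept t1) vans = fst t vans" by (simp add: t1_def sem_frame_var)
    ultimately have "fst (sem xs ?e (sem xs P_accept t1)) vans \<noteq> 0 \<longleftrightarrow> fst t vans \<noteq> 0 \<or> ?acc i"
      by auto
    moreover have "sem xs ?c t = (if i \<in> S then sem xs ?e (sem xs P_accept t1) else t)"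
      using T i(2) unfolding t1_def by simp
    moreover have "(\<exists>\<sigma><Suc i. \<sigma> \<in> S \<and> ?acc \<sigma>) \<longleftrightarrow> (\<exists>\<sigma><i. \<sigma> \<in> S \<and> ?acc \<sigma>) \<or> i \<in> S \<and> ?acc i"
      by (auto simp: less_Suc_eq)
    ultimately show "?P (Suc i) ((fst (sem xs ?c t))(vs := Suc i), snd (sem xs ?c t))"
      using P by (simp del: sem.simps)
  qed auto
  then show ?thesis using W s(5) unfolding P_answer_def by auto
qed

text \<open>Cutting \<open>k\<close> off at \<open>n + 1\<close> is harmless because no set of
  vertices exceeds \<open>n\<close>.\<close>

lemma size_bound_le_iff:
  assumes "m \<le> n"
  shows "size_bound \<le> m \<longleftrightarrow> k \<le> int m"
  using assms unfolding size_bound_def by auto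

lemma thr_sum:
  assumes "i < d"
  shows "(\<Sum>j<d. coef (7*i) j * x j) = x i" "(\<Sum>j<d. coef (7*i+1) j * x j) = x i"
    "(\<Sum>j<d. coef (7*i+2) j * x j) = x i" "(\<Sum>j<d. coef (7*i+3) j * x j) = y x i"
    "(\<Sum>j<d. coef (7*i+4) j * x j) = y x i" "(\<Sum>j<d. coef (7*i+5) j * x j) = (\<Sum>j<d. x j)"
    "(\<Sum>j<d. coef (7*i+6) j * x j) = (\<Sum>j<d. x j)"
proof -
  have "(\<Sum>j<d. of_bool (i = j) * x j) = (\<Sum>j<d. if j = i then x j else 0)"
    by (intro sum.cong) auto
  then have "(\<Sum>j<d. of_bool (i = j) * x j) = x i" using assms by simp
  then show "(\<Sum>j<d. coef (7*i) j * x j) = x i" "(\<Sum>j<d. coef (7*i+1) j * x j) = x i"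
    "(\<Sum>j<d. coef (7*i+2) j * x j) = x i" "(\<Sum>j<d. coef (7*i+3) j * x j) = y x i"
    "(\<Sum>j<d. coef (7*i+4) j * x j) = y x i" "(\<Sum>j<d. coef (7*i+5) j * x j) = (\<Sum>j<d. x j)"
    "(\<Sum>j<d. coef (7*i+6) j * x j) = (\<Sum>j<d. x j)"
    unfolding coef_simps y_def by simp_all
qed

lemma accepting_iff:
  assumes g: "\<And>c. c < 7 * d \<Longrightarrow> g c \<noteq> 0 \<longleftrightarrow> thr c \<le> (\<Sum>j<d. coef c j * x j)"
  shows "accepting g \<longleftrightarrow> lmda_counts x \<and> k \<le> int (\<Sum>j<d. x j)"
proof -
  have at: "g (7*i) = 0 \<longleftrightarrow> x i = 0" "g (7*i+1) = 0 \<longleftrightarrow> \<not> 2 \<le> x i" "g (7*i+2) = 0 \<longleftrightarrow> x i \<le> card (cls i)"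
    "g (7*i+3) = 0 \<longleftrightarrow> \<not> h i \<le> y x i" "g (7*i+4) = 0 \<longleftrightarrow> y x i \<le> h i"
    "g (7*i+5) = 0 \<longleftrightarrow> \<not> size_bound \<le> (\<Sum>j<d. x j)" "g (7*i+6) = 0 \<longleftrightarrow> \<not> 2 \<le> (\<Sum>j<d. x j)"
    if i: "i < d" for i
  proof -
    have lt: "7*i < 7*d" "7*i+1 < 7*d" "7*i+2 < 7*d" "7*i+3 < 7*d" "7*i+4 < 7*d" "7*i+5 < 7*d" "7*i+6 < 7*d"
      using i by simp_all
    note * = g[OF lt(1)] g[OF lt(2)] g[OF lt(3)] g[OF lt(4)] g[OF lt(5)] g[OF lt(6)] g[OF lt(7)]
    note ** = *[unfolded thr_sum[OF i] thr_simps]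
    show "g (7*i) = 0 \<longleftrightarrow> x i = 0" "g (7*i+1) = 0 \<longleftrightarrow> \<not> 2 \<le> x i" "g (7*i+2) = 0 \<longleftrightarrow> x i \<le> card (cls i)"
      "g (7*i+3) = 0 \<longleftrightarrow> \<not> h i \<le> y x i" "g (7*i+4) = 0 \<longleftrightarrow> y x i \<le> h i"
      "g (7*i+5) = 0 \<longleftrightarrow> \<not> size_bound \<le> (\<Sum>j<d. x j)" "g (7*i+6) = 0 \<longleftrightarrow> \<not> 2 \<le> (\<Sum>j<d. x j)"
      using ** by linarith+
  qed
  let ?ex = "\<lambda>i. \<exists>j<d. 0 < x j \<and> y x j \<le> h j \<and> cadj i j \<and> (i \<noteq> j \<or> 2 \<le> x i)"
  have wit: "witness g i j \<longleftrightarrow> 0 < x j \<and> y x j \<le> h j \<and> cadj i j \<and> (i \<noteq> j \<or> 2 \<le> x i)"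
    if "i < d" "j < d" for i j
    unfolding witness_def at[OF that(1)] at[OF that(2)] by auto
  have cls: "class_ok g i \<longleftrightarrow> x i \<le> card (cls i) \<and>
      (0 < x i \<longrightarrow> h i \<le> y x i \<and> size_bound \<le> (\<Sum>j<d. x j) \<and> (2 \<le> (\<Sum>j<d. x j) \<longrightarrow> ?ex i))"
    if i: "i < d" for i
  proof -
    have "(\<exists>j<d. witness g i j) \<longleftrightarrow> ?ex i" using wit[OF i] by metis
    then show ?thesis unfolding class_ok_def at[OF i] not_not by simp
  qed
  have pos: "(\<exists>i<d. g (7*i) \<noteq> 0) \<longleftrightarrow> (\<exists>i<d. 0 < x i)" using at(1) by (metis neq0_conv)
  show ?thesis
  \<comment> \<open>Two translations hold only in the positive case: the size bound needs a total of
    at most \<open>n\<close>, and \<open>y x j \<le> h j\<close> means equality only if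
    \<open>h j \<le> y x j\<close>. In the other case both sides fail.\<close>
  proof (cases "(\<exists>i<d. 0 < x i) \<and> (\<forall>i<d. x i \<le> card (cls i)) \<and> (\<forall>i<d. 0 < x i \<longrightarrow> h i \<le> y x i)")
    case True
    then have pos': "\<exists>i<d. 0 < x i" and le: "\<forall>i<d. x i \<le> card (cls i)"
      and ge: "\<forall>i<d. 0 < x i \<longrightarrow> h i \<le> y x i" by blast+
    have "(\<Sum>j<d. x j) \<le> (\<Sum>j<d. card ({..<n} \<inter> cls j))"
      using le cls_subset by (intro sum_mono) (simp add: Int_absorb1)
    then have "(\<Sum>j<d. x j) \<le> n" using card_by_classes[of "{..<n}"] by simp
    then have sb: "size_bound \<le> (\<Sum>j<d. x j) \<longleftrightarrow> k \<le> int (\<Sum>j<d. x j)" by (rule size_bound_le_iff)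
    have ex: "?ex i \<longleftrightarrow> (\<exists>j<d. 0 < x j \<and> y x j = h j \<and> cadj i j \<and> (i \<noteq> j \<or> 2 \<le> x i))" for i
      using ge by (metis le_antisym order_refl)
    have "accepting g \<longleftrightarrow> k \<le> int (\<Sum>j<d. x j) \<and> (\<forall>i<d. 0 < x i \<longrightarrow> 2 \<le> (\<Sum>j<d. x j) \<longrightarrow> ?ex i)"
      unfolding accepting_def pos sb[symmetric] using cls le ge pos' by (simp, blast)
    moreover have "lmda_counts x \<longleftrightarrow> (\<forall>i<d. 0 < x i \<longrightarrow> 2 \<le> (\<Sum>j<d. x j) \<longrightarrow> ?ex i)"
      unfolding lmda_counts_def ex using le ge pos' by blast
    ultimately show ?thesis by blast
  next
    case False
    then have "\<not> accepting g" unfolding accepting_def pos using cls by blast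
    moreover have "\<not> lmda_counts x" using False unfolding lmda_counts_def by blast
    ultimately show ?thesis by blast
  qed
qed

lemma ex_accepting_iff:
  "(\<exists>\<sigma>\<in>ts.reach (n + 2). accepting (\<lambda>c. \<sigma> div ts.B^c mod ts.B)) \<longleftrightarrow> lmda_problem (n, E, k)"
proof -
  have acc: "accepting (\<lambda>c. code ts.B (7*d) (carry d coef thr (n+2) x) div ts.B^c mod ts.B) \<longleftrightarrow>
      lmda_counts x \<and> k \<le> int (\<Sum>j<d. x j)" if x: "\<forall>j<d. x j < 2^(n+2)" for x
  proof (rule accepting_iff)
    fix c assume c: "c < 7 * d"
    have "n + 2 < 2^(n+2)" by (rule less_exp)
    then have "thr c < 2^(n+2)" using thr_le[OF c] by linarith
    from carry_pos_iff[where \<theta> = thr and c = c and i = "n+2", OF this, where a = coef and d = d and x = x]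
    show "code ts.B (7*d) (carry d coef thr (n+2) x) div ts.B^c mod ts.B \<noteq> 0 \<longleftrightarrow>
        thr c \<le> (\<Sum>j<d. coef c j * x j)"
      unfolding ts.reach_digit[OF x c] by simp
  qed
  have small: "\<forall>j<d. x j < 2^(n+2)" if "lmda_counts x" for x
  proof (intro allI impI)
    fix j assume j: "j < d"
    have "x j \<le> card (cls j)" using that j unfolding lmda_counts_def by blast
    then have "x j \<le> n + 2" using card_cls_le[of j] by linarith
    also have "n + 2 < 2^(n+2)" by (rule less_exp)
    finally show "x j < 2^(n+2)" .
  qed
  have "(\<exists>\<sigma>\<in>ts.reach (n + 2). accepting (\<lambda>c. \<sigma> div ts.B^c mod ts.B)) \<longleftrightarrow>
      (\<exists>x. (\<forall>j<d. x j < 2^(n+2)) \<and>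
        accepting (\<lambda>c. code ts.B (7*d) (carry d coef thr (n+2) x) div ts.B^c mod ts.B))"
    unfolding ts.reach_def by auto
  also have "\<dots> \<longleftrightarrow> (\<exists>x. lmda_counts x \<and> k \<le> int (\<Sum>j<d. x j))" using acc small by meson
  finally show ?thesis unfolding lmda_problem_iff_counts .
qed

end

section \<open>The whole program and its running time\<close>

text \<open>The cuts are placed where loop bounds become known: \<open>vn\<close> before the first
  phase, \<open>vd\<close> before the second, \<open>vb\<close> and \<open>vm\<close> before
  \<open>P_powers\<close>, and \<open>vW\<close> and \<open>vZ\<close> before the last.\<close>

definition P_phase1 :: com where "P_phase1 = P_rows ;; P_bound ;; P_reps"
definition P_phase2 :: com where "P_phase2 = P_classes ;; P_sizes"
definition P_phase4 :: com where
  "P_phase4 = P_halves ;; P_table ;; P_thresholds ;; P_columns ;; P_reach ;; P_answer"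

definition lmda_com :: com where
  "lmda_com = Asg vn (In (N 2)) ;; P_phase1 ;; P_phase2 ;; P_powers ;; P_phase4"

lemma wf_lmda_com: "wf_com lmda_com"
  unfolding lmda_com_def P_phase1_def P_phase2_def P_phase4_def by simp

context lmda_input
begin

definition store0 :: store where "store0 = sem xs (Asg vn (In (N 2))) initial_store"
definition store1 :: store where "store1 = sem xs P_phase1 store0"
definition store2 :: store where "store2 = sem xs P_phase2 store1"
definition store3 :: store where "store3 = sem xs P_powers store2"

lemma store0_vn: "fst store0 vn = n"
  unfolding store0_def using input_length input_n by (simp add: Let_def)

lemma store1_props: "reps_ok store1" "fst store1 vk = size_bound"
proof -
  have r: "rows_ok (sem xs P_rows store0)" using rows_spec[OF store0_vn] .
  then have "rows_ok (sem xs P_bound (sem xs P_rows store0))"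
    by (rule rows_ok_frame) (simp_all add: sem_frame_var sem_frame_arr)
  then show "reps_ok store1" unfolding store1_def P_phase1_def sem.simps(3) by (rule reps_spec)
  have "fst (sem xs P_bound (sem xs P_rows store0)) vk = size_bound"
    using r by (intro bound_spec) (simp add: rows_ok_def)
  then show "fst store1 vk = size_bound" unfolding store1_def P_phase1_def sem.simps(3)
    by (simp add: sem_frame_var)
qed

lemma store2_props: "classes_ok store2" "sizes_ok store2" "fst store2 vB = 1" "fst store2 vp = 1" "fst store2 vk = size_bound"
proof -
  have c: "classes_ok (sem xs P_classes store1)" using classes_spec[OF store1_props(1)] .
  then show "classes_ok store2" unfolding store2_def P_phase2_def sem.simps(3)
    by (rule classes_ok_frame) (auto simp: sem_frame_var sem_frame_arr)
  have "reps_ok (sem xs P_classes store1)" using c unfolding classes_ok_def by blast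
  from sizes_spec[OF this] show "sizes_ok store2" "fst store2 vB = 1" "fst store2 vp = 1"
    unfolding store2_def P_phase2_def sem.simps(3) by simp_all
  show "fst store2 vk = size_bound"
    using store1_props(2) unfolding store2_def P_phase2_def by (simp add: sem_frame_var)
qed

lemma store3_props: "classes_ok store3" "consts_ok store3" "fst store3 vk = size_bound"
  "snd store3 aHALF = (\<lambda>_. 0)" "snd store3 aH = (\<lambda>_. 0)" "snd store3 aT = (\<lambda>_. 0)" "snd store3 aU = (\<lambda>_. 0)"
proof -
  show "classes_ok store3" unfolding store3_def
    by (rule classes_ok_frame[OF store2_props(1)]) (auto simp: sem_frame_var sem_frame_arr)
  show "consts_ok store3" unfolding store3_def by (rule powers_spec[OF store2_props(2-4)])
  show "fst store3 vk = size_bound" unfolding store3_def using store2_props(5) by (simp add: sem_frame_var)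
  show "snd store3 aHALF = (\<lambda>_. 0)" "snd store3 aH = (\<lambda>_. 0)" "snd store3 aT = (\<lambda>_. 0)" "snd store3 aU = (\<lambda>_. 0)"
    unfolding store3_def store2_def store1_def store0_def P_phase1_def P_phase2_def initial_store_def
    by (simp_all add: sem_frame_arr)
qed

lemma phase4_spec: "fst (sem xs P_phase4 store3) vans \<noteq> 0 \<longleftrightarrow> lmda_problem (n, E, k)"
proof -
  define t1 where "t1 = sem xs P_halves store3"
  define t2 where "t2 = sem xs P_table t1"
  define t3 where "t3 = sem xs P_thresholds t2"
  define t4 where "t4 = sem xs P_columns t3"
  define t5 where "t5 = sem xs P_reach t4"
  note fr = sem_frame_var sem_frame_arr
  have h1: "halves_ok t1" unfolding t1_def by (rule halves_spec[OF store3_props(2,4)])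
  have c1: "consts_ok t1"
    by (rule consts_ok_frame[OF store3_props(2)]) (auto simp: t1_def fr)
  have "snd t1 aH 0 = 0" using store3_props(5) unfolding t1_def by (simp add: fr)
  then have tab2: "table_ok t2" unfolding t2_def by (rule table_spec[OF c1 h1])
  have c2: "classes_ok t2" by (rule classes_ok_frame[OF store3_props(1)]) (auto simp: t2_def t1_def fr)
  have h2: "halves_ok t2" using h1 unfolding halves_ok_def t2_def by (simp add: fr)
  have "fst t2 vk = size_bound" using store3_props(3) unfolding t2_def t1_def by (simp add: fr)
  then have th3: "thresholds_ok t3" unfolding t3_def by (rule thresholds_spec[OF c2 h2])
  have cl3: "classes_ok t3" by (rule classes_ok_frame[OF c2]) (auto simp: t3_def fr)
  have co3: "consts_ok t3" by (rule consts_ok_frame[OF c1]) (auto simp: t3_def t2_def fr)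
  have col4: "columns_ok t4" unfolding t4_def by (rule columns_spec[OF cl3 co3])
  have co4: "consts_ok t4" by (rule consts_ok_frame[OF co3]) (auto simp: t4_def fr)
  have "halves_ok t4" "table_ok t4" "thresholds_ok t4" "snd t4 aT = (\<lambda>_. 0)" "snd t4 aU = (\<lambda>_. 0)"
    using h2 tab2 th3 store3_props(6,7)
    unfolding halves_ok_def table_ok_def thresholds_ok_def t4_def t3_def t2_def t1_def
    by (simp_all add: fr)
  then have m5: "marks t5 (ts.reach (n + 2))" unfolding t5_def
    by (intro reach_spec[OF co4 _ _ col4])
  have cl5: "classes_ok t5" by (rule classes_ok_frame[OF cl3]) (auto simp: t5_def t4_def fr)
  have co5: "consts_ok t5" by (rule consts_ok_frame[OF co4]) (auto simp: t5_def fr)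
  have tab5: "table_ok t5"
    using tab2 unfolding table_ok_def t5_def t4_def t3_def by (simp add: fr)
  have "fst (sem xs P_answer t5) vans \<noteq> 0 \<longleftrightarrow> lmda_problem (n, E, k)"
    unfolding ex_accepting_iff[symmetric]
    by (rule answer_spec[OF cl5 co5 tab5 m5]) (use ts.reach_less in auto)
  then show ?thesis
    unfolding P_phase4_def sem.simps(3) t1_def t2_def t3_def t4_def t5_def .
qed

lemma lmda_com_correct: "fst (sem xs lmda_com initial_store) vans \<noteq> 0 \<longleftrightarrow> lmda_problem (n, E, k)"
  using phase4_spec unfolding lmda_com_def sem.simps(3) store3_def store2_def store1_def store0_def .

lemma W_pos: "0 < W"
  unfolding ts.B_def by simp

text \<open>The chosen number dominates all loop bounds: \<open>n\<close>, \<open>d\<close>,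
  \<open>d + 2\<close>, \<open>7 * d\<close>, \<open>n + 2\<close>, \<open>W\<close> and
  \<open>W + n + 3\<close>.\<close>

lemma lmda_com_bounded: "loops_bounded xs (W + n + 7 * d + 5) lmda_com initial_store"
proof -
  let ?M = "W + n + 7 * d + 5"
  have "loops_bounded xs ?M P_phase1 store0"
    by (rule loops_bounded_static) (use store0_vn in \<open>auto simp: P_phase1_def\<close>)
  moreover have "loops_bounded xs ?M P_phase2 store1"
    by (rule loops_bounded_static)
      (use store1_props in \<open>auto simp: P_phase2_def reps_ok_def rows_ok_def\<close>)
  moreover have "loops_bounded xs ?M P_powers store2"
    by (rule loops_bounded_static) (use store2_props W_pos in \<open>auto simp: sizes_ok_def\<close>)
  moreover have "loops_bounded xs ?M P_phase4 store3"
    by (rule loops_bounded_static)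
      (use store3_props(2) in \<open>auto simp: P_phase4_def consts_ok_def sizes_ok_def\<close>)
  ultimately show ?thesis
    unfolding lmda_com_def loops_bounded.simps store3_def store2_def store1_def store0_def by blast
qed

lemma input_size_ge: "n + 1 \<le> input_size xs"
proof -
  have "length ys \<le> input_size ys" for ys unfolding input_size_def by (induction ys) auto
  then have "3 + n * n \<le> input_size xs" using input_length by metis
  moreover have "n \<le> n * n" by (cases n) auto
  ultimately show ?thesis by linarith
qed

text \<open>The summand \<open>n\<close> is absorbed by the input size; everything else depends on
  \<open>d\<close> only and is bounded by a power of two in \<open>D\<close>.\<close>

lemma loop_bound_le:
  assumes "D = neighbourhood_diversity {..<n} E"
  shows "Suc (W + n + 7 * d + 5) \<le> 2 ^ (36 * 4^D) * input_size xs"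
proof -
  have dD: "d \<le> D" using d_le_neighbourhood_diversity assms by simp
  have p1: "D \<le> 2^D" by (simp add: less_imp_le)
  then have "D * D \<le> 2^D * 2^D" by (intro mult_mono) auto
  also have "\<dots> = 4^D" by (simp flip: power_mult_distrib)
  finally have DD: "D * D \<le> 4^D" .
  have D4: "D \<le> 4^D" using p1 power_mono[of 2 4 D] by simp
  have W: "W = 2^((d+2)*(7*d))" unfolding ts.B_def by (rule power_mult[symmetric])
  have small: "7 * d + 6 \<le> 2^(7*d+6)" by (simp add: less_imp_le)
  have dd: "(d+2)*(7*d) \<le> (D+2)*(7*D)" using dD by (intro mult_mono) auto
  have one: "1 \<le> input_size xs" and nn: "n \<le> input_size xs" using input_size_ge by simp_all
  let ?S = "input_size xs"
  have "W + 7*d + 6 + 1 \<le> W * (7*d+8)" using W_pos by (cases W) auto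
  also have "\<dots> \<le> 2^((d+2)*(7*d)) * 2^(7*d+8)"
    unfolding W by (intro mult_left_mono) (auto simp: less_imp_le)
  also have "\<dots> = 2^((d+2)*(7*d) + (7*d+8))" by (rule power_add[symmetric])
  also have "\<dots> \<le> 2^(36 * 4^D)"
  proof (rule power_increasing)
    \<comment> \<open>The exponent is at most \<open>7 * (D * D) + 21 * D + 8\<close>. As
      \<open>D * D\<close>, \<open>D\<close> and 1 are at most \<open>4^D\<close>, the constant is 7
      + 21 + 8 = 36.\<close>
    have "(D+2)*(7*D) = 7*(D*D) + 14*D" by (simp add: algebra_simps)
    moreover have "1 \<le> (4::nat)^D" by simp
    ultimately show "(d+2)*(7*d) + (7*d+8) \<le> 36 * 4^D" using dd dD DD D4 by linarith
  qed simp
  finally have le: "W + 7*d + 6 + 1 \<le> 2^(36 * 4^D)" .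
  have "Suc (W + n + 7*d + 5) \<le> (W + 7*d + 6) * 1 + ?S" using nn by simp
  also have "\<dots> \<le> (W + 7*d + 6) * ?S + ?S" using one by (intro add_right_mono mult_left_mono) auto
  also have "\<dots> = (W + 7*d + 6 + 1) * ?S" by (simp add: distrib_right)
  also have "\<dots> \<le> 2^(36 * 4^D) * ?S" using le by (intro mult_right_mono) auto
  finally show ?thesis .
qed

end

text \<open>Two doublings per round give \<open>C * 4 ^ n\<close>, and that many doublings of 1 give
  the value; computability imposes no time bound on the second loop.\<close>

lemma computable_double_exp: "computable (\<lambda>n. 2 ^ (C * 4 ^ n))"
proof -
  define c1 where "c1 = Asg 0 (In (N 0)) ;; Asg 1 (N C) ;; Asg 2 (N 1)"
  define c2 where "c2 = Loop 0 (doubleC 1 ;; doubleC 1)"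
  define c3 where "c3 = Loop 1 (doubleC 2)"
  have "\<exists>t s. exec (answer_prog (c1 ;; c2 ;; c3) 2) (initial_state [m]) t s \<and> result s = 2 ^ (C * 4 ^ m)" for m
  proof -
    define t1 where "t1 = sem [m] c1 initial_store"
    define t2 where "t2 = sem [m] c2 t1"
    have t1: "fst t1 0 = m" "fst t1 1 = C" "fst t1 2 = 1" unfolding t1_def c1_def by (simp_all add: Let_def)
    have "(\<lambda>i t. fst t 1 = C * 4^i) (fst t1 0) t2" unfolding t2_def c2_def
      by (rule Loop_rule) (use t1 in auto)
    then have t2: "fst t2 1 = C * 4^m" "fst t2 2 = 1"
      using t1 unfolding t2_def c2_def by (simp_all add: sem_frame_var)
    let ?M = "m + C * 4^m"
    have "loops_bounded [m] ?M c2 t1" unfolding c2_def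
      by (rule loops_bounded_static) (use t1 in auto)
    moreover have "loops_bounded [m] ?M c3 t2" unfolding c3_def
      by (rule loops_bounded_static) (use t2 in auto)
    moreover have "loops_bounded [m] ?M c1 initial_store" unfolding c1_def by simp
    ultimately have "loops_bounded [m] ?M (c1 ;; c2 ;; c3) initial_store"
      unfolding loops_bounded.simps t1_def t2_def by blast
    moreover have "wf_com (c1 ;; c2 ;; c3)" unfolding c1_def c2_def c3_def by simp
    moreover have "fst (sem [m] (c1 ;; c2 ;; c3) initial_store) 2 = 2 ^ (C * 4^m)"
      unfolding sem.simps(3) t1_def[symmetric] t2_def[symmetric] c3_def
      using Loop_double[of 1 2 "[m]" t2] t2 by simp
    ultimately show ?thesis using exec_answer_prog[of "c1 ;; c2 ;; c3" "[m]" ?M 2] by metis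
  qed
  then show ?thesis unfolding computable_def by blast
qed

theorem theorem3:
  "fixed_parameter_tractable lmda_instances lmda_encoding lmda_problem lmda_parameter"
proof -
  obtain K p where K: "\<And>M. com_time M lmda_com \<le> K * Suc M ^ p" using com_time_poly by blast
  \<comment> \<open>The factor \<open>K + 2\<close>, where 2 pays for copying the answer, is at most
    \<open>2 ^ (K + 2)\<close>; the \<open>p\<close>-th power of the loop bound contributes
    \<open>36 * p\<close> in the exponent.\<close>
  define C where "C = K + 2 + 36 * p"
  have "\<exists>t s. exec (answer_prog lmda_com vans) (initial_state (lmda_encoding x)) t s \<and>
      t \<le> 2 ^ (C * 4 ^ lmda_parameter x) * input_size (lmda_encoding x) ^ p \<and>
      (result s \<noteq> 0 \<longleftrightarrow> lmda_problem x)" if x: "x \<in> lmda_instances" for x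
  proof -
    obtain n E k where nEk: "x = (n, E, k)" by (cases x)
    interpret lmda_input n E k
      by unfold_locales (use x nEk in \<open>simp add: lmda_instances_def\<close>)
    let ?M = "W + n + 7 * d + 5" and ?D = "lmda_parameter x" and ?S = "input_size xs"
    obtain t s where run: "exec (answer_prog lmda_com vans) (initial_state xs) t s"
      "t \<le> com_time ?M lmda_com + 2" "result s = fst (sem xs lmda_com initial_store) vans"
      using exec_answer_prog[OF wf_lmda_com lmda_com_bounded] by blast
    have M: "Suc ?M \<le> 2 ^ (36 * 4^?D) * ?S" by (rule loop_bound_le) (simp add: nEk)
    have S: "1 \<le> ?S" using input_size_ge by simp
    have "1 \<le> Suc ?M ^ p" by (rule one_le_power) simp
    then have "t \<le> (K + 2) * Suc ?M ^ p" using run(2) K[of ?M] unfolding distrib_right by linarith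
    also have "\<dots> \<le> 2^(K+2) * (2 ^ (36 * 4^?D) * ?S) ^ p"
      by (intro mult_mono power_mono M less_imp_le[OF less_exp]) auto
    also have "\<dots> = 2 ^ (K + 2 + 36 * 4^?D * p) * ?S ^ p"
      by (simp only: power_mult_distrib power_mult power_add mult.assoc)
    also have "\<dots> \<le> 2 ^ (C * 4^?D) * ?S ^ p"
    proof (intro mult_right_mono power_increasing)
      have "(K + 2) * 1 \<le> (K + 2) * 4^?D" by (intro mult_left_mono) auto
      then show "K + 2 + 36 * 4^?D * p \<le> C * 4^?D" unfolding C_def by (simp add: algebra_simps)
    qed auto
    finally have "t \<le> 2 ^ (C * 4^?D) * ?S ^ p" .
    then show ?thesis using run lmda_com_correct unfolding xs_def nEk by metis
  qed
  then show ?thesis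
    unfolding fixed_parameter_tractable_def using computable_double_exp[of C] by blast
qed

end
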